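(* Let $F\in\{\mathbb R,\mathbb C\}$ and $(G,H)$ a unitary GGP pair over $F$, with a fixed Haar measure on $Z_H$. Let $K$ be a compact subset of $\mathfrak g^\wedge_{\mathrm{stab}}$. Then there exist a neighborhood $\mathcal Z$ of the identity in $Z_H$, a neighborhood $U$ of the identity in $\bar G$, $r_0>0$ and $C>0$ such that for all $\tau\in K$, $g\in U$ and $0<r<r_0$, \[\mathrm{vol}\{z\in\mathcal Z:\ \mathrm{dist}_F(gz\tau,H\tau)\le r\}\le C\,\frac{r}{d_H(g)}.\]
   Context: Unitary GGP pair: $E$ a quadratic étale $F$-algebra, $V$ a rank $n+1$ nondegenerate hermitian $E$-module, $e\in V$ with $Ee$ nondegenerate, $V_H=(Ee)^\perp$, $G=\mathrm U(V)$, $H=\mathrm U(V_H)$ (real Lie groups of $F$-points), $Z,Z_H$ centers, $\bar G=G/Z\supseteq H$. $\mathfrak g^\wedge=\mathrm{Hom}(\mathfrak g,i\mathbb R)$ with the coadjoint action of $G$ (which factors through $\bar G$); $H\tau$ denotes the $H$-orbit of $\tau$, $gz\tau$ the coadjoint action. $\xi_H$ is the restriction of $\xi$ to $\mathfrak h$. $\mathfrak g^\wedge_{\mathrm{stab}}$ is the set of $\xi\in\mathfrak g^\wedge$ that are stable for $H$ (finite $H$-stabilizer and Zariski-closed $H$-orbit); equivalently the multisets of eigenvalues of $\xi$ and $\xi_H$ (in the standard representations of the dual Lie algebras) are disjoint. Fix an inner product on $\mathfrak g^\wedge$ with norm $|\cdot|$; $\mathrm{dist}(\xi,S)=\inf_{\eta\in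 S}|\xi-\eta|$ and $\mathrm{dist}_F=\mathrm{dist}^{[F:\mathbb R]}$. $d_H:\bar G\to[0,1]$: for a fixed $F$-norm $|\cdot|_F$ on $V$ ($|tv|_F=|t|_F|v|_F$, $|t|_{\mathbb R}=|t|$, $|t|_{\mathbb C}=|t|^2$), $\tilde d_H(g)=|ge/\langle ge,e\rangle-e/\langle e,e\rangle|_F$ (computed on any lift to $\mathrm{GL}(V/E)$; $\infty$ if $\langle ge,e\rangle\notin E^\times$) and $d_H(g)=\min(1,\tilde d_H(g)+\tilde d_H(g^{-1}))$. *)

theory Defs
  imports "HOL-Analysis.Analysis" "HOL-Algebra.Coset"
begin

text \<open>
  The field \<open>F\<close> is a subset of the complex numbers, namely \<open>\<real>\<close> or \<open>UNIV\<close>.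
  The \<open>F\<close>-algebra \<open>E\<close> is the type \<open>'e\<close>, with structure map \<open>\<iota>\<close> (used on \<open>F\<close> only)
  and involution \<open>\<sigma>\<close>. The \<open>E\<close>-module \<open>V\<close> is the type \<open>'v\<close>, with scalar multiplication
  \<open>sm\<close> and hermitian form \<open>h\<close>. The class \<open>euclidean_space\<close> only serves to give \<open>V\<close> and
  its endomorphisms their topology as finite-dimensional real vector spaces: its inner
  product is unrelated to \<open>h\<close>.
\<close>

definition deg_over_real :: "complex set \<Rightarrow> nat" where
  "deg_over_real F = (if F = \<real> then 1 else 2)"

section \<open>Quadratic etale algebras and hermitian modules\<close>

definition algebra_map :: "complex set \<Rightarrow> (complex \<Rightarrow> 'e::comm_ring_1) \<Rightarrow> bool" where
  "algebra_map F \<iota> \<longleftrightarrow> \<iota> 1 = 1 \<and>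
     (\<forall>s\<in>F. \<forall>t\<in>F. \<iota> (s + t) = \<iota> s + \<iota> t \<and> \<iota> (s * t) = \<iota> s * \<iota> t)"

text \<open>
  An etale algebra is a finite product of finite separable field extensions. In rank 2 it
  is therefore a field or isomorphic to \<open>F \<times> F\<close>; separability is automatic in
  characteristic 0. The maps \<open>p\<close>, \<open>q\<close> below are the two components of an isomorphism
  from \<open>E\<close> onto \<open>F \<times> F\<close>.
\<close>

definition quadratic_etale :: "complex set \<Rightarrow> (complex \<Rightarrow> 'e::comm_ring_1) \<Rightarrow> bool" where
  "quadratic_etale F \<iota> \<longleftrightarrow> algebra_map F \<iota> \<and>
     (\<exists>a b. \<forall>x. \<exists>!(s, t). s \<in> F \<and> t \<in> F \<and> x = \<iota> s * a + \<iota> t * b) \<and>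
     ((\<forall>x::'e. x \<noteq> 0 \<longrightarrow> x dvd 1) \<or>
      (\<exists>p q. bij_betw (\<lambda>x. (p x, q x)) UNIV (F \<times> F) \<and>
         (\<forall>x y. p (x + y) = p x + p y \<and> q (x + y) = q x + q y) \<and>
         (\<forall>x y. p (x * y) = p x * p y \<and> q (x * y) = q x * q y) \<and>
         (\<forall>t\<in>F. p (\<iota> t) = t \<and> q (\<iota> t) = t)))"

definition nontrivial_involution ::
    "complex set \<Rightarrow> (complex \<Rightarrow> 'e::comm_ring_1) \<Rightarrow> ('e \<Rightarrow> 'e) \<Rightarrow> bool" where
  "nontrivial_involution F \<iota> \<sigma> \<longleftrightarrow> bij \<sigma> \<and> \<sigma> \<noteq> id \<and> \<sigma> 1 = 1 \<and>
     (\<forall>x y. \<sigma> (x + y) = \<sigma> x + \<sigma> y \<and> \<sigma> (x * y) = \<sigma> x * \<sigma> y) \<and>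
     (\<forall>x. \<sigma> (\<sigma> x) = x) \<and> (\<forall>t\<in>F. \<sigma> (\<iota> t) = \<iota> t)"

definition hermitian_form ::
    "('e::comm_ring_1 \<Rightarrow> 'e) \<Rightarrow> ('e \<Rightarrow> 'v::ab_group_add \<Rightarrow> 'v) \<Rightarrow> ('v \<Rightarrow> 'v \<Rightarrow> 'e) \<Rightarrow> bool" where
  "hermitian_form \<sigma> sm h \<longleftrightarrow>
     (\<forall>u v w. h (u + v) w = h u w + h v w) \<and>
     (\<forall>a v w. h (sm a v) w = a * h v w) \<and>
     (\<forall>v w. h w v = \<sigma> (h v w))"

definition nondegenerate_on :: "('v::ab_group_add \<Rightarrow> 'v \<Rightarrow> 'e::comm_ring_1) \<Rightarrow> 'v set \<Rightarrow> bool" where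
  "nondegenerate_on h W \<longleftrightarrow> (\<forall>v\<in>W. (\<forall>w\<in>W. h v w = 0) \<longrightarrow> v = 0)"

definition orth :: "('v \<Rightarrow> 'v \<Rightarrow> 'e::comm_ring_1) \<Rightarrow> 'v set \<Rightarrow> 'v set" where
  "orth h W = {v. \<forall>w\<in>W. h v w = 0}"

text \<open>
  Without the condition \<open>e \<noteq> 0\<close> the zero module \<open>Ee = 0\<close> would count as nondegenerate,
  and \<open>(Ee)\<^sup>\<bottom>\<close> would not have rank \<open>n\<close>.
\<close>

locale unitary_GGP_pair =
  fixes F :: "complex set"
    and \<iota> :: "complex \<Rightarrow> 'e::comm_ring_1"
    and \<sigma> :: "'e \<Rightarrow> 'e"
    and sm :: "'e \<Rightarrow> 'v::euclidean_space \<Rightarrow> 'v"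
    and h :: "'v \<Rightarrow> 'v \<Rightarrow> 'e"
    and n :: nat
    and e :: 'v
  assumes base_field: "F \<in> {\<real>, UNIV}"
    and etale: "quadratic_etale F \<iota>"
    and involution: "nontrivial_involution F \<iota> \<sigma>"
    and E_module: "module sm"
    and scaleR_compat: "\<And>r v. sm (\<iota> (complex_of_real r)) v = r *\<^sub>R v"
    and free_rank: "\<exists>B. finite B \<and> card B = n + 1 \<and> \<not> module.dependent sm B \<and> module.span sm B = UNIV"
    and hermitian: "hermitian_form \<sigma> sm h"
    and nondegenerate: "nondegenerate_on h UNIV"
    and e_nonzero: "e \<noteq> 0"
    and e_nondegenerate: "nondegenerate_on h (module.span sm {e})"

section \<open>The groups\<close>

text \<open>
  The unitary group of a submodule \<open>W\<close>, embedded in the unitary group of \<open>V\<close> by acting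
  trivially on the orthogonal complement of \<open>W\<close>.
\<close>

definition unitary_group ::
    "('e::comm_ring_1 \<Rightarrow> 'v::euclidean_space \<Rightarrow> 'v) \<Rightarrow> ('v \<Rightarrow> 'v \<Rightarrow> 'e) \<Rightarrow> 'v set \<Rightarrow> ('v \<Rightarrow>\<^sub>L 'v) monoid" where
  "unitary_group sm h W =
     \<lparr>carrier = {g. module_hom sm sm (blinfun_apply g) \<and>
                    (\<forall>v w. h (blinfun_apply g v) (blinfun_apply g w) = h v w) \<and>
                    (\<forall>v\<in>orth h W. blinfun_apply g v = v)},
      monoid.mult = (o\<^sub>L), one = id_blinfun\<rparr>"

abbreviation grp_G ::
    "('e::comm_ring_1 \<Rightarrow> 'v::euclidean_space \<Rightarrow> 'v) \<Rightarrow> ('v \<Rightarrow> 'v \<Rightarrow> 'e) \<Rightarrow> ('v \<Rightarrow>\<^sub>L 'v) monoid" where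
  "grp_G sm h \<equiv> unitary_group sm h UNIV"

abbreviation grp_H ::
    "('e::comm_ring_1 \<Rightarrow> 'v::euclidean_space \<Rightarrow> 'v) \<Rightarrow> ('v \<Rightarrow> 'v \<Rightarrow> 'e) \<Rightarrow> 'v \<Rightarrow> ('v \<Rightarrow>\<^sub>L 'v) monoid" where
  "grp_H sm h e \<equiv> unitary_group sm h (orth h (module.span sm {e}))"

definition group_center :: "('a, 'b) monoid_scheme \<Rightarrow> 'a set" where
  "group_center G = {z \<in> carrier G. \<forall>g\<in>carrier G. z \<otimes>\<^bsub>G\<^esub> g = g \<otimes>\<^bsub>G\<^esub> z}"

definition adjoint_group :: "('a, 'b) monoid_scheme \<Rightarrow> 'a set monoid" where
  "adjoint_group G = G Mod group_center G"

text \<open>The quotient topology on \<open>G/Z\<close>, where \<open>G\<close> carries the subspace topology.\<close>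

definition adjoint_topology :: "('a::topological_space, 'b) monoid_scheme \<Rightarrow> 'a set topology" where
  "adjoint_topology G = topology (\<lambda>U. U \<subseteq> carrier (adjoint_group G) \<and>
     openin (top_of_set (carrier G)) {g \<in> carrier G. group_center G #>\<^bsub>G\<^esub> g \<in> U})"

lemma openin_adjoint_topology:
  "openin (adjoint_topology G) U \<longleftrightarrow> U \<subseteq> carrier (adjoint_group G) \<and>
     openin (top_of_set (carrier G)) {g \<in> carrier G. group_center G #>\<^bsub>G\<^esub> g \<in> U}"
proof -
  let ?q = "\<lambda>g. group_center G #>\<^bsub>G\<^esub> g"
  have "istopology (\<lambda>U. U \<subseteq> carrier (adjoint_group G) \<and>
     openin (top_of_set (carrier G)) {g \<in> carrier G. ?q g \<in> U})"
    unfolding istopology_def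
  proof (intro conjI allI impI)
    fix S T
    assume S: "S \<subseteq> carrier (adjoint_group G) \<and> openin (top_of_set (carrier G)) {g \<in> carrier G. ?q g \<in> S}"
      and T: "T \<subseteq> carrier (adjoint_group G) \<and> openin (top_of_set (carrier G)) {g \<in> carrier G. ?q g \<in> T}"
    show "S \<inter> T \<subseteq> carrier (adjoint_group G)" using S by blast
    have eq: "{g \<in> carrier G. ?q g \<in> S \<inter> T} = {g \<in> carrier G. ?q g \<in> S} \<inter> {g \<in> carrier G. ?q g \<in> T}"
      by blast
    show "openin (top_of_set (carrier G)) {g \<in> carrier G. ?q g \<in> S \<inter> T}"
      unfolding eq by (rule openin_Int[OF conjunct2[OF S] conjunct2[OF T]])
  next
    fix \<K>
    assume K: "\<forall>S\<in>\<K>. S \<subseteq> carrier (adjoint_group G) \<and> openin (top_of_set (carrier G)) {g \<in> carrier G. ?q g \<in> S}"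
    show "\<Union>\<K> \<subseteq> carrier (adjoint_group G)" using K by blast
    have eq: "{g \<in> carrier G. ?q g \<in> \<Union>\<K>} = \<Union>((\<lambda>S. {g \<in> carrier G. ?q g \<in> S}) ` \<K>)"
      by blast
    show "openin (top_of_set (carrier G)) {g \<in> carrier G. ?q g \<in> \<Union>\<K>}"
      unfolding eq using K by (intro openin_Union) blast
  qed
  then show ?thesis
    unfolding adjoint_topology_def by (subst topology_inverse') (assumption, rule refl)
qed

definition is_neighborhood :: "'a topology \<Rightarrow> 'a \<Rightarrow> 'a set \<Rightarrow> bool" where
  "is_neighborhood X x N \<longleftrightarrow> N \<subseteq> topspace X \<and> x \<in> X interior_of N"

definition is_haar_measure ::
    "('v::euclidean_space \<Rightarrow>\<^sub>L 'v) set \<Rightarrow> ('v \<Rightarrow>\<^sub>L 'v) measure \<Rightarrow> bool" where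
  "is_haar_measure A \<mu> \<longleftrightarrow>
     space \<mu> = A \<and> sets \<mu> = sets (restrict_space borel A) \<and>
     (\<forall>a\<in>A. \<forall>S\<in>sets \<mu>. emeasure \<mu> ((\<lambda>x. a o\<^sub>L x) ` S) = emeasure \<mu> S) \<and>
     (\<forall>C\<subseteq>A. compact C \<longrightarrow> emeasure \<mu> C < \<infinity>) \<and>
     emeasure \<mu> A \<noteq> 0"

section \<open>The dual of the Lie algebra and the coadjoint action\<close>

definition lie_algebra ::
    "('e::comm_ring_1 \<Rightarrow> 'v::euclidean_space \<Rightarrow> 'v) \<Rightarrow> ('v \<Rightarrow> 'v \<Rightarrow> 'e) \<Rightarrow> ('v \<Rightarrow>\<^sub>L 'v) set" where
  "lie_algebra sm h = {X. module_hom sm sm (blinfun_apply X) \<and>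
     (\<forall>v w. h (blinfun_apply X v) w + h v (blinfun_apply X w) = 0)}"

type_synonym 'v functional = "('v \<Rightarrow>\<^sub>L 'v) \<Rightarrow> complex"

text \<open>
  Real-linear maps from \<open>\<gg>\<close> to \<open>i\<real>\<close>, made into functions on all of \<open>End(V)\<close> by the value
  0 outside \<open>\<gg>\<close>. On this finite-dimensional space the topology of pointwise convergence,
  which is the one of the function type, is the usual vector space topology.
\<close>

definition lie_dual ::
    "('e::comm_ring_1 \<Rightarrow> 'v::euclidean_space \<Rightarrow> 'v) \<Rightarrow> ('v \<Rightarrow> 'v \<Rightarrow> 'e) \<Rightarrow> 'v functional set" where
  "lie_dual sm h = {\<xi>.
     (\<forall>X\<in>lie_algebra sm h. \<forall>Y\<in>lie_algebra sm h. \<xi> (X + Y) = \<xi> X + \<xi> Y) \<and>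
     (\<forall>r. \<forall>X\<in>lie_algebra sm h. \<xi> (r *\<^sub>R X) = r *\<^sub>R \<xi> X) \<and>
     (\<forall>X\<in>lie_algebra sm h. Re (\<xi> X) = 0) \<and>
     (\<forall>X. X \<notin> lie_algebra sm h \<longrightarrow> \<xi> X = 0)}"

definition coad ::
    "('e::comm_ring_1 \<Rightarrow> 'v::euclidean_space \<Rightarrow> 'v) \<Rightarrow> ('v \<Rightarrow> 'v \<Rightarrow> 'e) \<Rightarrow> ('v \<Rightarrow>\<^sub>L 'v) \<Rightarrow>
     'v functional \<Rightarrow> 'v functional" where
  "coad sm h g \<xi> = (\<lambda>X. \<xi> (inv\<^bsub>grp_G sm h\<^esub> g o\<^sub>L X o\<^sub>L g))"

definition H_orbit ::
    "('e::comm_ring_1 \<Rightarrow> 'v::euclidean_space \<Rightarrow> 'v) \<Rightarrow> ('v \<Rightarrow> 'v \<Rightarrow> 'e) \<Rightarrow> 'v \<Rightarrow>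
     'v functional \<Rightarrow> 'v functional set" where
  "H_orbit sm h e \<xi> = (\<lambda>g. coad sm h g \<xi>) ` carrier (grp_H sm h e)"

definition H_stabilizer ::
    "('e::comm_ring_1 \<Rightarrow> 'v::euclidean_space \<Rightarrow> 'v) \<Rightarrow> ('v \<Rightarrow> 'v \<Rightarrow> 'e) \<Rightarrow> 'v \<Rightarrow>
     'v functional \<Rightarrow> ('v \<Rightarrow>\<^sub>L 'v) set" where
  "H_stabilizer sm h e \<xi> = {g \<in> carrier (grp_H sm h e). coad sm h g \<xi> = \<xi>}"

section \<open>Zariski topology and stability\<close>

text \<open>
  \<open>\<gg>\<^sup>\<and>\<close> as a vector space over \<open>F\<close>: \<open>(t\<xi>)(X) = \<xi>(tX)\<close>. For real \<open>t\<close> this is the pointwise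
  scalar multiplication. For \<open>F = \<complex>\<close> the values of \<open>t\<xi>\<close> remain in \<open>i\<real>\<close>.
\<close>

definition dual_scale ::
    "(complex \<Rightarrow> 'e::comm_ring_1) \<Rightarrow> ('e \<Rightarrow> 'v::euclidean_space \<Rightarrow> 'v) \<Rightarrow> complex \<Rightarrow>
     'v functional \<Rightarrow> 'v functional" where
  "dual_scale \<iota> sm t \<xi> = (\<lambda>X. \<xi> (Blinfun (\<lambda>v. sm (\<iota> t) (blinfun_apply X v))))"

definition dual_linear ::
    "complex set \<Rightarrow> (complex \<Rightarrow> 'e::comm_ring_1) \<Rightarrow> ('e \<Rightarrow> 'v::euclidean_space \<Rightarrow> 'v) \<Rightarrow>
     ('v \<Rightarrow> 'v \<Rightarrow> 'e) \<Rightarrow> ('v functional \<Rightarrow> complex) \<Rightarrow> bool" where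
  "dual_linear F \<iota> sm h L \<longleftrightarrow>
     (\<forall>\<xi>\<in>lie_dual sm h. L \<xi> \<in> F) \<and>
     (\<forall>\<xi>\<in>lie_dual sm h. \<forall>\<eta>\<in>lie_dual sm h. L (\<lambda>X. \<xi> X + \<eta> X) = L \<xi> + L \<eta>) \<and>
     (\<forall>t\<in>F. \<forall>\<xi>\<in>lie_dual sm h. L (dual_scale \<iota> sm t \<xi>) = t * L \<xi>)"

inductive_set dual_polynomials ::
    "complex set \<Rightarrow> (complex \<Rightarrow> 'e::comm_ring_1) \<Rightarrow> ('e \<Rightarrow> 'v::euclidean_space \<Rightarrow> 'v) \<Rightarrow>
     ('v \<Rightarrow> 'v \<Rightarrow> 'e) \<Rightarrow> ('v functional \<Rightarrow> complex) set"
  for F :: "complex set" and \<iota> :: "complex \<Rightarrow> 'e::comm_ring_1"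
    and sm :: "'e \<Rightarrow> 'v::euclidean_space \<Rightarrow> 'v" and h :: "'v \<Rightarrow> 'v \<Rightarrow> 'e"
where
  const: "c \<in> F \<Longrightarrow> (\<lambda>_. c) \<in> dual_polynomials F \<iota> sm h"
| linear: "dual_linear F \<iota> sm h L \<Longrightarrow> L \<in> dual_polynomials F \<iota> sm h"
| add: "p \<in> dual_polynomials F \<iota> sm h \<Longrightarrow> q \<in> dual_polynomials F \<iota> sm h \<Longrightarrow>
        (\<lambda>\<xi>. p \<xi> + q \<xi>) \<in> dual_polynomials F \<iota> sm h"
| mult: "p \<in> dual_polynomials F \<iota> sm h \<Longrightarrow> q \<in> dual_polynomials F \<iota> sm h \<Longrightarrow>
        (\<lambda>\<xi>. p \<xi> * q \<xi>) \<in> dual_polynomials F \<iota> sm h"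

definition zariski_closed ::
    "complex set \<Rightarrow> (complex \<Rightarrow> 'e::comm_ring_1) \<Rightarrow> ('e \<Rightarrow> 'v::euclidean_space \<Rightarrow> 'v) \<Rightarrow>
     ('v \<Rightarrow> 'v \<Rightarrow> 'e) \<Rightarrow> 'v functional set \<Rightarrow> bool" where
  "zariski_closed F \<iota> sm h S \<longleftrightarrow>
     (\<exists>P \<subseteq> dual_polynomials F \<iota> sm h. S = {\<xi> \<in> lie_dual sm h. \<forall>p\<in>P. p \<xi> = 0})"

definition lie_dual_stab ::
    "complex set \<Rightarrow> (complex \<Rightarrow> 'e::comm_ring_1) \<Rightarrow> ('e \<Rightarrow> 'v::euclidean_space \<Rightarrow> 'v) \<Rightarrow>
     ('v \<Rightarrow> 'v \<Rightarrow> 'e) \<Rightarrow> 'v \<Rightarrow> 'v functional set" where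
  "lie_dual_stab F \<iota> sm h e = {\<xi> \<in> lie_dual sm h.
     finite (H_stabilizer sm h e \<xi>) \<and> zariski_closed F \<iota> sm h (H_orbit sm h e \<xi>)}"

section \<open>Distances\<close>

definition is_inner_product_on_dual ::
    "('e::comm_ring_1 \<Rightarrow> 'v::euclidean_space \<Rightarrow> 'v) \<Rightarrow> ('v \<Rightarrow> 'v \<Rightarrow> 'e) \<Rightarrow>
     ('v functional \<Rightarrow> 'v functional \<Rightarrow> real) \<Rightarrow> bool" where
  "is_inner_product_on_dual sm h ip \<longleftrightarrow>
     (\<forall>\<xi>\<in>lie_dual sm h. \<forall>\<eta>\<in>lie_dual sm h. ip \<xi> \<eta> = ip \<eta> \<xi>) \<and>
     (\<forall>\<xi>\<in>lie_dual sm h. \<forall>\<eta>\<in>lie_dual sm h. \<forall>\<zeta>\<in>lie_dual sm h.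
        ip (\<lambda>X. \<xi> X + \<eta> X) \<zeta> = ip \<xi> \<zeta> + ip \<eta> \<zeta>) \<and>
     (\<forall>r. \<forall>\<xi>\<in>lie_dual sm h. \<forall>\<eta>\<in>lie_dual sm h. ip (\<lambda>X. r *\<^sub>R \<xi> X) \<eta> = r * ip \<xi> \<eta>) \<and>
     (\<forall>\<xi>\<in>lie_dual sm h. \<xi> \<noteq> (\<lambda>X. 0) \<longrightarrow> ip \<xi> \<xi> > 0)"

definition dual_norm :: "('v functional \<Rightarrow> 'v functional \<Rightarrow> real) \<Rightarrow> 'v::euclidean_space functional \<Rightarrow> real" where
  "dual_norm ip \<xi> = sqrt (ip \<xi> \<xi>)"

definition dual_dist ::
    "('v functional \<Rightarrow> 'v functional \<Rightarrow> real) \<Rightarrow> 'v::euclidean_space functional \<Rightarrow> 'v functional set \<Rightarrow> real" where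
  "dual_dist ip \<xi> S = (INF \<eta>\<in>S. dual_norm ip (\<lambda>X. \<xi> X - \<eta> X))"

definition dist_F ::
    "complex set \<Rightarrow> ('v functional \<Rightarrow> 'v functional \<Rightarrow> real) \<Rightarrow> 'v::euclidean_space functional \<Rightarrow>
     'v functional set \<Rightarrow> real" where
  "dist_F F ip \<xi> S = dual_dist ip \<xi> S ^ deg_over_real F"

text \<open>
  An \<open>F\<close>-norm is the power with exponent \<open>[F:\<real>]\<close> of a norm that is homogeneous over \<open>F\<close>;
  so \<open>|tv|\<^sub>F = |t|\<^sub>F |v|\<^sub>F\<close>, and for \<open>F = \<complex>\<close> the triangle inequality holds for the square root.
\<close>

definition is_F_norm ::
    "complex set \<Rightarrow> (complex \<Rightarrow> 'e::comm_ring_1) \<Rightarrow> ('e \<Rightarrow> 'v::euclidean_space \<Rightarrow> 'v) \<Rightarrow> ('v \<Rightarrow> real) \<Rightarrow> bool" where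
  "is_F_norm F \<iota> sm N \<longleftrightarrow> (\<exists>\<nu>.
     (\<forall>v. \<nu> v \<ge> 0) \<and> (\<forall>v. \<nu> v = 0 \<longleftrightarrow> v = 0) \<and>
     (\<forall>v w. \<nu> (v + w) \<le> \<nu> v + \<nu> w) \<and>
     (\<forall>t\<in>F. \<forall>v. \<nu> (sm (\<iota> t) v) = cmod t * \<nu> v) \<and>
     (\<forall>v. N v = \<nu> v ^ deg_over_real F))"

definition unit_inverse :: "'e::comm_ring_1 \<Rightarrow> 'e" where
  "unit_inverse a = (THE b. a * b = 1)"

text \<open>
  The functions below take an element of \<open>G\<close>, which stands for its class in \<open>G/Z\<close>: the value
  is the same for every lift, because \<open>Z\<close> acts by scalars and \<open>h\<close> is linear in its first
  argument.
\<close>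

definition dtilde_H ::
    "('e::comm_ring_1 \<Rightarrow> 'v::euclidean_space \<Rightarrow> 'v) \<Rightarrow> ('v \<Rightarrow> 'v \<Rightarrow> 'e) \<Rightarrow> 'v \<Rightarrow> ('v \<Rightarrow> real) \<Rightarrow>
     ('v \<Rightarrow>\<^sub>L 'v) \<Rightarrow> ennreal" where
  "dtilde_H sm h e N g =
     (let ge = blinfun_apply g e in
      if h ge e dvd 1
      then ennreal (N (sm (unit_inverse (h ge e)) ge - sm (unit_inverse (h e e)) e))
      else \<infinity>)"

definition d_H ::
    "('e::comm_ring_1 \<Rightarrow> 'v::euclidean_space \<Rightarrow> 'v) \<Rightarrow> ('v \<Rightarrow> 'v \<Rightarrow> 'e) \<Rightarrow> 'v \<Rightarrow> ('v \<Rightarrow> real) \<Rightarrow>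
     ('v \<Rightarrow>\<^sub>L 'v) \<Rightarrow> ennreal" where
  "d_H sm h e N g = min 1 (dtilde_H sm h e N g + dtilde_H sm h e N (inv\<^bsub>grp_G sm h\<^esub> g))"

end

theory Submission
  imports Defs
begin

text \<open>
  Via the trace form an element of the dual of the Lie algebra is a skew \<open>E\<close>-linear operator \<open>T\<close>, and
  the functions \<open>T \<mapsto> h(T\<^sup>i e, e)\<close> are invariant under \<open>H\<close>. If \<open>T\<close> is stable then \<open>e\<close> is a cyclic vector:
  otherwise the orthogonal complement \<open>S\<close> of \<open>E[T]e\<close> is nonzero; either \<open>S\<close> is nondegenerate
  and the scalars of norm 1 on \<open>S\<close> stabilise \<open>T\<close>, or its radical is a nonzero isotropic \<open>T\<close>-stable submodule of
  \<open>V\<^sub>H\<close>, which gives a one-parameter subgroup of \<open>H\<close> along which \<open>T\<close> degenerates to a point with infinite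
  stabiliser; that point lies in the orbit because the orbit is closed.

  Write \<open>g\<inverse>e = \<alpha>e + u\<close> with \<open>u \<in> V\<^sub>H\<close>, so that \<open>d\<^sub>H(g)\<close> is at most a multiple of \<open>\<bar>u\<bar>\<^sub>F\<close>, and let \<open>z \<in> Z\<^sub>H\<close> be the scalar \<open>t\<close>.
  The change of the \<open>i\<close>-th invariant from \<open>T\<close> to \<open>gzT\<close> is \<open>A + Bt + Ct\<inverse>\<close> with
  \<open>A = O(\<bar>u\<bar>\<^sup>2)\<close>, and by cyclicity \<open>max(\<bar>B\<bar>, \<bar>C\<bar>) \<ge> c\<bar>u\<bar>\<close> for some \<open>i\<close>, uniformly on the compact set. For \<open>t\<close> near 1 this
  is either bounded below by a multiple of \<open>\<bar>u\<bar>\<close> or expands distances by that factor. So the \<open>z\<close> that move \<open>T\<close> to within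
  \<open>\<rho>\<close> of its orbit form a set of diameter \<open>O(\<rho>/\<bar>u\<bar>)\<close>, and a packing argument bounds its Haar measure.
\<close>

section \<open>Coordinates on the quadratic algebra\<close>

text \<open>The exponents match because, for nonzero \<open>VH\<close>, the center of
  \<open>H\<close> consists of norm-one scalars of \<open>E\<close>, a group of real dimension
  \<open>q = [F:\<real>]\<close>: a disc of radius \<open>\<rho>/|u|\<close> in it has measure
  \<open>O((\<rho>/|u|)^q)\<close>, and with \<open>\<rho>^q = r\<close> and
  \<open>d_H(g) = O(|u|^q)\<close> this becomes \<open>r/d_H(g)\<close>. The obstacle is the
  constant term \<open>A\<close>. If it could be of order \<open>|u|\<close>, then
  \<open>B = C\<close>, \<open>A = -2B\<close> would give \<open>B (t - 1)^2 / t\<close>, whose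
  double zero at 1 allows only a square-root bound. It is quadratic in \<open>u\<close> because
  unitarity gives \<open>h(w, w) = h(e, e)\<close> for the image \<open>w\<close> of
  \<open>e\<close> under the inverse of \<open>g\<close>, hence
  \<open>\<alpha> \<sigma>(\<alpha>) - 1 = -h(u, u)/h(e, e)\<close>. Orbits of \<open>H\<close> may
  be unbounded, but only orbit points at distance at most 1 from \<open>gzT\<close> matter, and
  \<open>gzT\<close> stays bounded, so the invariants are uniformly Lipschitz where they are
  compared. Up to bounded factors \<open>B\<close> and \<open>C\<close> are the two coordinates of
  \<open>h(T^i e, u)\<close>, so one of them is nonzero even when this element is a zero
  divisor.\<close>

text \<open>
  The maps \<open>p\<close> and \<open>p \<circ> \<sigma>\<close> together embed \<open>E\<close> into \<open>\<complex> \<times> \<complex>\<close>: with \<open>\<omega> = 1\<close> this is the split case,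
  with \<open>\<omega> = \<i>\<close> the case \<open>E = \<complex>\<close> over \<open>F = \<real>\<close>. This treats all cases at once.
\<close>

locale GGP_coordinates = unitary_GGP_pair F \<iota> \<sigma> sm h n e
  for F :: "complex set" and \<iota> :: "complex \<Rightarrow> 'e::comm_ring_1" and \<sigma> :: "'e \<Rightarrow> 'e"
    and sm :: "'e \<Rightarrow> 'v::euclidean_space \<Rightarrow> 'v" and h :: "'v \<Rightarrow> 'v \<Rightarrow> 'e" and n :: nat and e :: 'v +
  fixes p :: "'e \<Rightarrow> complex" and \<delta> :: 'e and \<omega> :: complex
  assumes p_add: "p (x + y) = p x + p y"
    and p_mult: "p (x * y) = p x * p y"
    and p_1: "p 1 = 1"
    and p_iota: "t \<in> F \<Longrightarrow> p (\<iota> t) = t"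
    and sigma_delta: "\<sigma> \<delta> = - \<delta>"
    and p_delta: "p \<delta> = \<omega>"
    and omega: "\<omega> = 1 \<or> (\<omega> = \<i> \<and> F = \<real>)"
    and decomp: "\<exists>s\<in>F. \<exists>t\<in>F. x = \<iota> s + \<iota> t * \<delta>"

section \<open>Arithmetic of the quadratic algebra and a normalised generator\<close>

context unitary_GGP_pair
begin

lemma F_closed:
  "0 \<in> F" "1 \<in> F" "s \<in> F \<Longrightarrow> t \<in> F \<Longrightarrow> s + t \<in> F" "s \<in> F \<Longrightarrow> t \<in> F \<Longrightarrow> s * t \<in> F"
  "s \<in> F \<Longrightarrow> - s \<in> F" "s \<in> F \<Longrightarrow> t \<in> F \<Longrightarrow> s - t \<in> F" "s \<in> F \<Longrightarrow> inverse s \<in> F" "complex_of_real r \<in> F"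
  "s \<in> F \<Longrightarrow> t \<in> F \<Longrightarrow> s / t \<in> F"
  using base_field by auto

lemma iota_hom: "s \<in> F \<Longrightarrow> t \<in> F \<Longrightarrow> \<iota> (s + t) = \<iota> s + \<iota> t"
  "s \<in> F \<Longrightarrow> t \<in> F \<Longrightarrow> \<iota> (s * t) = \<iota> s * \<iota> t" "\<iota> 1 = 1"
  using etale unfolding quadratic_etale_def algebra_map_def by auto

lemma iota_0: "\<iota> 0 = 0"
  using iota_hom(1)[of 0 0] F_closed by simp

lemma iota_minus: "s \<in> F \<Longrightarrow> \<iota> (- s) = - \<iota> s"
  using iota_hom(1)[of s "- s"] F_closed iota_0 by (simp add: eq_neg_iff_add_eq_0 add.commute)

lemma iota_diff: "s \<in> F \<Longrightarrow> t \<in> F \<Longrightarrow> \<iota> (s - t) = \<iota> s - \<iota> t"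
  using iota_hom(1)[of s "- t"] iota_minus F_closed by simp

lemma sigma_hom: "\<sigma> (x + y) = \<sigma> x + \<sigma> y" "\<sigma> (x * y) = \<sigma> x * \<sigma> y" "\<sigma> 1 = 1" "\<sigma> (\<sigma> x) = x"
  "t \<in> F \<Longrightarrow> \<sigma> (\<iota> t) = \<iota> t"
  using involution unfolding nontrivial_involution_def by auto

lemma sigma_0: "\<sigma> 0 = 0"
  using sigma_hom(1)[of 0 0] by simp

lemma sigma_minus: "\<sigma> (- x) = - \<sigma> x"
  using sigma_hom(1)[of x "- x"] sigma_0 by (simp add: eq_neg_iff_add_eq_0 add.commute)

lemma sigma_diff: "\<sigma> (x - y) = \<sigma> x - \<sigma> y"
  using sigma_hom(1)[of x "- y"] sigma_minus by simp

lemma iota_cancel: "s \<in> F \<Longrightarrow> s \<noteq> 0 \<Longrightarrow> \<iota> s * x = 0 \<Longrightarrow> x = 0"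
proof -
  assume s: "s \<in> F" "s \<noteq> 0" "\<iota> s * x = 0"
  have "\<iota> (inverse s) * \<iota> s = 1"
    using iota_hom(2)[of "inverse s" s] s F_closed iota_hom(3) by simp
  then show "x = 0" using s(3) by (metis mult.assoc mult.left_neutral mult_zero_right)
qed

lemma iota_2: "\<iota> 2 * x = x + x"
proof -
  have "\<iota> 2 = \<iota> 1 + \<iota> 1" using iota_hom(1)[of 1 1] F_closed by simp
  then show ?thesis using iota_hom(3) by (simp add: distrib_right)
qed

lemma double_cancel: "(x::'e) + x = 0 \<Longrightarrow> x = 0"
  using iota_cancel[of 2 x] iota_2[of x] F_closed(8)[of 2] by simp

text \<open>A nonzero element of square zero cannot be a unit, and in the split case both components
  have square zero. This excludes the dual numbers, where an antifixed generator would have square 0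
  and could not be normalised.\<close>

lemma reduced: "(x::'e) * x = 0 \<Longrightarrow> x = 0"
proof -
  assume x: "x * x = 0"
  consider "\<forall>x::'e. x \<noteq> 0 \<longrightarrow> x dvd 1"
    | (split) P Q where "bij_betw (\<lambda>x. (P x, Q x)) (UNIV::'e set) (F \<times> F)"
      "\<forall>x y. P (x + y) = P x + P y \<and> Q (x + y) = Q x + Q y"
      "\<forall>x y. P (x * y) = P x * P y \<and> Q (x * y) = Q x * Q y"
    using etale unfolding quadratic_etale_def by blast
  then show "x = 0"
  proof cases
    case 1
    show ?thesis
    proof (rule ccontr)
      assume nz: "x \<noteq> 0"
      with 1 obtain y where "1 = x * y" by (metis dvdE)
      then show False using x nz by (metis mult.assoc mult.commute mult.right_neutral mult_zero_left)
    qed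
  next
    case split
    have z: "P 0 = 0" "Q 0 = 0" using split(2)[rule_format, of 0 0] by auto
    have "P x * P x = 0" "Q x * Q x = 0" using split(3)[rule_format, of x x] x z by auto
    then have "(P x, Q x) = (P 0, Q 0)" using z by simp
    then show ?thesis using split(1) unfolding bij_betw_def inj_on_def by blast
  qed
qed

text \<open>Take \<open>D = x - \<sigma> x\<close> for an \<open>x\<close> moved by
  \<open>\<sigma>\<close>. As \<open>\<sigma>\<close> fixes 1 and negates \<open>D\<close>, these
  two are independent over \<open>F\<close>, and Cramer's rule relative to the given basis
  \<open>a\<close>, \<open>b\<close> shows that they span.\<close>

lemma ex_antifixed_basis:
  "\<exists>\<delta>0. \<delta>0 \<noteq> 0 \<and> \<sigma> \<delta>0 = - \<delta>0 \<and> (\<forall>x. \<exists>s\<in>F. \<exists>t\<in>F. x = \<iota> s + \<iota> t * \<delta>0)"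
proof -
  obtain x where x: "\<sigma> x \<noteq> x" using involution unfolding nontrivial_involution_def by (metis eq_id_iff)
  define D where "D = x - \<sigma> x"
  have D0: "D \<noteq> 0" using x unfolding D_def by auto
  have sD: "\<sigma> D = - D" unfolding D_def by (simp add: sigma_diff sigma_hom)
  have "\<exists>a b. \<forall>x. \<exists>!(s, t). s \<in> F \<and> t \<in> F \<and> x = \<iota> s * a + \<iota> t * b"
    using etale unfolding quadratic_etale_def by (elim conjE)
  then obtain a b where ab: "\<forall>x. \<exists>!(s, t). s \<in> F \<and> t \<in> F \<and> x = \<iota> s * a + \<iota> t * b"
    by (elim exE)
  have ex: "\<exists>s\<in>F. \<exists>t\<in>F. y = \<iota> s * a + \<iota> t * b" for y
    using ex1_implies_ex[OF ab[rule_format, of y]] by auto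
  obtain s1 t1 where 1: "s1 \<in> F" "t1 \<in> F" "1 = \<iota> s1 * a + \<iota> t1 * b" using ex[of 1] by blast
  obtain s2 t2 where 2: "s2 \<in> F" "t2 \<in> F" "D = \<iota> s2 * a + \<iota> t2 * b" using ex[of D] by blast
  have one0: "(1::'e) \<noteq> 0" using D0 by (metis mult_1 mult_zero_left)
  have indep: "s = 0 \<and> t = 0" if st: "s \<in> F" "t \<in> F" "\<iota> s * 1 + \<iota> t * D = 0" for s t
  proof -
    have "\<sigma> (\<iota> s * 1 + \<iota> t * D) = 0" using st sigma_0 by simp
    then have "\<iota> s - \<iota> t * D = 0" using st sD by (simp add: sigma_hom)
    with st have "\<iota> s + \<iota> s = 0" by (simp add: algebra_simps)
    then have s: "\<iota> s = 0" by (rule double_cancel)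
    then have t: "\<iota> t * D = 0" using st by simp
    have "s = 0" using iota_cancel[of s 1] s st one0 by auto
    moreover have "t = 0" using iota_cancel[of t D] t st D0 by auto
    ultimately show ?thesis by simp
  qed
  \<comment> \<open>Determinant of the passage from \<open>a\<close>, \<open>b\<close> to
    \<open>1\<close>, \<open>D\<close>; \<open>ea\<close> and \<open>eb\<close> are the adjugate
    formulas. If it vanished, independence would make all four coefficients zero, contradicting the
    expansion of 1.\<close>
  define d where "d = s1 * t2 - s2 * t1"
  have dF: "d \<in> F" unfolding d_def using 1(1,2) 2(1,2) F_closed by simp
  have ea: "\<iota> d * a = \<iota> t2 * 1 + \<iota> (- t1) * D"
    unfolding d_def 2(3) using 1(1,2) 2(1,2) F_closed
    by (subst 1(3)) (simp add: iota_diff iota_minus iota_hom(1,2) algebra_simps)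
  have eb: "\<iota> d * b = \<iota> (- s2) * 1 + \<iota> s1 * D"
    unfolding d_def 2(3) using 1(1,2) 2(1,2) F_closed
    by (subst 1(3)) (simp add: iota_diff iota_minus iota_hom(1,2) algebra_simps)
  have d0: "d \<noteq> 0"
  proof
    assume "d = 0"
    then have "t2 = 0 \<and> - t1 = 0" "- s2 = 0 \<and> s1 = 0"
      using indep[of t2 "- t1"] indep[of "- s2" s1] ea eb 1(1,2) 2(1,2) F_closed(5) iota_0 by (simp_all del: mult_1_right)
    then show False using 1(3) iota_0 one0 by simp
  qed
  have di: "\<iota> (inverse d) * (\<iota> d * y) = y" for y
    using iota_hom(2)[of "inverse d" d] dF d0 F_closed iota_hom(3) by (simp add: mult.assoc[symmetric])
  have "\<exists>s\<in>F. \<exists>t\<in>F. y = \<iota> s + \<iota> t * D" for y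
  proof -
    obtain s t where st: "s \<in> F" "t \<in> F" "y = \<iota> s * a + \<iota> t * b" using ex by blast
    have "y = \<iota> (inverse d) * (\<iota> d * y)" by (simp add: di)
    also have "\<iota> d * y = \<iota> s * (\<iota> d * a) + \<iota> t * (\<iota> d * b)" unfolding st(3) by (simp add: algebra_simps)
    also have "\<dots> = \<iota> (s * t2 - t * s2) + \<iota> (t * s1 - s * t1) * D"
      unfolding ea eb using st 1(1,2) 2(1,2) F_closed by (simp add: iota_diff iota_minus iota_hom algebra_simps)
    finally have "y = \<iota> (inverse d * (s * t2 - t * s2)) + \<iota> (inverse d * (t * s1 - s * t1)) * D"
      using st(1,2) 1(1,2) 2(1,2) dF F_closed by (simp only: iota_hom(2) distrib_left mult.assoc)
    moreover have "inverse d * (s * t2 - t * s2) \<in> F" "inverse d * (t * s1 - s * t1) \<in> F"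
      using st(1,2) 1(1,2) 2(1,2) dF by (simp_all add: F_closed)
    ultimately show ?thesis by blast
  qed
  then show ?thesis using D0 sD by blast
qed

text \<open>Since \<open>\<sigma>\<close> fixes \<open>D * D\<close>, this square is a scalar
  \<open>d\<close> of \<open>F\<close>, nonzero because \<open>E\<close> is reduced. Rescaling
  \<open>D\<close> turns \<open>d\<close> into its sign when \<open>F\<close> is real, so
  \<open>\<omega>\<close> is 1 or \<open>\<i>\<close>, and always into 1 when \<open>F\<close> is
  complex. The map \<open>p\<close> then sends \<open>\<delta>\<close> to the chosen square root
  \<open>\<omega>\<close>.\<close>

lemma ex_coordinates:
  "\<exists>p \<delta> \<omega>. GGP_coordinates F \<iota> \<sigma> sm h n e p \<delta> \<omega>"
proof -
  obtain D where D: "D \<noteq> 0" "\<sigma> D = - D" and dec: "\<And>x. \<exists>s\<in>F. \<exists>t\<in>F. x = \<iota> s + \<iota> t * D"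
    using ex_antifixed_basis by blast
  obtain d u where du: "d \<in> F" "u \<in> F" "D * D = \<iota> d + \<iota> u * D" using dec by blast
  have "\<sigma> (D * D) = D * D" using D by (simp add: sigma_hom)
  then have "\<iota> u * D + \<iota> u * D = 0" using du D by (simp add: sigma_hom algebra_simps eq_neg_iff_add_eq_0)
  then have DD: "D * D = \<iota> d" using double_cancel du by fastforce
  have d0: "d \<noteq> 0" using reduced[of D] D DD iota_0 by auto
  obtain c \<omega> where c: "c \<in> F" "c \<noteq> 0" "c * c * d = \<omega> * \<omega>" and w: "\<omega> = 1 \<or> (\<omega> = \<i> \<and> F = \<real>)"
  proof (cases "F = \<real>")
    case True
    then obtain d' where d': "d = of_real d'" using du Reals_cases by blast
    show thesis
    proof (cases "d' > 0")
      case True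
      have "inverse (sqrt d') * inverse (sqrt d') * d' = 1" using True by (simp add: field_simps)
      then have "complex_of_real (inverse (sqrt d')) * of_real (inverse (sqrt d')) * d = 1 * 1"
        unfolding d' by (metis mult_1 of_real_1 of_real_mult)
      then show thesis using that[OF F_closed(8)] True by (metis inverse_nonzero_iff_nonzero of_real_eq_0_iff less_irrefl real_sqrt_eq_0_iff)
    next
      case False
      then have n: "d' < 0" using d0 d' by (cases "d' = 0") auto
      have "inverse (sqrt (- d')) * inverse (sqrt (- d')) * d' = -1" using n by (simp add: field_simps)
      then have "complex_of_real (inverse (sqrt (- d'))) * of_real (inverse (sqrt (- d'))) * d = \<i> * \<i>"
        unfolding d' by (metis i_squared of_real_1 of_real_minus of_real_mult)
      then show thesis using that[OF F_closed(8)] n \<open>F = \<real>\<close>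
        by (metis inverse_nonzero_iff_nonzero of_real_eq_0_iff less_irrefl real_sqrt_eq_0_iff neg_equal_0_iff_equal)
    qed
  next
    case False
    then have U: "F = UNIV" using base_field by auto
    have "inverse (csqrt d) * inverse (csqrt d) * d = 1 * 1"
      using d0 by (metis inverse_mult_distrib left_inverse mult_1 power2_csqrt power2_eq_square)
    then show thesis using that[of "inverse (csqrt d)" 1] U d0 by simp
  qed
  define \<delta> where "\<delta> = \<iota> c * D"
  have w2F: "\<omega> * \<omega> \<in> F" using c du F_closed by metis
  have dd: "\<delta> * \<delta> = \<iota> (\<omega> * \<omega>)"
  proof -
    have "\<delta> * \<delta> = \<iota> c * \<iota> c * (D * D)" unfolding \<delta>_def by (simp add: algebra_simps)
    also have "\<dots> = \<iota> (c * c * d)" unfolding DD using c(1) du(1) F_closed by (simp add: iota_hom)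
    finally show ?thesis using c by simp
  qed
  have sd: "\<sigma> \<delta> = - \<delta>" unfolding \<delta>_def using c D by (simp add: sigma_hom)
  have cc: "\<iota> c * \<iota> (inverse c) = 1"
    using iota_hom(2)[of c "inverse c"] c F_closed iota_hom(3) by simp
  have decd: "\<exists>s\<in>F. \<exists>t\<in>F. x = \<iota> s + \<iota> t * \<delta>" for x
  proof -
    obtain s t where st: "s \<in> F" "t \<in> F" "x = \<iota> s + \<iota> t * D" using dec by blast
    have "\<iota> (t * inverse c) * \<delta> = \<iota> t * D" unfolding \<delta>_def using st c F_closed cc
      by (simp add: iota_hom(2)) (metis mult.assoc mult.commute mult.left_neutral)
    then show ?thesis using st c F_closed by metis
  qed
  have one0: "(1::'e) \<noteq> 0" using D(1) by (metis mult_1 mult_zero_left)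
  have delta0: "\<delta> \<noteq> 0" unfolding \<delta>_def using iota_cancel c D by blast
  have indep: "s = 0 \<and> t = 0" if st: "s \<in> F" "t \<in> F" "\<iota> s + \<iota> t * \<delta> = 0" for s t
  proof -
    have "\<sigma> (\<iota> s + \<iota> t * \<delta>) = \<iota> s - \<iota> t * \<delta>" using st(1,2) sd by (simp add: sigma_hom)
    then have "\<iota> s - \<iota> t * \<delta> = 0" using st(3) sigma_0 by simp
    with st have "\<iota> s + \<iota> s = 0" by (simp add: algebra_simps)
    then have s: "\<iota> s = 0" by (rule double_cancel)
    then have t: "\<iota> t * \<delta> = 0" using st by simp
    have "s = 0" using iota_cancel[of s 1] s st one0 by auto
    moreover have "t = 0" using iota_cancel[of t \<delta>] t st delta0 by auto
    ultimately show ?thesis by simp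
  qed
  define p where "p x = (THE y. \<exists>s\<in>F. \<exists>t\<in>F. x = \<iota> s + \<iota> t * \<delta> \<and> y = s + t * \<omega>)" for x
  have pI: "p (\<iota> s + \<iota> t * \<delta>) = s + t * \<omega>" if st: "s \<in> F" "t \<in> F" for s t
    unfolding p_def
  proof (rule the_equality)
    show "\<exists>s'\<in>F. \<exists>t'\<in>F. \<iota> s + \<iota> t * \<delta> = \<iota> s' + \<iota> t' * \<delta> \<and> s + t * \<omega> = s' + t' * \<omega>" using st by blast
    fix y assume "\<exists>s'\<in>F. \<exists>t'\<in>F. \<iota> s + \<iota> t * \<delta> = \<iota> s' + \<iota> t' * \<delta> \<and> y = s' + t' * \<omega>"
    then obtain s' t' where s': "s' \<in> F" "t' \<in> F" "\<iota> s + \<iota> t * \<delta> = \<iota> s' + \<iota> t' * \<delta>" "y = s' + t' * \<omega>" by blast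
    have "\<iota> (s - s') + \<iota> (t - t') * \<delta> = 0" using s' st by (simp add: iota_diff algebra_simps)
    then have "s - s' = 0 \<and> t - t' = 0" using indep[OF F_closed(6) F_closed(6)] s' st by blast
    then show "y = s + t * \<omega>" using s' by simp
  qed
  have "GGP_coordinates F \<iota> \<sigma> sm h n e p \<delta> \<omega>"
  proof unfold_locales
    fix x y :: 'e
    obtain s t where st: "s \<in> F" "t \<in> F" "x = \<iota> s + \<iota> t * \<delta>" using decd by blast
    obtain s' t' where st': "s' \<in> F" "t' \<in> F" "y = \<iota> s' + \<iota> t' * \<delta>" using decd by blast
    have "x + y = \<iota> (s + s') + \<iota> (t + t') * \<delta>" using st st' by (simp add: iota_hom algebra_simps)
    then have "p (x + y) = (s + s') + (t + t') * \<omega>" using pI[OF F_closed(3) F_closed(3)] st(1,2) st'(1,2) by simp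
    moreover have px: "p x = s + t * \<omega>" "p y = s' + t' * \<omega>" using st st' pI by auto
    ultimately show "p (x + y) = p x + p y" by (simp add: algebra_simps)
    have "x * y = \<iota> s * \<iota> s' + \<iota> t * \<iota> t' * (\<delta> * \<delta>) + (\<iota> s * \<iota> t' + \<iota> t * \<iota> s') * \<delta>"
      using st st' by (simp add: algebra_simps)
    also have "\<dots> = \<iota> (s * s' + t * t' * (\<omega> * \<omega>)) + \<iota> (s * t' + t * s') * \<delta>"
      unfolding dd using st st' w2F F_closed by (simp add: iota_hom)
    finally have "x * y = \<dots>" .
    then have "p (x * y) = (s * s' + t * t' * (\<omega> * \<omega>)) + (s * t' + t * s') * \<omega>"
      using pI[of "s * s' + t * t' * (\<omega> * \<omega>)" "s * t' + t * s'"] st(1,2) st'(1,2) w2F F_closed(3,4) by simp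
    then show "p (x * y) = p x * p y" unfolding px by (simp add: algebra_simps)
  next
    show p1: "p (\<iota> t) = t" if "t \<in> F" for t using pI[of t 0] that F_closed iota_0 by simp
    show "p 1 = 1" using p1[of 1] F_closed iota_hom by simp
    show "p \<delta> = \<omega>" using pI[of 0 1] F_closed iota_0 iota_hom by simp
  qed (use sd w decd in auto)
  then show ?thesis by blast
qed

end

section \<open>The hermitian form\<close>

context GGP_coordinates
begin

lemmas sm_add_right = module.scale_right_distrib[OF E_module]
  and sm_add_left = module.scale_left_distrib[OF E_module]
  and sm_sm = module.scale_scale[OF E_module]
  and sm_one = module.scale_one[OF E_module]
  and sm_zero_left = module.scale_zero_left[OF E_module]
  and sm_zero_right = module.scale_zero_right[OF E_module]
  and sm_minus_left = module.scale_minus_left[OF E_module]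
  and sm_minus_right = module.scale_minus_right[OF E_module]
  and sm_diff_left = module.scale_left_diff_distrib[OF E_module]
  and sm_diff_right = module.scale_right_diff_distrib[OF E_module]
  and sm_sum_right = module.scale_sum_right[OF E_module]

lemmas sm_simps = sm_add_right sm_add_left sm_sm sm_one sm_zero_left sm_zero_right
  sm_minus_left sm_minus_right sm_diff_left sm_diff_right

lemma sm_scaleR: "sm a (r *\<^sub>R v) = r *\<^sub>R sm a v"
  by (simp add: scaleR_compat[symmetric] sm_sm mult.commute)

lemma sm_iota_complex:
  assumes "F = UNIV"
  shows "sm (\<iota> s) v = Re s *\<^sub>R v + Im s *\<^sub>R sm (\<iota> \<i>) v"
proof -
  have "\<iota> s = \<iota> (of_real (Re s)) + \<iota> (of_real (Im s)) * \<iota> \<i>"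
    using assms complex_eq[of s] by (simp add: iota_hom[symmetric] mult.commute)
  then show ?thesis by (simp only: sm_add_left sm_sm[symmetric] scaleR_compat)
qed

lemma bounded_linear_sm: "bounded_linear (sm a)"
  unfolding linear_conv_bounded_linear[symmetric] by (rule linearI) (auto simp: sm_simps sm_scaleR)

lemma h_add_left: "h (u + v) w = h u w + h v w"
  and h_sm_left: "h (sm a v) w = a * h v w"
  and h_sigma: "\<sigma> (h v w) = h w v"
  using hermitian unfolding hermitian_form_def by metis+

lemma h_add_right: "h w (u + v) = h w u + h w v"
  by (metis h_add_left h_sigma sigma_hom(1))

lemma h_sm_right: "h w (sm a v) = \<sigma> a * h w v"
  by (metis h_sm_left h_sigma sigma_hom(2))

lemma h_zero_left: "h 0 w = 0"
  using h_add_left[of 0 0 w] by simp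

lemma h_zero_right: "h w 0 = 0"
  using h_add_right[of w 0 0] by simp

lemma h_minus_left: "h (- v) w = - h v w"
  using h_add_left[of v "- v" w] h_zero_left by (simp add: eq_neg_iff_add_eq_0 add.commute)

lemma h_minus_right: "h w (- v) = - h w v"
  using h_add_right[of w v "- v"] h_zero_right by (simp add: eq_neg_iff_add_eq_0 add.commute)

lemma h_diff_left: "h (u - v) w = h u w - h v w"
  using h_add_left[of u "- v"] h_minus_left by simp

lemma h_diff_right: "h w (u - v) = h w u - h w v"
  using h_add_right[of w u "- v"] h_minus_right by simp

lemmas h_simps = h_add_left h_add_right h_sm_left h_sm_right h_zero_left h_zero_right
  h_minus_left h_minus_right h_diff_left h_diff_right

lemma h_sum_left: "h (\<Sum>i\<in>I. f i) w = (\<Sum>i\<in>I. h (f i) w)"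
  by (induction I rule: infinite_finite_induct) (auto simp: h_simps)

lemma h_sum_right: "h w (\<Sum>i\<in>I. f i) = (\<Sum>i\<in>I. h w (f i))"
  by (induction I rule: infinite_finite_induct) (auto simp: h_simps)

section \<open>The two coordinates of an element of \<open>E\<close> and the real form attached to
  \<open>h\<close>\<close>

lemma p_0: "p 0 = 0"
  using p_add[of 0 0] by simp

lemma p_minus: "p (- x) = - p x"
  using p_add[of x "- x"] p_0 by (simp add: eq_neg_iff_add_eq_0 add.commute)

lemma p_diff: "p (x - y) = p x - p y"
  using p_add[of x "- y"] p_minus by simp

lemma p_sum: "p (\<Sum>i\<in>I. f i) = (\<Sum>i\<in>I. p (f i))"
  by (induction I rule: infinite_finite_induct) (auto simp: p_add p_0)

lemma p_real: "p (\<iota> (complex_of_real r)) = of_real r"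
  by (simp add: p_iota F_closed)

lemma omega_sq: "\<omega> * \<omega> = 1 \<or> \<omega> * \<omega> = - 1" "\<omega> * \<omega> \<in> F" "\<omega> \<noteq> 0"
  using omega base_field by auto

lemma cnj_F: "s \<in> F \<Longrightarrow> cnj s \<in> F"
  using base_field by (metis Reals_cnj_iff UNIV_I empty_iff insert_iff)

lemma p_decomp:
  assumes "s \<in> F" "t \<in> F"
  shows "p (\<iota> s + \<iota> t * \<delta>) = s + t * \<omega>" "p (\<sigma> (\<iota> s + \<iota> t * \<delta>)) = s - t * \<omega>"
  using assms by (auto simp: p_add p_mult p_iota p_delta sigma_hom sigma_delta p_diff)

text \<open>The coordinates \<open>s + t * \<omega>\<close> and \<open>s - t * \<omega>\<close>
  determine \<open>s\<close> and \<open>t\<close> as \<open>\<omega>\<close> is nonzero. Hence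
  equations in \<open>E\<close> can be checked in the complex numbers, coordinate by
  coordinate.\<close>

lemma p_inj:
  assumes "p x = 0" "p (\<sigma> x) = 0"
  shows "x = 0"
proof -
  obtain s t where st: "s \<in> F" "t \<in> F" "x = \<iota> s + \<iota> t * \<delta>" using decomp[of x] by blast
  have a: "s + t * \<omega> = 0" "s - t * \<omega> = 0" using assms p_decomp[OF st(1,2)] st(3) by auto
  have "s = ((s + t * \<omega>) + (s - t * \<omega>)) / 2" by simp
  then have "s = 0" unfolding a by simp
  moreover have "t * \<omega> = 0" using a(1) \<open>s = 0\<close> by simp
  ultimately show ?thesis using st iota_0 omega_sq by auto
qed

lemma p_eqI: "p x = p y \<Longrightarrow> p (\<sigma> x) = p (\<sigma> y) \<Longrightarrow> x = y"
  using p_inj[of "x - y"] by (simp add: p_diff sigma_diff)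

lemma sigma_fixed: "\<sigma> x = x \<Longrightarrow> \<exists>s\<in>F. x = \<iota> s"
proof -
  assume x: "\<sigma> x = x"
  obtain s t where st: "s \<in> F" "t \<in> F" "x = \<iota> s + \<iota> t * \<delta>" using decomp[of x] by blast
  have "s + t * \<omega> = s - t * \<omega>" using x p_decomp[OF st(1,2)] st by auto
  then have "t = 0" using omega_sq(3) by (simp add: eq_neg_iff_add_eq_0)
  then show ?thesis using st iota_0 by auto
qed

text \<open>The norm \<open>x * \<sigma> x\<close> is fixed by \<open>\<sigma>\<close>, so it lies
  in \<open>F\<close>; when both coordinates are nonzero it is invertible there. In the split case
  one nonzero coordinate would not be enough.\<close>

lemma ex_inverse: "p x \<noteq> 0 \<Longrightarrow> p (\<sigma> x) \<noteq> 0 \<Longrightarrow> \<exists>y. x * y = 1"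
proof -
  assume nz: "p x \<noteq> 0" "p (\<sigma> x) \<noteq> 0"
  obtain c where c: "c \<in> F" "x * \<sigma> x = \<iota> c" using sigma_fixed[of "x * \<sigma> x"]
    by (auto simp: sigma_hom mult.commute)
  have "c \<noteq> 0" using c nz by (metis iota_0 mult_eq_0_iff p_0 p_mult)
  then have "x * (\<sigma> x * \<iota> (inverse c)) = 1"
    using c iota_hom(2)[of c "inverse c"] iota_hom(3) F_closed by (simp add: mult.assoc[symmetric])
  then show ?thesis by blast
qed

text \<open>The value \<open>h v v\<close> is fixed by \<open>\<sigma>\<close>, so its two
  coordinates coincide and it is never a nonzero zero divisor. Anisotropic vectors can thus be
  divided by, even over a split algebra.\<close>

lemma h_self_unit: "h v v \<noteq> 0 \<Longrightarrow> \<exists>y. h v v * y = 1"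
  using ex_inverse[of "h v v"] p_inj[of "h v v"] by (auto simp: h_sigma)

lemma nondeg: "(\<And>w. h v w = 0) \<Longrightarrow> v = 0"
  using nondegenerate unfolding nondegenerate_on_def by auto

lemma nondeg_eqI: "(\<And>w. h v w = h v' w) \<Longrightarrow> v = v'"
  using nondeg[of "v - v'"] by (simp add: h_simps)

lemma nondeg_right_eqI: "(\<And>w. h w v = h w v') \<Longrightarrow> v = v'"
  by (rule nondeg_eqI) (metis h_sigma)

text \<open>Up to a constant, \<open>h\<close> followed by the trace from \<open>E\<close> to the reals.\<close>

definition \<beta> :: "'v \<Rightarrow> 'v \<Rightarrow> real" where
  "\<beta> v w = Re (p (h v w) + p (h w v))"

lemma beta_commute: "\<beta> v w = \<beta> w v"
  unfolding \<beta>_def by (simp add: add.commute)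

lemma p_h_scaleR: "p (h (r *\<^sub>R v) w) = of_real r * p (h v w)" "p (h v (r *\<^sub>R w)) = of_real r * p (h v w)"
  by (simp_all add: scaleR_compat[symmetric] h_simps p_mult p_real sigma_hom F_closed)

lemma h_scaleR: "h (r *\<^sub>R v) w = \<iota> (of_real r) * h v w" "h v (r *\<^sub>R w) = \<iota> (of_real r) * h v w"
  unfolding scaleR_compat[symmetric] h_sm_left h_sm_right sigma_hom(5)[OF F_closed(8)] by simp_all

lemma linear_p_h_left: "linear (\<lambda>v. p (h v w))"
  by (rule linearI) (simp_all add: h_simps p_add p_h_scaleR scaleR_conv_of_real)

lemma linear_p_h_right: "linear (\<lambda>w. p (h v w))"
  by (rule linearI) (simp_all add: h_simps p_add p_h_scaleR scaleR_conv_of_real)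

lemma bounded_bilinear_p_h: "bounded_bilinear (\<lambda>v w. p (h v w))"
  using linear_p_h_left linear_p_h_right
  by (subst bilinear_conv_bounded_bilinear[symmetric]) (simp add: bilinear_def)

lemma linear_beta: "linear (\<lambda>v. \<beta> v w)"
  unfolding \<beta>_def by (rule linearI) (simp_all add: h_simps p_add p_h_scaleR algebra_simps)

lemma linear_beta_right: "linear (\<lambda>v. \<beta> w v)"
  unfolding \<beta>_def by (rule linearI) (simp_all add: h_simps p_add p_h_scaleR algebra_simps)

text \<open>Testing against \<open>cnj s\<close> and \<open>cnj t * \<delta>\<close> isolates
  \<open>2 |s|^2\<close> and, up to sign, \<open>2 |t|^2\<close>. The conjugates are there for
  complex \<open>F\<close>, where only the real part of the trace is available.\<close>

lemma trace_nondeg: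
  assumes "\<And>c. Re (p (c * x) + p (\<sigma> (c * x))) = 0"
  shows "x = 0"
proof -
  obtain s t where st: "s \<in> F" "t \<in> F" "x = \<iota> s + \<iota> t * \<delta>" using decomp[of x] by blast
  have p: "p x = s + t * \<omega>" "p (\<sigma> x) = s - t * \<omega>" using p_decomp[OF st(1,2)] st(3) by auto
  have "Re (cnj s * (s + t * \<omega>) + cnj s * (s - t * \<omega>)) = 0"
    using assms[of "\<iota> (cnj s)"] st cnj_F p by (simp add: p_mult p_iota sigma_hom)
  moreover have "cnj s * (s + t * \<omega>) + cnj s * (s - t * \<omega>) = 2 * (s * cnj s)" by (simp add: algebra_simps)
  moreover have "Re (2 * (s * cnj s)) = 2 * (cmod s)\<^sup>2" by (simp add: cmod_power2) (simp add: power2_eq_square)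
  ultimately have s0: "s = 0" by (simp only:) simp
  have "Re (cnj t * \<omega> * (s + t * \<omega>) + cnj t * (- \<omega>) * (s - t * \<omega>)) = 0"
    using assms[of "\<iota> (cnj t) * \<delta>"] st cnj_F p
    by (simp add: p_mult p_iota sigma_hom p_delta sigma_delta p_minus)
  moreover have "cnj t * \<omega> * (s + t * \<omega>) + cnj t * (- \<omega>) * (s - t * \<omega>) = 2 * (t * cnj t) * (\<omega> * \<omega>)"
    by (simp add: algebra_simps)
  moreover have "\<bar>Re (2 * (t * cnj t) * (\<omega> * \<omega>))\<bar> = 2 * (cmod t)\<^sup>2"
    using omega_sq(1)
  proof
    assume w: "\<omega> * \<omega> = 1"
    show ?thesis unfolding w by (simp add: cmod_power2) (simp add: power2_eq_square abs_of_nonneg)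
  next
    assume w: "\<omega> * \<omega> = - 1"
    have "Re (2 * (t * cnj t) * - 1) = - (2 * (cmod t)\<^sup>2)" by (simp add: cmod_power2) (simp add: power2_eq_square)
    then show ?thesis unfolding w by simp
  qed
  ultimately have "t = 0" by (simp only:) simp
  then show ?thesis using s0 st iota_0 by simp
qed

text \<open>The real form sees only one real linear functional of \<open>h v w\<close>; letting the
  scalar \<open>c\<close> run over \<open>E\<close> recovers all of it. This is how real-linear
  arguments are upgraded to statements over \<open>E\<close>.\<close>

lemma beta_eq_imp_h_eq:
  assumes "\<And>c. \<beta> (sm c v) w = \<beta> (sm c v') w'"
  shows "h v w = h v' w'"
proof -
  have "h v w - h v' w' = 0"
  proof (rule trace_nondeg)
    fix c
    have "p (\<sigma> (c * (h v w - h v' w'))) = p (h w (sm c v)) - p (h w' (sm c v'))"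
      by (simp add: h_simps sigma_hom sigma_diff h_sigma p_diff algebra_simps)
    moreover have "p (c * (h v w - h v' w')) = p (h (sm c v) w) - p (h (sm c v') w')"
      by (simp add: h_simps p_diff algebra_simps)
    ultimately show "Re (p (c * (h v w - h v' w')) + p (\<sigma> (c * (h v w - h v' w')))) = 0"
      using assms[of c] unfolding \<beta>_def by simp
  qed
  then show ?thesis by simp
qed

lemma beta_zero_left: "\<beta> 0 w = 0"
  unfolding \<beta>_def by (simp add: h_simps p_0)

lemma beta_nondeg:
  assumes "\<And>w. \<beta> w v = 0"
  shows "v = 0"
proof (rule nondeg)
  fix w
  have "h w v = h 0 0" by (rule beta_eq_imp_h_eq) (simp add: assms sm_simps beta_zero_left)
  then show "h v w = 0" by (metis h_sigma h_zero_left sigma_0)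
qed

text \<open>Gram operator of \<open>\<beta>\<close> with respect to the auxiliary inner product of
  the type. It transports orthogonality and duality between the two forms.\<close>

definition beta_map :: "'v \<Rightarrow> 'v" where
  "beta_map a = (\<Sum>b\<in>Basis. \<beta> b a *\<^sub>R b)"

lemma inner_beta_map: "v \<bullet> beta_map a = \<beta> v a"
proof -
  have "v \<bullet> beta_map a = (\<Sum>b\<in>Basis. (v \<bullet> b) * \<beta> b a)"
    unfolding beta_map_def by (simp add: inner_sum_right mult.commute)
  also have "\<dots> = \<beta> (\<Sum>b\<in>Basis. (v \<bullet> b) *\<^sub>R b) a"
    by (simp add: linear_sum[OF linear_beta] linear_scale[OF linear_beta])
  finally show ?thesis by (simp add: euclidean_representation)
qed

lemma linear_beta_map: "linear beta_map"
  unfolding beta_map_def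
  by (rule linearI)
    (simp_all add: linear_add[OF linear_beta_right] linear_scale[OF linear_beta_right]
      scaleR_add_left sum.distrib scaleR_sum_right)

lemma inj_beta_map: "inj beta_map"
proof (subst linear_injective_0[OF linear_beta_map], intro allI impI)
  fix a assume "beta_map a = 0"
  then have "\<beta> w a = 0" for w using inner_beta_map[of w a] by simp
  then show "a = 0" by (rule beta_nondeg)
qed

lemma surj_beta_map: "surj beta_map"
  by (rule linear_injective_imp_surjective[OF linear_beta_map inj_beta_map refl])

lemma riesz:
  fixes f :: "'v \<Rightarrow> real"
  assumes "linear f"
  shows "\<exists>a. \<forall>v. f v = \<beta> v a"
proof -
  obtain a where a: "beta_map a = (\<Sum>b\<in>Basis. f b *\<^sub>R b)" using surj_beta_map by (metis surjD)
  have "f v = \<beta> v a" for v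
  proof -
    have "f v = f (\<Sum>b\<in>Basis. (v \<bullet> b) *\<^sub>R b)" by (simp add: euclidean_representation)
    also have "\<dots> = (\<Sum>b\<in>Basis. (v \<bullet> b) * f b)"
      by (simp add: linear_sum[OF assms] linear_scale[OF assms])
    also have "\<dots> = v \<bullet> beta_map a" unfolding a by (simp add: inner_sum_right mult.commute)
    finally show ?thesis by (simp add: inner_beta_map)
  qed
  then show ?thesis by blast
qed

definition elin :: "('v \<Rightarrow>\<^sub>L 'v) \<Rightarrow> bool" where
  "elin X \<longleftrightarrow> (\<forall>a v. X (sm a v) = sm a (X v))"

lemma elinD: "elin X \<Longrightarrow> X (sm a v) = sm a (X v)"
  unfolding elin_def by blast

lemma module_hom_iff_elin: "module_hom sm sm (blinfun_apply X) \<longleftrightarrow> elin X"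
  unfolding module_hom_iff elin_def using E_module by (auto simp: blinfun.add_right)

lemma Blinfun_E_linear:
  assumes "\<And>u v. f (u + v) = f u + f v" "\<And>a v. f (sm a v) = sm a (f v)"
  shows "blinfun_apply (Blinfun f) = f" "elin (Blinfun f)"
proof -
  have "f (r *\<^sub>R v) = r *\<^sub>R f v" for r v using assms(2)[of "\<iota> (of_real r)" v] by (simp add: scaleR_compat)
  then have "linear f" using assms by (intro linearI)
  then have "bounded_linear f" by (simp add: linear_conv_bounded_linear)
  then show "blinfun_apply (Blinfun f) = f" by (rule bounded_linear_Blinfun_apply)
  then show "elin (Blinfun f)" unfolding elin_def using assms by simp
qed

text \<open>Riesz representation gives an adjoint for the real form \<open>\<beta>\<close>. Its
  values are determined by \<open>h\<close>, so nondegeneracy forces it to be additive and linear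
  over \<open>E\<close>.\<close>

lemma ex_adjoint:
  assumes "elin X"
  shows "\<exists>Y. elin Y \<and> (\<forall>v w. h (X v) w = h v (Y w))"
proof -
  have "\<exists>a. \<forall>v. \<beta> (X v) w = \<beta> v a" for w
    by (rule riesz, rule linear_compose[OF _ linear_beta, unfolded o_def])
      (rule bounded_linear.linear[OF blinfun.bounded_linear_right])
  then obtain f where f: "\<And>v w. \<beta> (X v) w = \<beta> v (f w)" by metis
  have hf: "h (X v) w = h v (f w)" for v w
    by (rule beta_eq_imp_h_eq) (simp add: elinD[OF assms, symmetric] f)
  have "f (u + v) = f u + f v" for u v
    by (rule nondeg_right_eqI) (simp add: hf[symmetric] h_simps)
  moreover have "f (sm a v) = sm a (f v)" for a v
    by (rule nondeg_right_eqI) (simp add: hf[symmetric] h_simps)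
  ultimately have "elin (Blinfun f)" "blinfun_apply (Blinfun f) = f"
    using Blinfun_E_linear[of f] by auto
  then show ?thesis using hf by metis
qed

text \<open>Each coordinate functional of a free basis is \<open>E\<close>-linear, and its real
  trace is represented by a vector through \<open>\<beta>\<close>; by nondegeneracy of the trace the
  same vector represents the functional itself through \<open>h\<close>.\<close>

lemma ex_dual_frame:
  "\<exists>B f. finite B \<and> (\<forall>v. v = (\<Sum>b\<in>B. sm (h v (f b)) b))"
proof -
  obtain B where B: "finite B" "\<not> module.dependent sm B" "module.span sm B = UNIV"
    using free_rank by blast
  interpret M: module sm by (rule E_module)
  let ?c = "\<lambda>b v. M.representation B v b"
  have add: "?c b (u + v) = ?c b u + ?c b v" for b u v
    using M.representation_add[OF B(2), of v u] B(3) by simp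
  have scale: "?c b (sm a v) = a * ?c b v" for a b v
    using M.representation_scale[OF B(2), of v a] B(3) by simp
  have "\<exists>a. \<forall>v. Re (p (?c b v) + p (\<sigma> (?c b v))) = \<beta> v a" for b
  proof (rule riesz, rule linearI)
    show "Re (p (?c b (r *\<^sub>R v)) + p (\<sigma> (?c b (r *\<^sub>R v)))) = r *\<^sub>R Re (p (?c b v) + p (\<sigma> (?c b v)))" for r v
      by (simp add: scaleR_compat[symmetric] scale p_mult p_real sigma_hom F_closed algebra_simps)
  qed (simp add: add p_add sigma_hom)
  then obtain f where f: "\<And>b v. Re (p (?c b v) + p (\<sigma> (?c b v))) = \<beta> v (f b)" by metis
  have hf: "?c b v = h v (f b)" for b v
  proof -
    have "?c b v - h v (f b) = 0"
    proof (rule trace_nondeg)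
      fix a
      have "Re (p (a * ?c b v) + p (\<sigma> (a * ?c b v))) = Re (p (a * h v (f b)) + p (\<sigma> (a * h v (f b))))"
        using f[of "sm a v" b] unfolding \<beta>_def by (simp add: scale h_simps sigma_hom h_sigma)
      then show "Re (p (a * (?c b v - h v (f b))) + p (\<sigma> (a * (?c b v - h v (f b))))) = 0"
        by (simp add: right_diff_distrib p_diff sigma_diff)
    qed
    then show ?thesis by simp
  qed
  have "v = (\<Sum>b\<in>B. sm (h v (f b)) b)" for v
    using M.sum_representation_eq[OF B(2) _ B(1) order_refl, of v] B(3) by (simp add: hf)
  then show ?thesis using B(1) by blast
qed

section \<open>The groups and the Lie algebra\<close>

lemma h_e_e: "\<exists>y. h e e * y = 1"
proof (rule h_self_unit, rule notI)
  assume "h e e = 0"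
  then have "\<forall>w\<in>module.span sm {e}. h e w = 0"
    by (auto simp: module.span_singleton[OF E_module] h_simps)
  moreover have "e \<in> module.span sm {e}" by (simp add: module.span_base[OF E_module])
  ultimately show False using e_nondegenerate e_nonzero unfolding nondegenerate_on_def by blast
qed

definition ei :: 'e where "ei = (SOME y. h e e * y = 1)"

lemma h_ee_ei: "h e e * ei = 1"
  unfolding ei_def using h_e_e by (rule someI_ex)

definition coef :: "'v \<Rightarrow> 'e" where "coef v = h v e * ei"

definition VH :: "'v set" where "VH = {v. h v e = 0}"

definition projH :: "'v \<Rightarrow> 'v" where "projH v = v - sm (coef v) e"

lemma projH_VH: "projH v \<in> VH"
  unfolding projH_def VH_def coef_def using h_ee_ei by (simp add: h_simps mult.assoc mult.commute[of ei])

lemma projH_decomp: "v = sm (coef v) e + projH v"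
  unfolding projH_def by simp

lemma projH_id: "v \<in> VH \<Longrightarrow> projH v = v"
  unfolding projH_def VH_def coef_def by (simp add: sm_simps)

lemma VH_h_right: "v \<in> VH \<Longrightarrow> h e v = 0"
  unfolding VH_def using h_sigma[of v e] sigma_0 by simp

lemma VH_h_left: "v \<in> VH \<Longrightarrow> h v e = 0"
  unfolding VH_def by simp

lemma VH_closed: "u \<in> VH \<Longrightarrow> v \<in> VH \<Longrightarrow> u + v \<in> VH" "u \<in> VH \<Longrightarrow> sm a u \<in> VH"
  unfolding VH_def by (auto simp: h_simps)

lemma orth_span_e: "orth h (module.span sm {e}) = VH"
  unfolding orth_def VH_def
  by (auto simp: module.span_singleton[OF E_module] h_simps) (metis sigma_hom(3) mult_1)

lemma orth_VH: "orth h VH = range (\<lambda>a. sm a e)"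
proof
  show "orth h VH \<subseteq> range (\<lambda>a. sm a e)"
  proof
    fix v assume v: "v \<in> orth h VH"
    have "projH v = 0"
    proof (rule nondeg)
      fix w
      have "h (projH v) w = h (projH v) (sm (coef w) e) + h (projH v) (projH w)"
        using projH_decomp[of w] by (metis h_add_right)
      also have "h (projH v) (sm (coef w) e) = 0" using VH_h_left[OF projH_VH] by (simp add: h_simps)
      also have "h (projH v) (projH w) = h v (projH w) - h (sm (coef v) e) (projH w)"
        by (subst projH_def) (simp add: h_simps)
      also have "\<dots> = 0" using v projH_VH[of w] VH_h_right[OF projH_VH]
        unfolding orth_def by (simp add: h_simps)
      finally show "h (projH v) w = 0" by simp
    qed
    then show "v \<in> range (\<lambda>a. sm a e)" using projH_decomp[of v] by auto
  qed
  show "range (\<lambda>a. sm a e) \<subseteq> orth h VH"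
    unfolding orth_def by (auto simp: h_simps VH_h_right)
qed

lemma orth_UNIV: "orth h UNIV = {0}"
  unfolding orth_def using nondeg by (auto simp: h_simps)

section \<open>The unitary groups as plain sets of operators\<close>

definition GU :: "('v \<Rightarrow>\<^sub>L 'v) set" where
  "GU = {g. elin g \<and> (\<forall>v w. h (g v) (g w) = h v w)}"

lemma carrier_G: "carrier (grp_G sm h) = GU"
  unfolding unitary_group_def GU_def by (auto simp: module_hom_iff_elin orth_UNIV)

lemma carrier_H: "carrier (grp_H sm h e) = {g \<in> GU. g e = e}"
  unfolding unitary_group_def GU_def
  by (auto simp: module_hom_iff_elin orth_span_e orth_VH elinD) (metis sm_one)

text \<open>The adjoint of an isometry is a left inverse by nondegeneracy; injectivity in finite
  real dimension makes it two-sided.\<close>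

lemma GU_inverse:
  assumes "g \<in> GU"
  shows "\<exists>y\<in>GU. y o\<^sub>L g = id_blinfun \<and> g o\<^sub>L y = id_blinfun"
proof -
  have g: "elin g" "\<And>v w. h (g v) (g w) = h v w" using assms unfolding GU_def by auto
  obtain y where y: "elin y" "\<And>v w. h (g v) w = h v (y w)" using ex_adjoint[OF g(1)] by blast
  have yg: "y (g w) = w" for w
    by (rule nondeg_right_eqI) (simp add: y(2)[symmetric] g)
  have lin: "linear g" by (rule bounded_linear.linear[OF blinfun.bounded_linear_right])
  have "inj g" by (rule inj_on_inverseI[of _ y]) (rule yg)
  then have "surj g" by (rule linear_injective_imp_surjective[OF lin _ refl])
  then have gy: "g (y w) = w" for w by (metis surjD yg)
  have "y \<in> GU" unfolding GU_def using y(1) g(2) gy by (simp add: y(2)[symmetric])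
  moreover have "y o\<^sub>L g = id_blinfun" "g o\<^sub>L y = id_blinfun" by (auto intro!: blinfun_eqI simp: yg gy)
  ultimately show ?thesis by blast
qed

lemma GU_compose: "g \<in> GU \<Longrightarrow> k \<in> GU \<Longrightarrow> g o\<^sub>L k \<in> GU"
  unfolding GU_def elin_def by simp

lemma GU_id: "id_blinfun \<in> GU"
  unfolding GU_def elin_def by simp

lemma mult_G: "monoid.mult (unitary_group sm h W) = (o\<^sub>L)" "one (unitary_group sm h W) = id_blinfun"
  unfolding unitary_group_def by auto

lemma group_G: "group (grp_G sm h)"
  by (rule groupI)
    (use GU_inverse in \<open>auto simp: mult_G carrier_G GU_compose GU_id intro!: blinfun_eqI\<close>)

definition gi :: "('v \<Rightarrow>\<^sub>L 'v) \<Rightarrow> ('v \<Rightarrow>\<^sub>L 'v)" where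
  "gi g = inv\<^bsub>grp_G sm h\<^esub> g"

lemma gi_GU: "g \<in> GU \<Longrightarrow> gi g \<in> GU"
  using group.inv_closed[OF group_G] unfolding gi_def carrier_G by simp

lemma gi_left: "g \<in> GU \<Longrightarrow> gi g (g v) = v"
  using group.l_inv[OF group_G, of g] unfolding gi_def carrier_G mult_G
  by (metis blinfun_apply_blinfun_compose blinfun_apply_id_blinfun id_apply)

lemma gi_right: "g \<in> GU \<Longrightarrow> g (gi g v) = v"
  using group.r_inv[OF group_G, of g] unfolding gi_def carrier_G mult_G
  by (metis blinfun_apply_blinfun_compose blinfun_apply_id_blinfun id_apply)

lemma gi_unique: "g \<in> GU \<Longrightarrow> k \<in> GU \<Longrightarrow> k o\<^sub>L g = id_blinfun \<Longrightarrow> gi g = k"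
  using group.inv_equality[OF group_G] unfolding gi_def carrier_G mult_G by blast

lemma gi_compose: "g \<in> GU \<Longrightarrow> k \<in> GU \<Longrightarrow> gi (g o\<^sub>L k) = gi k o\<^sub>L gi g"
  by (rule gi_unique) (auto simp: GU_compose gi_GU gi_left intro!: blinfun_eqI)

lemma GU_elin: "g \<in> GU \<Longrightarrow> elin g"
  unfolding GU_def by simp

lemma GU_h: "g \<in> GU \<Longrightarrow> h (g v) (g w) = h v w"
  unfolding GU_def by simp

lemma GU_adj: "g \<in> GU \<Longrightarrow> h (g v) w = h v (gi g w)"
  using GU_h[of g v "gi g w"] gi_right by simp

lemma GU_adj': "g \<in> GU \<Longrightarrow> h v (g w) = h (gi g v) w"
  using GU_h[of g "gi g v" w] gi_right by simp

section \<open>Skew operators\<close>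

abbreviation LA :: "('v \<Rightarrow>\<^sub>L 'v) set" where "LA \<equiv> lie_algebra sm h"

lemma LA_iff: "X \<in> LA \<longleftrightarrow> elin X \<and> (\<forall>v w. h (X v) w = - h v (X w))"
  unfolding lie_algebra_def by (auto simp: module_hom_iff_elin eq_neg_iff_add_eq_0)

lemma LA_elin: "X \<in> LA \<Longrightarrow> elin X"
  and LA_skew: "X \<in> LA \<Longrightarrow> h (X v) w = - h v (X w)"
  unfolding LA_iff by auto

lemma LA_closed:
  "X \<in> LA \<Longrightarrow> Y \<in> LA \<Longrightarrow> X + Y \<in> LA" "X \<in> LA \<Longrightarrow> r *\<^sub>R X \<in> LA" "0 \<in> LA"
  unfolding LA_iff elin_def
  by (auto simp: blinfun.add_left blinfun.scaleR_left sm_simps h_simps sm_scaleR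
      scaleR_compat[symmetric] sigma_hom F_closed mult.commute)

lemma LA_sum: "(\<And>i. i \<in> I \<Longrightarrow> f i \<in> LA) \<Longrightarrow> (\<Sum>i\<in>I. f i) \<in> LA"
  by (induction I rule: infinite_finite_induct) (auto simp: LA_closed)

lemma LA_uminus: "X \<in> LA \<Longrightarrow> - X \<in> LA"
  using LA_closed(2)[of X "- 1"] by simp

lemma LA_diff: "X \<in> LA \<Longrightarrow> Y \<in> LA \<Longrightarrow> X - Y \<in> LA"
  using LA_closed(1)[of X "- Y"] LA_uminus by simp

lemma LA_conj: "g \<in> GU \<Longrightarrow> X \<in> LA \<Longrightarrow> g o\<^sub>L X o\<^sub>L gi g \<in> LA"
  unfolding LA_iff using GU_elin[of g] GU_elin[OF gi_GU, of g]
  by (auto simp: elin_def GU_adj GU_adj')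

lemma gi_gi: "g \<in> GU \<Longrightarrow> gi (gi g) = g"
  by (rule gi_unique) (auto simp: gi_GU gi_right intro!: blinfun_eqI)

lemma LA_conj': "g \<in> GU \<Longrightarrow> gi g o\<^sub>L X o\<^sub>L g \<in> LA \<longleftrightarrow> X \<in> LA"
proof
  assume g: "g \<in> GU"
  show "gi g o\<^sub>L X o\<^sub>L g \<in> LA" if "X \<in> LA"
    using LA_conj[OF gi_GU[OF g] that] gi_gi[OF g] by simp
  assume "gi g o\<^sub>L X o\<^sub>L g \<in> LA"
  then have "g o\<^sub>L (gi g o\<^sub>L X o\<^sub>L g) o\<^sub>L gi g \<in> LA" using LA_conj[OF g] by blast
  moreover have "g o\<^sub>L (gi g o\<^sub>L X o\<^sub>L g) o\<^sub>L gi g = X"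
    by (rule blinfun_eqI) (simp add: gi_right[OF g])
  ultimately show "X \<in> LA" by simp
qed

text \<open>The skew operator of rank at most two usually written as a wedge of \<open>a\<close> and
  \<open>b\<close>. These operators span the Lie algebra (\<open>LA_expand\<close>), so functionals
  on it are compared on them.\<close>

definition yy :: "'v \<Rightarrow> 'v \<Rightarrow> ('v \<Rightarrow>\<^sub>L 'v)" where
  "yy a b = Blinfun (\<lambda>v. sm (h v a) b - sm (h v b) a)"

lemma yy_apply: "yy a b v = sm (h v a) b - sm (h v b) a"
  and yy_elin: "elin (yy a b)"
  unfolding yy_def using Blinfun_E_linear[of "\<lambda>v. sm (h v a) b - sm (h v b) a"]
  by (simp_all add: h_simps sm_simps)

lemma yy_LA: "yy a b \<in> LA"
  unfolding LA_iff by (simp add: yy_elin yy_apply h_simps h_sigma algebra_simps)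

lemma yy_add_right: "yy a (b + b') = yy a b + yy a b'"
  and yy_add_left: "yy (a + a') b = yy a b + yy a' b"
  and yy_anti: "yy a b = - yy b a"
  and yy_sm: "yy a (sm c b) = yy (sm (\<sigma> c) a) b"
  by (auto intro!: blinfun_eqI simp: yy_apply h_simps sm_simps blinfun.add_left blinfun.minus_left
      sigma_hom mult.commute)

lemma yy_scaleR_right: "yy a (r *\<^sub>R b) = r *\<^sub>R yy a b"
  by (rule blinfun_eqI)
    (simp add: yy_apply blinfun.scaleR_left scaleR_compat[symmetric] h_simps sm_simps sigma_hom F_closed mult.commute)

lemma yy_scaleR_left: "yy (r *\<^sub>R a) b = r *\<^sub>R yy a b"
  using yy_anti[of "r *\<^sub>R a" b] yy_anti[of a b] yy_scaleR_right[of b r a] by simp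

lemma yy_conj: "g \<in> GU \<Longrightarrow> gi g o\<^sub>L yy a b o\<^sub>L g = yy (gi g a) (gi g b)"
  by (rule blinfun_eqI)
    (simp add: yy_apply blinfun.diff_right elinD[OF GU_elin[OF gi_GU]] GU_adj)

end

section \<open>Identification of the dual of the Lie algebra with skew operators\<close>

locale GGP_frame = GGP_coordinates F \<iota> \<sigma> sm h n e p \<delta> \<omega>
  for F :: "complex set" and \<iota> :: "complex \<Rightarrow> 'e::comm_ring_1" and \<sigma> :: "'e \<Rightarrow> 'e"
    and sm :: "'e \<Rightarrow> 'v::euclidean_space \<Rightarrow> 'v" and h :: "'v \<Rightarrow> 'v \<Rightarrow> 'e" and n :: nat and e :: 'v
    and p :: "'e \<Rightarrow> complex" and \<delta> :: 'e and \<omega> :: complex +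
  fixes B :: "'v set" and f :: "'v \<Rightarrow> 'v"
  assumes finite_B: "finite B" and frame: "(\<Sum>b\<in>B. sm (h v (f b)) b) = v"
begin

lemma frame': "(\<Sum>b\<in>B. sm (h v b) (f b)) = v"
proof (rule nondeg_eqI)
  fix x
  have "h (\<Sum>b\<in>B. sm (h v b) (f b)) x = (\<Sum>b\<in>B. h v b * h (f b) x)"
    by (simp add: h_sum_left h_simps)
  also have "\<dots> = (\<Sum>b\<in>B. h v (sm (h x (f b)) b))"
    by (simp add: h_simps h_sigma mult.commute)
  also have "\<dots> = h v x" by (simp add: h_sum_right[symmetric] frame)
  finally show "h (\<Sum>b\<in>B. sm (h v b) (f b)) x = h v x" .
qed

text \<open>The operator \<open>v \<mapsto> h(v, a) w\<close> has trace \<open>h w a\<close>, and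
  the frame computes traces; applying the real trace of \<open>E\<close> to both sides gives
  \<open>\<beta>\<close>.\<close>

lemma frame_trace: "(\<Sum>c\<in>B. \<beta> (sm (h c a) w) (f c)) = \<beta> w a"
proof -
  have "(\<Sum>c\<in>B. h (sm (h c a) w) (f c)) = (\<Sum>c\<in>B. h (sm (h w (f c)) c) a)"
    by (simp add: h_simps mult.commute)
  also have "\<dots> = h w a" by (simp add: h_sum_left[symmetric] frame)
  finally have 1: "(\<Sum>c\<in>B. h (sm (h c a) w) (f c)) = h w a" .
  have "(\<Sum>c\<in>B. h (f c) (sm (h c a) w)) = (\<Sum>c\<in>B. h a (sm (h w (f c)) c))"
    by (simp add: h_simps h_sigma mult.commute)
  also have "\<dots> = h a w" by (simp add: h_sum_right[symmetric] frame)
  finally have 2: "(\<Sum>c\<in>B. h (f c) (sm (h c a) w)) = h a w" .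
  show ?thesis unfolding \<beta>_def Re_sum[symmetric] sum.distrib p_sum[symmetric] 1 2 ..
qed

text \<open>Summing \<open>yy (f c) (X c)\<close> over the frame yields \<open>X\<close> twice: once
  by expanding the argument in the frame, once, by skewness, by expanding the value in the dual
  frame. Hence the factor \<open>1/2\<close>.\<close>

lemma LA_expand:
  assumes "X \<in> LA"
  shows "X = (\<Sum>c\<in>B. (1/2) *\<^sub>R yy (f c) (X c))"
proof (rule blinfun_eqI)
  fix v
  have "(\<Sum>c\<in>B. yy (f c) (X c) v) = (\<Sum>c\<in>B. X (sm (h v (f c)) c)) + (\<Sum>c\<in>B. sm (h (X v) c) (f c))"
    by (simp add: yy_apply sum.distrib[symmetric] elinD[OF LA_elin[OF assms]] LA_skew[OF assms] sm_simps)
  also have "\<dots> = X v + X v" by (simp add: blinfun.sum_right[symmetric] frame frame')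
  finally have 1: "(\<Sum>c\<in>B. yy (f c) (X c) v) = X v + X v" .
  have "(\<Sum>c\<in>B. (1/2) *\<^sub>R yy (f c) (X c)) v = (1/2) *\<^sub>R (\<Sum>c\<in>B. yy (f c) (X c) v)"
    by (simp add: blinfun.sum_left blinfun.scaleR_left scaleR_sum_right)
  then show "X v = (\<Sum>c\<in>B. (1/2) *\<^sub>R yy (f c) (X c)) v" unfolding 1
    by (simp add: scaleR_add_right[symmetric] scaleR_2[symmetric])
qed

lemma lie_dual_sum:
  assumes "\<xi> \<in> lie_dual sm h" "\<And>i. i \<in> I \<Longrightarrow> X i \<in> LA"
  shows "\<xi> (\<Sum>i\<in>I. X i) = (\<Sum>i\<in>I. \<xi> (X i))"
proof -
  have z: "\<xi> 0 = 0"
    using assms(1) LA_closed(3) unfolding lie_dual_def by (metis (mono_tags, lifting) mem_Collect_eq scale_zero_left)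
  have a: "\<xi> (X + Y) = \<xi> X + \<xi> Y" if "X \<in> LA" "Y \<in> LA" for X Y
    using assms(1) that unfolding lie_dual_def by blast
  show ?thesis using assms(2)
    by (induction I rule: infinite_finite_induct) (auto simp: z a LA_sum)
qed

lemma lie_dual_add: "\<xi> \<in> lie_dual sm h \<Longrightarrow> X \<in> LA \<Longrightarrow> Y \<in> LA \<Longrightarrow> \<xi> (X + Y) = \<xi> X + \<xi> Y"
  and lie_dual_scaleR: "\<xi> \<in> lie_dual sm h \<Longrightarrow> X \<in> LA \<Longrightarrow> \<xi> (r *\<^sub>R X) = r *\<^sub>R \<xi> X"
  and lie_dual_Re: "\<xi> \<in> lie_dual sm h \<Longrightarrow> X \<in> LA \<Longrightarrow> Re (\<xi> X) = 0"
  and lie_dual_out: "\<xi> \<in> lie_dual sm h \<Longrightarrow> X \<notin> LA \<Longrightarrow> \<xi> X = 0"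
  unfolding lie_dual_def by blast+

lemma lie_dual_eqI:
  assumes "\<xi> \<in> lie_dual sm h" "\<eta> \<in> lie_dual sm h" "\<And>a b. \<xi> (yy a b) = \<eta> (yy a b)"
  shows "\<xi> = \<eta>"
proof
  fix X
  show "\<xi> X = \<eta> X"
  proof (cases "X \<in> LA")
    case True
    have *: "\<zeta> X = (\<Sum>c\<in>B. (1/2) *\<^sub>R \<zeta> (yy (f c) (X c)))" if "\<zeta> \<in> lie_dual sm h" for \<zeta>
      by (subst LA_expand[OF True])
        (simp add: lie_dual_sum[OF that] LA_closed yy_LA lie_dual_scaleR[OF that])
    show ?thesis unfolding *[OF assms(1)] *[OF assms(2)] assms(3) ..
  next
    case False
    then show ?thesis using assms lie_dual_out by metis
  qed
qed

text \<open>
  Up to a constant, \<open>Phi T\<close> is \<open>X \<mapsto> \<i> tr(TX)\<close> for the trace over \<open>E\<close> followed by the trace from \<open>E\<close> to the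
  reals: the sum computes the trace because \<open>B\<close> and \<open>f ` B\<close> are dual frames.
\<close>

definition Phi :: "('v \<Rightarrow>\<^sub>L 'v) \<Rightarrow> 'v functional" where
  "Phi T X = (if X \<in> LA then \<i> * of_real ((\<Sum>b\<in>B. \<beta> (T (X b)) (f b)) / 2) else 0)"

lemma beta_add: "\<beta> (v + v') w = \<beta> v w + \<beta> v' w"
  and beta_scaleR: "\<beta> (r *\<^sub>R v) w = r * \<beta> v w"
  and beta_diff: "\<beta> (v - v') w = \<beta> v w - \<beta> v' w"
  using linear_add[OF linear_beta] linear_scale[OF linear_beta] linear_diff[OF linear_beta] by auto

lemma Phi_lie_dual: "Phi T \<in> lie_dual sm h"
  unfolding lie_dual_def Phi_def
  by (auto simp: LA_closed blinfun.add_left blinfun.add_right blinfun.scaleR_left blinfun.scaleR_right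
      beta_add beta_scaleR sum.distrib sum_distrib_left[symmetric] algebra_simps add_divide_distrib
      scaleR_conv_of_real)

lemma Phi_add: "Phi (S + T) = (\<lambda>X. Phi S X + Phi T X)"
  and Phi_scaleR: "Phi (r *\<^sub>R T) = (\<lambda>X. r *\<^sub>R Phi T X)"
  unfolding Phi_def
  by (auto simp: fun_eq_iff blinfun.add_left blinfun.scaleR_left beta_add beta_scaleR sum.distrib
      sum_distrib_left[symmetric] algebra_simps add_divide_distrib scaleR_conv_of_real)

lemma Phi_diff: "Phi (S - T) = (\<lambda>X. Phi S X - Phi T X)"
  using Phi_add[of "S - T" T] by (auto simp: fun_eq_iff)

lemma beta_skew: "T \<in> LA \<Longrightarrow> \<beta> (T v) w = - \<beta> v (T w)"
  unfolding \<beta>_def by (simp add: LA_skew p_minus)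

text \<open>The two rank-one halves of \<open>yy a b\<close> have traces against \<open>T\<close>
  that are equal up to sign by skewness, so they add up; the \<open>1/2\<close> in
  \<open>Phi\<close> absorbs the doubling.\<close>

lemma Phi_yy:
  assumes "T \<in> LA"
  shows "Phi T (yy a b) = \<i> * of_real (\<beta> (T b) a)"
proof -
  have "(\<Sum>c\<in>B. \<beta> (T (yy a b c)) (f c)) = (\<Sum>c\<in>B. \<beta> (sm (h c a) (T b)) (f c)) - (\<Sum>c\<in>B. \<beta> (sm (h c b) (T a)) (f c))"
    by (simp add: yy_apply blinfun.diff_right elinD[OF LA_elin[OF assms]] beta_diff sum_subtractf)
  also have "\<dots> = \<beta> (T b) a - \<beta> (T a) b" by (simp add: frame_trace)
  also have "\<beta> (T a) b = - \<beta> (T b) a" using beta_skew[OF assms, of a b] beta_commute by simp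
  finally show ?thesis unfolding Phi_def by (simp add: yy_LA)
qed

definition rank1 :: "'v \<Rightarrow> 'v \<Rightarrow> ('v \<Rightarrow>\<^sub>L 'v)" where
  "rank1 b j = Blinfun (\<lambda>v. (v \<bullet> b) *\<^sub>R j)"

lemma rank1_apply: "rank1 b j v = (v \<bullet> b) *\<^sub>R j"
  unfolding rank1_def by (subst bounded_linear_Blinfun_apply) (auto intro!: bounded_linear_intros)

definition bs :: "'v \<Rightarrow> 'v" where "bs = inv_into UNIV beta_map"

lemma beta_bs: "\<beta> v (bs j) = v \<bullet> j"
  unfolding bs_def by (metis inner_beta_map surj_beta_map surj_f_inv_f)

text \<open>The inverse of \<open>Phi\<close>, written as a matrix: \<open>bs j\<close> represents
  the \<open>j\<close>-th coordinate through \<open>\<beta>\<close>, so the entries are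
  \<open>\<beta> (T b) (bs j)\<close>. As a finite sum of evaluations of \<open>\<xi>\<close> it is
  visibly continuous for pointwise convergence, which carries compactness from functionals to
  operators.\<close>

definition Tmap :: "'v functional \<Rightarrow> ('v \<Rightarrow>\<^sub>L 'v)" where
  "Tmap \<xi> = (\<Sum>b\<in>Basis. \<Sum>j\<in>Basis. Im (\<xi> (yy (bs j) b)) *\<^sub>R rank1 b j)"

lemma continuous_Tmap: "continuous_on UNIV Tmap"
  unfolding Tmap_def
  by (intro continuous_intros continuous_on_product_coordinates)

lemma Im_yy_linear:
  assumes "\<xi> \<in> lie_dual sm h"
  shows "linear (\<lambda>b. Im (\<xi> (yy a b)))" "linear (\<lambda>a. Im (\<xi> (yy a b)))"
  by (auto intro!: linearI simp: yy_add_right yy_add_left yy_scaleR_right yy_scaleR_left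
      lie_dual_add[OF assms] lie_dual_scaleR[OF assms] yy_LA)

lemma Tmap_beta:
  assumes "\<xi> \<in> lie_dual sm h"
  shows "\<beta> (Tmap \<xi> v) a = Im (\<xi> (yy a v))"
proof -
  have "Tmap \<xi> v = (\<Sum>b\<in>Basis. \<Sum>j\<in>Basis. (Im (\<xi> (yy (bs j) b)) * (v \<bullet> b)) *\<^sub>R j)"
    unfolding Tmap_def by (simp add: blinfun.sum_left blinfun.scaleR_left rank1_apply)
  also have "\<dots> = (\<Sum>j\<in>Basis. (\<Sum>b\<in>Basis. (v \<bullet> b) * Im (\<xi> (yy (bs j) b))) *\<^sub>R j)"
    by (subst sum.swap) (simp add: scaleR_sum_left mult.commute)
  also have "\<dots> = (\<Sum>j\<in>Basis. Im (\<xi> (yy (bs j) v)) *\<^sub>R j)"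
  proof -
    have "(\<Sum>b\<in>Basis. (v \<bullet> b) * Im (\<xi> (yy a b))) = Im (\<xi> (yy a (\<Sum>b\<in>Basis. (v \<bullet> b) *\<^sub>R b)))" for a
      by (simp only: linear_sum[OF Im_yy_linear(1)[OF assms]] linear_scale[OF Im_yy_linear(1)[OF assms]] real_scaleR_def)
    then show ?thesis by (simp add: euclidean_representation)
  qed
  finally have 1: "Tmap \<xi> v = (\<Sum>j\<in>Basis. Im (\<xi> (yy (bs j) v)) *\<^sub>R j)" .
  have a: "a = (\<Sum>j\<in>Basis. \<beta> j a *\<^sub>R bs j)"
  proof -
    have "a - (\<Sum>j\<in>Basis. \<beta> j a *\<^sub>R bs j) = 0"
    proof (rule beta_nondeg)
      fix w
      have "\<beta> w (\<Sum>j\<in>Basis. \<beta> j a *\<^sub>R bs j) = (\<Sum>j\<in>Basis. \<beta> j a * (w \<bullet> j))"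
        by (simp add: linear_sum[OF linear_beta_right] linear_scale[OF linear_beta_right] beta_bs)
      also have "\<dots> = w \<bullet> beta_map a" unfolding beta_map_def by (simp add: inner_sum_right)
      finally show "\<beta> w (a - (\<Sum>j\<in>Basis. \<beta> j a *\<^sub>R bs j)) = 0"
        by (simp add: linear_diff[OF linear_beta_right] inner_beta_map)
    qed
    then show ?thesis by simp
  qed
  have "\<beta> (Tmap \<xi> v) a = (\<Sum>j\<in>Basis. Im (\<xi> (yy (bs j) v)) * \<beta> j a)"
    unfolding 1 by (simp add: linear_sum[OF linear_beta] beta_scaleR)
  also have "\<dots> = Im (\<xi> (yy (\<Sum>j\<in>Basis. \<beta> j a *\<^sub>R bs j) v))"
    by (simp add: linear_sum[OF Im_yy_linear(2)[OF assms]] linear_scale[OF Im_yy_linear(2)[OF assms]] mult.commute)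
  finally show ?thesis using a by simp
qed

lemma beta_sm: "\<beta> (sm c v) w = \<beta> v (sm (\<sigma> c) w)"
  unfolding \<beta>_def by (simp add: h_simps sigma_hom)

lemma beta_eqI: "(\<And>a. \<beta> v a = \<beta> w a) \<Longrightarrow> v = w"
  using beta_nondeg[of "v - w"] by (simp add: beta_commute[of _ "v - w"] beta_diff)

text \<open>Linearity over \<open>E\<close> comes from moving scalars across \<open>yy\<close>,
  skewness from its antisymmetry; both are first obtained for \<open>\<beta>\<close> and then
  transferred to \<open>h\<close>.\<close>

lemma Tmap_LA:
  assumes "\<xi> \<in> lie_dual sm h"
  shows "Tmap \<xi> \<in> LA"
proof -
  have el: "elin (Tmap \<xi>)"
    unfolding elin_def by (intro allI beta_eqI) (simp add: beta_sm Tmap_beta[OF assms] yy_sm)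
  have xm: "\<xi> (- X) = - \<xi> X" if "X \<in> LA" for X
    using lie_dual_scaleR[OF assms that, of "- 1"] by simp
  have skew: "\<beta> (Tmap \<xi> v) w = \<beta> v (- Tmap \<xi> w)" for v w
  proof -
    have "\<beta> (Tmap \<xi> v) w = - Im (\<xi> (yy v w))"
      unfolding Tmap_beta[OF assms] by (subst yy_anti) (simp add: xm yy_LA)
    also have "\<dots> = - \<beta> v (Tmap \<xi> w)" by (simp add: Tmap_beta[OF assms, symmetric] beta_commute)
    finally show ?thesis by (simp add: linear_neg[OF linear_beta_right])
  qed
  have "h (Tmap \<xi> v) w = h v (- Tmap \<xi> w)" for v w
    by (rule beta_eq_imp_h_eq) (simp add: elinD[OF el, symmetric] skew)
  then show ?thesis unfolding LA_iff using el by (simp add: h_simps)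
qed

lemma Phi_Tmap:
  assumes "\<xi> \<in> lie_dual sm h"
  shows "Phi (Tmap \<xi>) = \<xi>"
proof (rule lie_dual_eqI[OF Phi_lie_dual assms])
  fix a b
  show "Phi (Tmap \<xi>) (yy a b) = \<xi> (yy a b)"
    unfolding Phi_yy[OF Tmap_LA[OF assms]] Tmap_beta[OF assms]
    using lie_dual_Re[OF assms yy_LA] by (simp add: complex_eq_iff)
qed

lemma Tmap_Phi:
  assumes "T \<in> LA"
  shows "Tmap (Phi T) = T"
  by (rule blinfun_eqI, rule beta_eqI) (simp add: Tmap_beta[OF Phi_lie_dual] Phi_yy[OF assms])

lemma Phi_inj: "S \<in> LA \<Longrightarrow> T \<in> LA \<Longrightarrow> Phi S = Phi T \<Longrightarrow> S = T"
  by (metis Tmap_Phi)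

lemma coad_lie_dual:
  assumes "g \<in> GU" "\<xi> \<in> lie_dual sm h"
  shows "coad sm h g \<xi> \<in> lie_dual sm h"
proof -
  have 1: "gi g o\<^sub>L (X + Y) o\<^sub>L g = (gi g o\<^sub>L X o\<^sub>L g) + (gi g o\<^sub>L Y o\<^sub>L g)"
    "gi g o\<^sub>L (r *\<^sub>R X) o\<^sub>L g = r *\<^sub>R (gi g o\<^sub>L X o\<^sub>L g)" for X Y r
    by (auto intro!: blinfun_eqI simp: blinfun.add_left blinfun.add_right blinfun.scaleR_left blinfun.scaleR_right)
  show ?thesis
    unfolding lie_dual_def coad_def gi_def[symmetric]
    using lie_dual_add[OF assms(2)] lie_dual_scaleR[OF assms(2)] lie_dual_Re[OF assms(2)] lie_dual_out[OF assms(2)]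
    by (simp add: 1 LA_conj'[OF assms(1)])
qed

lemma coad_Phi:
  assumes "g \<in> GU" "T \<in> LA"
  shows "coad sm h g (Phi T) = Phi (g o\<^sub>L T o\<^sub>L gi g)"
proof (rule lie_dual_eqI[OF coad_lie_dual[OF assms(1) Phi_lie_dual] Phi_lie_dual])
  fix a b
  have "coad sm h g (Phi T) (yy a b) = Phi T (yy (gi g a) (gi g b))"
    unfolding coad_def gi_def[symmetric] yy_conj[OF assms(1)] ..
  also have "\<dots> = \<i> * of_real (\<beta> (g (T (gi g b))) a)"
    unfolding Phi_yy[OF assms(2)] \<beta>_def by (simp add: GU_adj[OF assms(1)] GU_adj'[OF assms(1)])
  finally show "coad sm h g (Phi T) (yy a b) = Phi (g o\<^sub>L T o\<^sub>L gi g) (yy a b)"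
    unfolding Phi_yy[OF LA_conj[OF assms]] by simp
qed

lemma closed_LA: "closed LA"
proof -
  have eq: "LA = (\<Inter>a. \<Inter>v. {X. blinfun_apply X (sm a v) = sm a (X v)}) \<inter>
     (\<Inter>v. \<Inter>w. {X. p (h (blinfun_apply X v) w) = - p (h v (X w))})"
  proof (safe)
    fix X assume "X \<in> LA"
    then show "X (sm a v) = sm a (X v)" "p (h (X v) w) = - p (h v (X w))" for a v w
      by (simp_all add: LA_skew p_minus elinD[OF LA_elin])
  next
    fix X assume X: "X \<in> (\<Inter>a. \<Inter>v. {X. blinfun_apply X (sm a v) = sm a (X v)})"
      "X \<in> (\<Inter>v. \<Inter>w. {X. p (h (blinfun_apply X v) w) = - p (h v (X w))})"
    have "h (X v) w = - h v (X w)" for v w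
    proof (rule p_eqI)
      show "p (h (X v) w) = p (- h v (X w))" using X(2) by (simp add: p_minus)
      \<comment> \<open>Exchanging \<open>v\<close> and \<open>w\<close> applies
        \<open>\<sigma>\<close> to the form, so the condition on the first coordinate for all pairs
        already contains the one on the second.\<close>
      have "p (h (X w) v) = - p (h w (X v))" using X(2) by blast
      then show "p (\<sigma> (h (X v) w)) = p (\<sigma> (- h v (X w)))"
        by (simp add: p_minus sigma_minus h_sigma)
    qed
    then show "X \<in> LA" unfolding LA_iff elin_def using X(1) by auto
  qed
  have c1: "closed {X. blinfun_apply X (sm a v) = sm a (blinfun_apply X v)}" for a v
    by (intro closed_Collect_eq continuous_on_compose2[OF linear_continuous_on[OF bounded_linear_sm]] continuous_intros) auto
  have c2: "closed {X. p (h (blinfun_apply X v) w) = - p (h v (blinfun_apply X w))}" for v w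
    by (intro closed_Collect_eq continuous_intros bounded_bilinear.continuous_on[OF bounded_bilinear_p_h])
  show ?thesis unfolding eq by (intro closed_Int closed_INT ballI c1 c2)
qed

text \<open>A positive definite form is bounded below on the unit sphere of the finite-dimensional
  space \<open>LA\<close>. Since \<open>ip\<close> is an abstract bilinear function, its continuity
  has to be produced by expansion in a finite spanning set.\<close>

lemma dual_norm_lower_bound:
  assumes ip: "is_inner_product_on_dual sm h ip"
  shows "\<exists>c>0. \<forall>T\<in>LA. c * norm T \<le> dual_norm ip (Phi T)"
proof -
  define Q where "Q S T = ip (Phi S) (Phi T)" for S T
  have sym: "Q S T = Q T S" for S T
    using ip Phi_lie_dual unfolding Q_def is_inner_product_on_dual_def by blast
  have add: "Q (S + S') T = Q S T + Q S' T" for S S' T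
    using ip Phi_lie_dual unfolding Q_def is_inner_product_on_dual_def Phi_add by blast
  have scale: "Q (r *\<^sub>R S) T = r * Q S T" for r S T
    using ip Phi_lie_dual unfolding Q_def is_inner_product_on_dual_def Phi_scaleR by blast
  have lin: "linear (\<lambda>S. Q S T)" for T by (rule linearI) (auto simp: add scale)
  have lin2: "linear (\<lambda>T. Q S T)" for S using lin[of S] by (simp add: sym)
  have pos: "Q T T > 0" if "T \<in> LA" "T \<noteq> 0" for T
  proof -
    have "Phi T \<noteq> (\<lambda>X. 0)"
    proof
      assume "Phi T = (\<lambda>X. 0)"
      then have "Phi T = Phi 0" using Phi_scaleR[of 0 0] by simp
      then show False using Phi_inj that LA_closed(3) by blast
    qed
    then show ?thesis using ip Phi_lie_dual unfolding Q_def is_inner_product_on_dual_def by blast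
  qed
  have expand: "T = (\<Sum>c\<in>B. \<Sum>j\<in>Basis. ((T c \<bullet> j) / 2) *\<^sub>R yy (f c) j)" if "T \<in> LA" for T
  proof -
    have ly: "linear (yy a)" for a by (rule linearI) (auto simp: yy_add_right yy_scaleR_right)
    have "yy (f c) (T c) = (\<Sum>j\<in>Basis. (T c \<bullet> j) *\<^sub>R yy (f c) j)" for c
      using linear_sum[OF ly, of "f c" "\<lambda>j. (T c \<bullet> j) *\<^sub>R j" Basis]
      by (simp add: euclidean_representation yy_scaleR_right)
    then show ?thesis by (subst LA_expand[OF that]) (simp add: scaleR_sum_right)
  qed
  \<comment> \<open>A polynomial in the matrix entries of \<open>T\<close> that agrees with
    \<open>Q T T\<close> on the Lie algebra; continuity is evident for it.\<close>
  define q where "q T = (\<Sum>c\<in>B. \<Sum>j\<in>Basis. \<Sum>c'\<in>B. \<Sum>j'\<in>Basis.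
      (((blinfun_apply T c \<bullet> j) / 2) * ((T c' \<bullet> j') / 2)) * Q (yy (f c') j') (yy (f c) j))" for T
  have Qq: "Q T T = q T" if "T \<in> LA" for T
  proof -
    have "Q T T = Q (\<Sum>c\<in>B. \<Sum>j\<in>Basis. ((T c \<bullet> j) / 2) *\<^sub>R yy (f c) j) (\<Sum>c\<in>B. \<Sum>j\<in>Basis. ((T c \<bullet> j) / 2) *\<^sub>R yy (f c) j)"
      using expand[OF that] by simp
    also have "\<dots> = q T" unfolding q_def
      by (simp only: linear_sum[OF lin] linear_sum[OF lin2] linear_scale[OF lin] linear_scale[OF lin2]
        sum_distrib_left real_scaleR_def mult.assoc)
    finally show ?thesis .
  qed
  have cq: "continuous_on A q" for A unfolding q_def by (intro continuous_intros) auto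
  let ?S = "LA \<inter> sphere 0 1"
  have "closed {T :: 'v \<Rightarrow>\<^sub>L 'v. norm T = 1}" by (intro closed_Collect_eq continuous_intros)
  moreover have "bounded {T :: 'v \<Rightarrow>\<^sub>L 'v. norm T = 1}" by (rule boundedI[of _ 1]) auto
  moreover have "sphere 0 1 = {T :: 'v \<Rightarrow>\<^sub>L 'v. norm T = 1}" by auto
  ultimately have comp: "compact ?S" by (intro closed_Int_compact closed_LA) (simp add: compact_eq_bounded_closed)
  show ?thesis
  proof (cases "?S = {}")
    case True
    have "T = 0" if "T \<in> LA" for T
    proof (rule ccontr)
      assume "T \<noteq> 0"
      then have "(1 / norm T) *\<^sub>R T \<in> ?S" using that LA_closed(2) by auto
      with True show False by blast
    qed
    then have "\<forall>T\<in>LA. 1 * norm T \<le> dual_norm ip (Phi T)"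
    proof (intro ballI)
      fix T assume *: "\<And>T. T \<in> LA \<Longrightarrow> T = 0" "T \<in> LA"
      have "T = 0" using * by blast
      moreover have "Q 0 0 = 0" using scale[of 0 0 0] by simp
      ultimately show "1 * norm T \<le> dual_norm ip (Phi T)" unfolding dual_norm_def Q_def by simp
    qed
    then show ?thesis by (intro exI[of _ 1]) simp
  next
    case False
    obtain T0 where T0: "T0 \<in> ?S" "\<forall>T\<in>?S. q T0 \<le> q T"
      using continuous_attains_inf[OF comp False cq] by blast
    have "T0 \<noteq> 0" "T0 \<in> LA" using T0 by auto
    then have m: "q T0 > 0" using pos Qq by metis
    have "sqrt (q T0) * norm T \<le> dual_norm ip (Phi T)" if T: "T \<in> LA" for T
    proof (cases "T = 0")
      case True
      have "Q 0 0 = 0" using scale[of 0 0 0] by simp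
      then show ?thesis using True unfolding dual_norm_def Q_def by simp
    next
      case False
      define U where "U = (1 / norm T) *\<^sub>R T"
      have U: "U \<in> ?S" unfolding U_def using T False LA_closed(2) by auto
      have "T = norm T *\<^sub>R U" unfolding U_def using False by simp
      then have "Q T T = (norm T)\<^sup>2 * Q U U" using scale sym by (metis mult.assoc power2_eq_square)
      moreover have "Q U U \<ge> q T0" using T0(2) U Qq[of U] by auto
      ultimately have "q T0 * (norm T)\<^sup>2 \<le> Q T T" by (simp add: mult.commute mult_right_mono)
      then have "sqrt (q T0 * (norm T)\<^sup>2) \<le> sqrt (Q T T)" by simp
      then show ?thesis unfolding dual_norm_def Q_def by (simp add: real_sqrt_mult)
    qed
    then show ?thesis using m by (intro exI[of _ "sqrt (q T0)"]) simp
  qed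
qed

section \<open>Stability implies cyclicity\<close>

text \<open>Explicit one-parameter groups of norm-one scalars: \<open>c\<close> and \<open>s\<close>
  are \<open>cosh\<close> and \<open>sinh\<close> of \<open>x\<close> for
  \<open>\<omega> = 1\<close>, and \<open>cos\<close> and \<open>sin\<close> of \<open>x\<close> for
  \<open>\<omega> = \<i>\<close>, so they lie in \<open>F\<close> in each case.\<close>

lemma ex_norm_one:
  assumes "x \<in> F"
  shows "\<exists>t. p t = exp (\<omega> * x) \<and> p (\<sigma> t) = exp (- (\<omega> * x))"
proof -
  define c where "c = (exp (\<omega> * x) + exp (- (\<omega> * x))) / 2"
  define s where "s = (exp (\<omega> * x) - exp (- (\<omega> * x))) / (2 * \<omega>)"
  have cs: "c \<in> F \<and> s \<in> F"
  proof (cases "F = UNIV")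
    case False
    then have FR: "F = \<real>" using base_field by auto
    then obtain y where y: "x = of_real y" using assms Reals_cases by blast
    show ?thesis
    proof (cases "\<omega> = 1")
      case True
      have "c = of_real ((exp y + exp (- y)) / 2)" "s = of_real ((exp y - exp (- y)) / 2)"
        unfolding c_def s_def True y by (simp_all add: exp_of_real[symmetric])
      then show ?thesis unfolding FR by (metis Reals_of_real)
    next
      case False
      then have w: "\<omega> = \<i>" using omega by auto
      have "c = of_real (cos y)" "s = of_real (sin y)"
        unfolding c_def s_def w y cos_of_real[symmetric] sin_of_real[symmetric] cos_exp_eq sin_exp_eq by simp_all
      then show ?thesis unfolding FR by (metis Reals_of_real)
    qed
  qed simp
  have 1: "s * \<omega> = (exp (\<omega> * x) - exp (- (\<omega> * x))) / 2" unfolding s_def using omega_sq(3) by simp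
  have "c + s * \<omega> = exp (\<omega> * x)" "c - s * \<omega> = exp (- (\<omega> * x))"
    unfolding 1 c_def by (simp_all add: field_simps)
  then have "p (\<iota> c + \<iota> s * \<delta>) = exp (\<omega> * x)" "p (\<sigma> (\<iota> c + \<iota> s * \<delta>)) = exp (- (\<omega> * x))"
    unfolding p_decomp[OF conjunct1[OF cs] conjunct2[OF cs]] by auto
  then show ?thesis by blast
qed

section \<open>Submodules with nondegenerate form and their scalar automorphisms\<close>

definition esub :: "'v set \<Rightarrow> bool" where
  "esub S \<longleftrightarrow> 0 \<in> S \<and> (\<forall>u\<in>S. \<forall>v\<in>S. u + v \<in> S) \<and> (\<forall>a. \<forall>v\<in>S. sm a v \<in> S)"

lemma esub_subspace: "esub S \<Longrightarrow> subspace S"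
  unfolding esub_def subspace_def by (metis scaleR_compat)

lemma esub_diff: "esub S \<Longrightarrow> u \<in> S \<Longrightarrow> v \<in> S \<Longrightarrow> u - v \<in> S"
  using esub_subspace subspace_diff by blast

lemma esub_orth: "esub {v. \<forall>x\<in>S. h v x = 0}"
  unfolding esub_def by (simp add: h_simps)

text \<open>The \<open>h\<close>-complement of \<open>S\<close> is the Euclidean complement of
  \<open>beta_map\<close> applied to \<open>S\<close>, so real dimensions are complementary; a
  trivial intersection then makes the sum everything. Counting real dimensions avoids bases over
  \<open>E\<close>, over which \<open>S\<close> need not be free.\<close>

lemma orth_decomposition:
  assumes S: "esub S" and triv: "\<And>x. x \<in> S \<Longrightarrow> (\<forall>y\<in>S. h x y = 0) \<Longrightarrow> x = 0"
  shows "\<exists>s\<in>S. \<forall>x\<in>S. h (v - s) x = 0"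
proof -
  define T where "T = {v. \<forall>x\<in>S. h v x = 0}"
  have subS: "subspace S" and subT: "subspace T"
    unfolding T_def by (rule esub_subspace, rule S esub_orth)+
  have Teq: "T = {y \<in> UNIV. \<forall>x \<in> beta_map ` S. orthogonal x y}"
  proof (rule Set.set_eqI)
    fix v
    have "(\<forall>x\<in>S. h v x = 0) \<longleftrightarrow> (\<forall>x\<in>S. \<beta> v x = 0)"
    proof
      show "\<forall>x\<in>S. \<beta> v x = 0" if "\<forall>x\<in>S. h v x = 0"
      proof
        fix x assume "x \<in> S"
        then have "h v x = 0" "h x v = 0" using that h_sigma[of v x] sigma_0 by auto
        then show "\<beta> v x = 0" unfolding \<beta>_def by (simp add: p_0)
      qed
      show "\<forall>x\<in>S. h v x = 0" if *: "\<forall>x\<in>S. \<beta> v x = 0"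
      proof
        fix x assume x: "x \<in> S"
        have "h v x = h 0 0"
        proof (rule beta_eq_imp_h_eq)
          fix c
          have "sm (\<sigma> c) x \<in> S" using x S unfolding esub_def by blast
          then show "\<beta> (sm c v) x = \<beta> (sm c 0) 0" using * by (simp add: beta_sm sm_simps beta_zero_left)
        qed
        then show "h v x = 0" by (simp add: h_simps)
      qed
    qed
    then show "v \<in> T \<longleftrightarrow> v \<in> {y \<in> UNIV. \<forall>x \<in> beta_map ` S. orthogonal x y}"
      unfolding T_def by (simp add: orthogonal_def inner_commute[of "beta_map _"] inner_beta_map)
  qed
  have "subspace (beta_map ` S)" by (rule linear_subspace_image[OF linear_beta_map subS])
  then have "dim T + dim (beta_map ` S) = dim (UNIV :: 'v set)"
    unfolding Teq by (intro dim_subspace_orthogonal_to_vectors) auto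
  moreover have "dim (beta_map ` S) = dim S"
    by (rule dim_image_eq[OF linear_beta_map]) (rule inj_on_subset[OF inj_beta_map subset_UNIV])
  moreover have "S \<inter> T = {0}"
    using triv subspace_0[OF subS] subspace_0[OF subT] unfolding T_def by auto
  moreover have "dim {x + y |x y. x \<in> S \<and> y \<in> T} + dim (S \<inter> T) = dim S + dim T"
    by (rule dim_sums_Int[OF subS subT])
  ultimately have "dim {x + y |x y. x \<in> S \<and> y \<in> T} = DIM('v)" by (simp add: dim_UNIV)
  then have "span {x + y |x y. x \<in> S \<and> y \<in> T} = UNIV" by (rule dim_eq_full[THEN iffD1])
  then have "{x + y |x y. x \<in> S \<and> y \<in> T} = UNIV"
    using span_eq_iff[THEN iffD2, OF subspace_sums[OF subS subT]] by simp
  then obtain s y where "v = s + y" "s \<in> S" "y \<in> T" by blast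
  then show ?thesis unfolding T_def by (intro bexI[of _ s]) auto
qed

text \<open>The operator \<open>k t\<close> multiplies \<open>S\<close> by \<open>t\<close> and
  fixes its complement. As \<open>T\<close> preserves both summands it commutes with
  \<open>k t\<close>, and since \<open>e\<close> lies in the complement, \<open>k t\<close> belongs
  to \<open>H\<close>.\<close>

lemma infinite_stabilizer_scalars:
  assumes T: "T \<in> LA" and S: "esub S" and TS: "\<And>x. x \<in> S \<Longrightarrow> T x \<in> S" and SVH: "S \<subseteq> VH"
    and triv: "\<And>x. x \<in> S \<Longrightarrow> (\<forall>y\<in>S. h x y = 0) \<Longrightarrow> x = 0" and ne: "u \<in> S" "u \<noteq> 0"
  shows "infinite (H_stabilizer sm h e (Phi T))"
proof -
  have "\<exists>Q. \<forall>v. Q v \<in> S \<and> (\<forall>x\<in>S. h (v - Q v) x = 0)"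
    using orth_decomposition[OF S triv] by metis
  then obtain Q where Q: "\<And>v. Q v \<in> S" "\<And>v x. x \<in> S \<Longrightarrow> h (v - Q v) x = 0" by blast
  \<comment> \<open>The orthogonal projection is pinned down by its defining property, so
    additivity, linearity over \<open>E\<close> and commutation with \<open>T\<close> each follow by
    exhibiting a candidate.\<close>
  have uniq: "Q v = s" if "s \<in> S" "\<And>x. x \<in> S \<Longrightarrow> h (v - s) x = 0" for v s
  proof -
    have "s - Q v = 0"
    proof (rule triv)
      show "s - Q v \<in> S" using esub_diff[OF S] that Q by blast
      show "\<forall>y\<in>S. h (s - Q v) y = 0"
        using that(2) Q(2)[of _ v] by (simp add: h_simps)
    qed
    then show ?thesis by simp
  qed
  have Qadd: "Q (v + w) = Q v + Q w" for v w
  proof (rule uniq)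
    show "Q v + Q w \<in> S" using Q(1) S unfolding esub_def by blast
    show "h (v + w - (Q v + Q w)) x = 0" if "x \<in> S" for x
      using Q(2)[OF that, of v] Q(2)[OF that, of w] by (simp add: h_simps)
  qed
  have Qsm: "Q (sm a v) = sm a (Q v)" for a v
  proof (rule uniq)
    show "sm a (Q v) \<in> S" using Q(1) S unfolding esub_def by blast
    show "h (sm a v - sm a (Q v)) x = 0" if "x \<in> S" for x
      using Q(2)[OF that, of v] by (simp add: sm_diff_right[symmetric] h_sm_left)
  qed
  have QT: "Q (T v) = T (Q v)" for v
  proof (rule uniq)
    show "T (Q v) \<in> S" using TS Q(1) by blast
    show "h (T v - T (Q v)) x = 0" if "x \<in> S" for x
      using Q(2)[OF TS[OF that], of v] by (simp add: blinfun.diff_right[symmetric] LA_skew[OF T])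
  qed
  have Qid: "Q v = v" if "v \<in> S" for v by (rule uniq) (use that in \<open>auto simp: h_simps\<close>)
  have Qe: "Q e = 0"
    by (rule uniq) (use S SVH VH_h_right in \<open>auto simp: esub_def\<close>)
  define k where "k t = Blinfun (\<lambda>v. v + sm (t - 1) (Q v))" for t
  have k: "k t v = v + sm (t - 1) (Q v)" "elin (k t)" for t v
    unfolding k_def using Blinfun_E_linear[of "\<lambda>v. v + sm (t - 1) (Q v)"]
    by (simp_all add: Qadd Qsm sm_simps algebra_simps)
  have kGU: "k t \<in> GU" if t: "t * \<sigma> t = 1" for t
  proof -
    have "h (k t v) (k t w) = h v w" for v w
    proof -
      define a b a' b' where d: "a = Q v" "b = v - Q v" "a' = Q w" "b' = w - Q w"
      have 0: "h a b' = 0" "h b a' = 0" "h a' b = 0" "h b' a = 0"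
        unfolding d using Q(2)[OF Q(1)] by (auto simp: h_sigma[symmetric, of _ "_ - _"] sigma_0)
      have v: "v = a + b" "w = a' + b'" unfolding d by auto
      have "k t v = sm t a + b" "k t w = sm t a' + b'" unfolding k d by (simp_all add: sm_simps)
      then have "h (k t v) (k t w) = (t * \<sigma> t) * h a a' + h b b'" by (simp add: h_simps 0 algebra_simps)
      also have "\<dots> = h v w" unfolding t v by (simp add: h_simps 0)
      finally show ?thesis .
    qed
    then show ?thesis unfolding GU_def using k(2) by simp
  qed
  have stab: "k t \<in> H_stabilizer sm h e (Phi T)" if t: "t * \<sigma> t = 1" for t
  proof -
    have "k t o\<^sub>L T o\<^sub>L gi (k t) = T"
    proof (rule blinfun_eqI)
      fix v
      have "k t (T w) = T (k t w)" for w
        by (simp add: k QT blinfun.add_right elinD[OF LA_elin[OF T]])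
      then show "(k t o\<^sub>L T o\<^sub>L gi (k t)) v = T v" by (simp add: gi_right[OF kGU[OF t]])
    qed
    then show ?thesis
      unfolding H_stabilizer_def carrier_H using kGU[OF t] coad_Phi[OF kGU[OF t] T]
      by (simp add: k Qe sm_simps)
  qed
  have "\<forall>x\<in>{0<..<1::real}. \<exists>t. p t = exp (\<omega> * of_real x) \<and> p (\<sigma> t) = exp (- (\<omega> * of_real x))"
    using ex_norm_one F_closed(8) by blast
  then obtain t where t: "\<And>x. x \<in> {0<..<1::real} \<Longrightarrow> p (t x) = exp (\<omega> * of_real x)"
    "\<And>x. x \<in> {0<..<1::real} \<Longrightarrow> p (\<sigma> (t x)) = exp (- (\<omega> * of_real x))" by metis
  have t1: "t x * \<sigma> (t x) = 1" if "x \<in> {0<..<1}" for x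
    by (rule p_eqI) (simp_all add: p_mult sigma_hom t[OF that] p_1 exp_minus)
  have inj: "inj_on (\<lambda>x. k (t x)) {0<..<1}"
  proof (rule inj_onI, rule ccontr)
    fix x y :: real assume x: "x \<in> {0<..<1}" and y: "y \<in> {0<..<1}" and eq: "k (t x) = k (t y)" and "x \<noteq> y"
    have "k (t x) u = k (t y) u" using eq by simp
    then have z: "sm (t x - t y) u = 0" using k(1) Qid[OF ne(1)] by (simp add: sm_simps)
    \<comment> \<open>On parameters in \<open>(-1, 1)\<close> the imaginary parts differ by less
      than \<open>2 * pi\<close>, so \<open>exp\<close> is injective there. Negative parameters are
      included for the second coordinate, which is the exponential of the negated argument.\<close>
    have e1: "exp (\<omega> * of_real x) \<noteq> exp (\<omega> * of_real y)" if xy: "x \<in> {-1<..<1}" "y \<in> {-1<..<1}" "x \<noteq> y" for x y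
    proof
      assume "exp (\<omega> * of_real x) = exp (\<omega> * of_real y)"
      moreover have "\<bar>Im (\<omega> * of_real x) - Im (\<omega> * of_real y)\<bar> < 2 * pi"
        using omega xy pi_gt3 by auto
      ultimately have "\<omega> * of_real x = \<omega> * of_real y" using exp_complex_eqI by blast
      then show False using omega_sq(3) xy by simp
    qed
    have "p (t x - t y) \<noteq> 0" using e1[of x y] x y \<open>x \<noteq> y\<close> by (simp add: p_diff t)
    moreover have "p (\<sigma> (t x - t y)) \<noteq> 0" using e1[of "- x" "- y"] x y \<open>x \<noteq> y\<close> by (simp add: p_diff t sigma_diff)
    ultimately obtain i where "(t x - t y) * i = 1" using ex_inverse by blast
    then have "u = sm i (sm (t x - t y) u)" by (simp add: sm_sm mult.commute sm_one del: sm_diff_left)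
    then show False unfolding z sm_zero_right using ne by simp
  qed
  have "(\<lambda>x. k (t x)) ` {0<..<1} \<subseteq> H_stabilizer sm h e (Phi T)" using stab t1 by blast
  moreover have "infinite ((\<lambda>x. k (t x)) ` {0<..<1::real})"
    using finite_image_iff[OF inj] infinite_Ioo[of 0 "1::real"] by simp
  ultimately show ?thesis using finite_subset by blast
qed

text \<open>Since \<open>c * c\<close> is the sign \<open>\<epsilon>\<close>, the inverse of
  \<open>c\<close> is \<open>\<epsilon> c\<close>, and \<open>P'\<close> is the mean of
  \<open>P\<close> and its conjugate by \<open>c\<close>. Scalars of \<open>E\<close> commute with
  each other, so commutation with \<open>d\<close> survives the averaging.\<close>

lemma average_projection:
  assumes "linear P" "\<And>v. P v \<in> R" "\<And>v. v \<in> R \<Longrightarrow> P v = v" "esub R"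
    and c: "c * c = \<iota> (of_real \<epsilon>)" "\<epsilon> * \<epsilon> = 1"
  shows "\<exists>P'. linear P' \<and> (\<forall>v. P' v \<in> R) \<and> (\<forall>v\<in>R. P' v = v) \<and> (\<forall>v. P' (sm c v) = sm c (P' v)) \<and>
    (\<forall>d. (\<forall>v. P (sm d v) = sm d (P v)) \<longrightarrow> (\<forall>v. P' (sm d v) = sm d (P' v)))"
proof -
  define P' where "P' v = (1/2) *\<^sub>R (P v + \<epsilon> *\<^sub>R sm c (P (sm c v)))" for v
  have cc: "sm c (sm c v) = \<epsilon> *\<^sub>R v" for v by (simp add: sm_sm c scaleR_compat)
  have P: "P (v + w) = P v + P w" "P (r *\<^sub>R v) = r *\<^sub>R P v" for v w r
    using assms(1) linear_add linear_scale by blast+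
  have R: "u + v \<in> R" "sm a u \<in> R" "r *\<^sub>R u \<in> R" if "u \<in> R" "v \<in> R" for u v a r
    using assms(4) that esub_subspace[OF assms(4)] subspace_scale unfolding esub_def by blast+
  have "linear P'"
    by (rule linearI) (simp_all add: P'_def P sm_simps sm_scaleR scaleR_add_right algebra_simps)
  moreover have "P' v \<in> R" for v unfolding P'_def using R assms(2) by blast
  moreover have "P' v = v" if "v \<in> R" for v
  proof -
    have "P (sm c v) = sm c v" using assms(3) R that by blast
    then show ?thesis unfolding P'_def using that assms(3) c(2)
      by (simp add: cc scaleR_add_right[symmetric] scaleR_2[symmetric])
  qed
  moreover have "P' (sm c v) = sm c (P' v)" for v
    unfolding P'_def by (simp add: cc P sm_scaleR sm_simps c(2)) (simp add: cc P(2) sm_scaleR sm_sm[symmetric] c(2) add.commute)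
  moreover have "P' (sm d v) = sm d (P' v)" if "\<And>v. P (sm d v) = sm d (P v)" for d v
  proof -
    have "P (sm c (sm d v)) = sm d (P (sm c v))" using that[of "sm c v"] by (simp add: sm_sm mult.commute)
    then show ?thesis unfolding P'_def using that[of v] by (simp add: sm_scaleR sm_simps mult.commute)
  qed
  ultimately show ?thesis by blast
qed

text \<open>A real-linear projection onto \<open>R\<close> is averaged over
  \<open>\<iota> \<i>\<close> when \<open>F\<close> is complex and then over
  \<open>\<delta>\<close>; together with the reals these generate \<open>E\<close>. This replaces a
  choice of basis for \<open>R\<close>.\<close>

lemma ex_E_projection:
  assumes R: "esub R"
  shows "\<exists>Q. elin Q \<and> (\<forall>v. Q v \<in> R) \<and> (\<forall>v\<in>R. Q v = v)"
proof -
  have "\<exists>g. range g \<subseteq> R \<and> linear g \<and> (\<forall>v\<in>R. g (id v) = v)"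
    by (rule linear_exists_left_inverse_on[OF linear_id esub_subspace[OF R] inj_on_id])
  then obtain P0 where P0: "linear P0" "range P0 \<subseteq> R" "\<forall>x\<in>R. P0 (id x) = x" by (elim exE conjE)
  have "\<exists>P. linear P \<and> (\<forall>v. P v \<in> R) \<and> (\<forall>v\<in>R. P v = v) \<and> (\<forall>s\<in>F. \<forall>v. P (sm (\<iota> s) v) = sm (\<iota> s) (P v))"
  proof (cases "F = \<real>")
    case True
    have "P0 (sm (\<iota> s) v) = sm (\<iota> s) (P0 v)" if "s \<in> F" for s v
    proof -
      have "s \<in> \<real>" using that True by simp
      then obtain r where "s = of_real r" by (rule Reals_cases)
      then show ?thesis using linear_scale[OF P0(1), of r v] by (simp only: scaleR_compat)
    qed
    moreover have "\<forall>v. P0 v \<in> R" "\<forall>v\<in>R. P0 v = v" using P0(2,3) by auto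
    ultimately show ?thesis using P0(1) by blast
  next
    case False
    then have FU: "F = UNIV" using base_field by auto
    have P0R: "P0 v \<in> R" for v using P0(2) by blast
    have ii: "\<iota> \<i> * \<iota> \<i> = \<iota> (of_real (- 1))" using iota_hom(2)[of "\<i>" "\<i>"] FU by simp
    obtain P where P: "linear P" "\<forall>v. P v \<in> R" "\<forall>v\<in>R. P v = v" "\<forall>v. P (sm (\<iota> \<i>) v) = sm (\<iota> \<i>) (P v)"
      using average_projection[OF P0(1) P0R _ R ii] P0(3) by auto
    have "P (sm (\<iota> s) v) = sm (\<iota> s) (P v)" for s v
    proof -
      show ?thesis using P(4) unfolding sm_iota_complex[OF FU, of s v] sm_iota_complex[OF FU, of s "P v"]
        by (simp only: linear_add[OF P(1)] linear_scale[OF P(1)])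
    qed
    then show ?thesis using P by blast
  qed
  then obtain P where P: "linear P" "\<forall>v. P v \<in> R" "\<forall>v\<in>R. P v = v" "\<forall>s\<in>F. \<forall>v. P (sm (\<iota> s) v) = sm (\<iota> s) (P v)"
    by blast
  obtain \<epsilon> :: real where eps: "\<omega> * \<omega> = of_real \<epsilon>" "\<epsilon> * \<epsilon> = 1"
    using omega_sq(1) by (metis mult_minus_left mult_minus_right mult_1 minus_minus of_real_1 of_real_minus)
  have dd: "\<delta> * \<delta> = \<iota> (of_real \<epsilon>)"
    unfolding eps(1)[symmetric]
    by (rule p_eqI) (simp_all add: p_mult p_delta sigma_hom sigma_delta p_minus p_iota omega_sq)
  obtain Q where Q: "linear Q" "\<forall>v. Q v \<in> R" "\<forall>v\<in>R. Q v = v" "\<forall>v. Q (sm \<delta> v) = sm \<delta> (Q v)"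
    "\<forall>s\<in>F. \<forall>v. Q (sm (\<iota> s) v) = sm (\<iota> s) (Q v)"
    using average_projection[OF P(1) P(2)[rule_format] P(3)[rule_format] R dd eps(2)] P(4) by metis
  have Qsm: "Q (sm a v) = sm a (Q v)" for a v
  proof -
    obtain s t where st: "s \<in> F" "t \<in> F" "a = \<iota> s + \<iota> t * \<delta>" using decomp[of a] by blast
    show ?thesis unfolding st(3) using st(1,2) Q(4,5)
      by (simp add: sm_add_left sm_sm[symmetric] linear_add[OF Q(1)])
  qed
  show ?thesis
    using Blinfun_E_linear[of Q, OF linear_add[OF Q(1)] Qsm] Q(2,3) by metis
qed

text \<open>
  From an \<open>E\<close>-linear projection \<open>A\<close> onto an isotropic submodule, \<open>Q = A - A A\<^sup>* / 2\<close> is a projection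
  onto the same submodule that satisfies \<open>Q Q\<^sup>* = Q\<^sup>* Q = 0\<close>.
\<close>

lemma ex_isotropic_projection:
  assumes R: "esub R" and RVH: "R \<subseteq> VH" and iso: "\<And>x y. x \<in> R \<Longrightarrow> y \<in> R \<Longrightarrow> h x y = 0"
  shows "\<exists>Q Q'. elin Q \<and> elin Q' \<and> (\<forall>v w. h (Q v) w = h v (Q' w)) \<and> (\<forall>v. Q v \<in> R) \<and> (\<forall>v\<in>R. Q v = v) \<and>
     (\<forall>v. Q' (Q' v) = Q' v) \<and> (\<forall>v. Q (Q' v) = 0) \<and> (\<forall>v. Q' (Q v) = 0) \<and> Q e = 0 \<and> Q' e = 0"
proof -
  obtain Q0 where Q0: "elin Q0" "\<And>v. Q0 v \<in> R" "\<And>v. v \<in> R \<Longrightarrow> Q0 v = v" using ex_E_projection[OF R] by blast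
  \<comment> \<open>Precomposition with \<open>projH\<close> makes \<open>A\<close> kill
    \<open>e\<close>; its adjoint kills \<open>e\<close> because \<open>R\<close> lies in
    \<open>VH\<close>.\<close>
  define A where "A = Blinfun (\<lambda>v. Q0 (projH v))"
  have A: "A v = Q0 (projH v)" "elin A" for v
    unfolding A_def using Blinfun_E_linear[of "\<lambda>v. Q0 (projH v)"]
    by (simp_all add: projH_def coef_def h_simps sm_simps blinfun.add_right blinfun.diff_right
        elinD[OF Q0(1)] algebra_simps)
  have AR: "A v \<in> R" for v unfolding A using Q0 by blast
  have Aid: "A v = v" if "v \<in> R" for v unfolding A using that Q0(3) projH_id RVH by auto
  have Ae: "A e = 0" unfolding A projH_def coef_def using h_ee_ei by (simp add: sm_simps)
  obtain A' where A': "elin A'" "\<And>v w. h (A v) w = h v (A' w)" using ex_adjoint[OF A(2)] by blast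
  have A'R: "A' r = 0" if "r \<in> R" for r
    by (rule nondeg_right_eqI) (simp add: A'(2)[symmetric] h_simps iso[OF AR that])
  have A'e: "A' e = 0"
    by (rule nondeg_right_eqI) (use AR RVH VH_h_left in \<open>auto simp: A'(2)[symmetric] h_simps\<close>)
  have A'A': "A' (A' w) = A' w" for w
    by (rule nondeg_right_eqI) (simp add: A'(2)[symmetric] Aid[OF AR])
  have A'adj: "h (A' v) w = h v (A w)" for v w using A'(2)[of w v] by (metis h_sigma)
  define Q where "Q = A - (1/2) *\<^sub>R (A o\<^sub>L A')"
  define Q' where "Q' = A' - (1/2) *\<^sub>R (A o\<^sub>L A')"
  have Q: "Q v = A v - (1/2) *\<^sub>R A (A' v)" "Q' v = A' v - (1/2) *\<^sub>R A (A' v)" for v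
    unfolding Q_def Q'_def by (simp_all add: blinfun.diff_left blinfun.scaleR_left)
  have el: "elin Q" "elin Q'"
    unfolding elin_def by (simp_all add: Q elinD[OF A(2)] elinD[OF A'(1)] sm_simps sm_scaleR)
  have adj: "h (Q v) w = h v (Q' w)" for v w
  proof -
    have "h ((1/2) *\<^sub>R A (A' v)) w = h v ((1/2) *\<^sub>R A (A' w))"
      unfolding scaleR_compat[symmetric] h_simps sigma_hom(5)[OF F_closed(8)] A'(2) A'adj ..
    then show ?thesis unfolding Q by (simp add: h_diff_left h_diff_right A'(2))
  qed
  have QR: "Q v \<in> R" for v
  proof -
    have "(1/2) *\<^sub>R A (A' v) \<in> R" using AR subspace_scale[OF esub_subspace[OF R]] by blast
    then show ?thesis unfolding Q using AR esub_diff[OF R] by blast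
  qed
  have Qid: "Q v = v" if "v \<in> R" for v unfolding Q using that Aid A'R by (simp add: blinfun.zero_right)
  have Q'R: "Q' v = - ((1/2) *\<^sub>R A 0)" if "v \<in> R" for v unfolding Q using A'R[OF that] by simp
  have Q'Q: "Q' (Q v) = 0" for v using Q'R[OF QR] by (simp add: blinfun.zero_right)
  have hh: "x - (1/2) *\<^sub>R x = (1/2) *\<^sub>R (x::'v)" for x
    by (metis add_diff_cancel field_sum_of_halves scaleR_add_left scaleR_one)
  have QQ': "Q (Q' v) = 0" for v
    unfolding Q by (simp add: blinfun.diff_right blinfun.scaleR_right blinfun.zero_right A'A' Aid[OF AR] A'R[OF AR] hh)
  have Q'Q': "Q' (Q' v) = Q' v" for v
  proof -
    have "Q' (Q' v) = Q' (A' v) - (1/2) *\<^sub>R Q' (A (A' v))"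
      by (subst (2) Q(2)) (simp add: blinfun.diff_right blinfun.scaleR_right)
    also have "Q' (A (A' v)) = 0" using Q'R[OF AR] by (simp add: blinfun.zero_right)
    also have "Q' (A' v) = Q' v" unfolding Q A'A' ..
    finally show ?thesis by simp
  qed
  have "Q e = 0" "Q' e = 0" unfolding Q Ae A'e by (simp_all add: blinfun.zero_right)
  then show ?thesis using el adj QR Qid Q'Q' QQ' Q'Q by blast
qed

section \<open>Degeneration along a one-parameter subgroup\<close>

lemma dual_linear_curve:
  assumes "dual_linear F \<iota> sm h L"
  shows "L (Phi (T0 + s *\<^sub>R T1 + (s * s) *\<^sub>R T2)) = L (Phi T0) + s * L (Phi T1) + (s * s) * L (Phi T2)"
proof -
  have add: "L (Phi (S + T)) = L (Phi S) + L (Phi T)" for S T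
    using assms Phi_lie_dual unfolding dual_linear_def Phi_add by blast
  have scale: "L (Phi (r *\<^sub>R T)) = of_real r * L (Phi T)" for r T
  proof -
    have "dual_scale \<iota> sm (of_real r) (Phi T) = Phi (r *\<^sub>R T)"
    proof
      fix X :: "'v \<Rightarrow>\<^sub>L 'v"
      have "bounded_linear (\<lambda>v. r *\<^sub>R blinfun_apply X v)"
        by (intro bounded_linear_const_scaleR blinfun.bounded_linear_right)
      then have "Blinfun (\<lambda>v. r *\<^sub>R blinfun_apply X v) = r *\<^sub>R X"
        by (intro blinfun_eqI) (simp add: bounded_linear_Blinfun_apply blinfun.scaleR_left)
      then have 1: "dual_scale \<iota> sm (of_real r) (Phi T) X = Phi T (r *\<^sub>R X)"
        unfolding dual_scale_def scaleR_compat by simp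
      show "dual_scale \<iota> sm (of_real r) (Phi T) X = Phi (r *\<^sub>R T) X"
      proof (cases "X \<in> LA")
        case True
        then show ?thesis unfolding 1 Phi_scaleR using lie_dual_scaleR[OF Phi_lie_dual] by blast
      next
        case False
        have "Phi T (r *\<^sub>R X) = 0"
        proof (cases "r = 0")
          case True
          then show ?thesis using lie_dual_scaleR[OF Phi_lie_dual LA_closed(3), of T 0] by simp
        next
          case r: False
          have "r *\<^sub>R X \<notin> LA" using False LA_closed(2)[of "r *\<^sub>R X" "1 / r"] r by auto
          then show ?thesis unfolding Phi_def by simp
        qed
        then show ?thesis unfolding 1 Phi_scaleR using False by (simp add: Phi_def)
      qed
    qed
    moreover have "L (dual_scale \<iota> sm (of_real r) (Phi T)) = of_real r * L (Phi T)"
      using assms Phi_lie_dual F_closed(8) unfolding dual_linear_def by blast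
    ultimately show ?thesis by simp
  qed
  show ?thesis by (simp add: add scale)
qed

text \<open>Zariski closedness is exploited through real limits: a polynomial that vanishes along
  the curve for nonzero \<open>s\<close> also vanishes at \<open>s = 0\<close>.\<close>

lemma polynomial_curve_continuous:
  assumes "P \<in> dual_polynomials F \<iota> sm h"
  shows "continuous_on UNIV (\<lambda>s::real. P (Phi (T0 + s *\<^sub>R T1 + (s * s) *\<^sub>R T2)))"
  using assms
proof induction
  case (linear L)
  show ?case unfolding dual_linear_curve[OF linear] by (intro continuous_intros)
qed (intro continuous_intros; assumption)+

text \<open>\<open>l s\<close> scales \<open>R\<close> by \<open>s\<close>, the range of
  \<open>Q'\<close> by \<open>1/s\<close>, and fixes the rest. Because \<open>T\<close> preserves
  \<open>R\<close> and is skew, it is block triangular for this grading, so conjugation by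
  \<open>l s\<close> creates no negative powers of \<open>s\<close>. The value \<open>T0\<close> at
  \<open>s = 0\<close> commutes with every \<open>l s\<close> and lies in the closed orbit, hence is
  conjugate to \<open>T\<close> under \<open>H\<close>.\<close>

lemma infinite_stabilizer_isotropic:
  assumes T: "T \<in> LA" and zc: "zariski_closed F \<iota> sm h (H_orbit sm h e (Phi T))"
    and R: "esub R" and TR: "\<And>x. x \<in> R \<Longrightarrow> T x \<in> R" and RVH: "R \<subseteq> VH"
    and iso: "\<And>x y. x \<in> R \<Longrightarrow> y \<in> R \<Longrightarrow> h x y = 0" and ne: "u \<in> R" "u \<noteq> 0"
  shows "infinite (H_stabilizer sm h e (Phi T))"
proof -
  obtain Q Q' where el: "elin Q" "elin Q'" and adj: "\<And>v w. h (Q v) w = h v (Q' w)"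
    and QR: "\<And>v. Q v \<in> R" and Qid: "\<And>v. v \<in> R \<Longrightarrow> Q v = v" and Q'Q': "\<And>v. Q' (Q' v) = Q' v"
    and QQ': "\<And>v. Q (Q' v) = 0" and Q'Q: "\<And>v. Q' (Q v) = 0" and Qe: "Q e = 0" "Q' e = 0"
    using ex_isotropic_projection[OF R RVH iso] by auto
  have adj': "h (Q' v) w = h v (Q w)" for v w using adj[of w v] by (metis h_sigma)
  have QQ: "Q (Q v) = Q v" for v using Qid QR by blast
  define l where "l s = id_blinfun + (s - 1) *\<^sub>R Q + (1/s - 1) *\<^sub>R Q'" for s :: real
  have l: "l s v = v + (s - 1) *\<^sub>R Q v + (1/s - 1) *\<^sub>R Q' v" for s v
    unfolding l_def by (simp add: blinfun.add_left blinfun.scaleR_left)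
  have ll: "l r (l s v) = l (r * s) v" if "r \<noteq> 0" "s \<noteq> 0" for r s v
  proof -
    have "l r (l s v) = v + ((s - 1) + (r - 1) + (r - 1) * (s - 1)) *\<^sub>R Q v
        + ((1/s - 1) + (1/r - 1) + (1/r - 1) * (1/s - 1)) *\<^sub>R Q' v"
      unfolding l by (simp add: blinfun.add_right blinfun.scaleR_right QQ Q'Q' QQ' Q'Q) (simp add: algebra_simps)
    also have "(s - 1) + (r - 1) + (r - 1) * (s - 1) = r * s - 1" by (simp add: algebra_simps)
    also have "(1/s - 1) + (1/r - 1) + (1/r - 1) * (1/s - 1) = 1 / (r * s) - 1" using that by (simp add: field_simps)
    finally show ?thesis unfolding l .
  qed
  have l1: "l 1 v = v" for v unfolding l by simp
  have l_el: "elin (l s)" for s unfolding elin_def by (simp add: l elinD[OF el(1)] elinD[OF el(2)] sm_simps sm_scaleR)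
  have l_adj: "h (l s v) w = h v (l (1/s) w)" for s v w
    unfolding l h_add_left h_add_right h_scaleR adj adj' by (simp only: divide_divide_eq_right mult_1 div_by_1 add_ac)
  have lGU: "l s \<in> GU" if "s \<noteq> 0" for s
    unfolding GU_def using l_el l_adj ll[of "1/s" s] that by (simp add: l1)
  have gil: "gi (l s) = l (1/s)" if "s \<noteq> 0" for s
    by (rule gi_unique) (use that lGU[of s] lGU[of "1/s"] ll[of "1/s" s] in \<open>auto intro!: blinfun_eqI simp: l1\<close>)
  have le: "l s e = e" for s unfolding l Qe by simp
  have TQ: "Q (T (Q v)) = T (Q v)" for v using Qid TR QR by blast
  have Q'TQ: "Q' (T (Q v)) = 0" for v using Q'Q[of "T (Q v)"] TQ by simp
  \<comment> \<open>Adjoint form of the invariance of \<open>R\<close>: the kernel of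
    \<open>Q'\<close>, which contains \<open>R\<close> and the middle summand, is also stable under
    \<open>T\<close>.\<close>
  have Q'T: "Q' (T v) = Q' (T (Q' v))" for v
    by (rule nondeg_eqI) (simp add: adj' LA_skew[OF T] TQ)
  \<comment> \<open>Projection onto the middle summand of the grading, on which \<open>l s\<close>
    acts trivially.\<close>
  define M where "M = id_blinfun - Q - Q'"
  have M: "M v = v - Q v - Q' v" for v unfolding M_def by (simp add: blinfun.diff_left)
  have Q'TM: "Q' (T (M v)) = 0" for v
    using Q'T[of "M v"] by (simp add: M blinfun.diff_right Q'Q' Q'Q blinfun.zero_right)
  define T0 where "T0 = (T o\<^sub>L M) - (Q o\<^sub>L T o\<^sub>L M) + (T o\<^sub>L Q) + (Q' o\<^sub>L T o\<^sub>L Q')"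
  define T1 where "T1 = (Q o\<^sub>L T o\<^sub>L M) + (T o\<^sub>L Q') - (Q o\<^sub>L T o\<^sub>L Q') - (Q' o\<^sub>L T o\<^sub>L Q')"
  define T2 where "T2 = Q o\<^sub>L T o\<^sub>L Q'"
  define L where "L s = l s o\<^sub>L T o\<^sub>L gi (l s)" for s
  have L: "L s = T0 + s *\<^sub>R T1 + (s * s) *\<^sub>R T2" if s: "s \<noteq> 0" for s
  proof (rule blinfun_eqI)
    fix v
    define a b c where d: "a = M v" "b = Q v" "c = Q' v"
    have "l (1/s) v = a + (1/s) *\<^sub>R b + s *\<^sub>R c"
      unfolding l d M using s by (simp add: algebra_simps)
    then have "L s v = l s (T a) + (1/s) *\<^sub>R l s (T b) + s *\<^sub>R l s (T c)"
      unfolding L_def gil[OF s] by (simp add: blinfun.add_right blinfun.scaleR_right)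
    also have "l s (T a) = T a + (s - 1) *\<^sub>R Q (T a)" unfolding l d Q'TM by simp
    also have "l s (T b) = s *\<^sub>R T b" unfolding l d Q'TQ TQ by (simp add: algebra_simps)
    also have "(1/s) *\<^sub>R (s *\<^sub>R T b) = T b" using s by simp
    also have "s *\<^sub>R l s (T c) = s *\<^sub>R T c + (s * (s - 1)) *\<^sub>R Q (T c) + (1 - s) *\<^sub>R Q' (T c)"
      unfolding l using s by (simp add: scaleR_add_right right_diff_distrib)
    finally have eq: "L s v = T a + (s - 1) *\<^sub>R Q (T a) + T b +
        (s *\<^sub>R T c + (s * (s - 1)) *\<^sub>R Q (T c) + (1 - s) *\<^sub>R Q' (T c))" .
    show "L s v = (T0 + s *\<^sub>R T1 + (s * s) *\<^sub>R T2) v"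
      unfolding eq T0_def T1_def T2_def d
      by (simp add: blinfun.add_left blinfun.diff_left blinfun.scaleR_left algebra_simps)
  qed
  have L_LA: "L s \<in> LA" if "s \<noteq> 0" for s unfolding L_def by (rule LA_conj[OF lGU[OF that] T])
  \<comment> \<open>Extrapolation of a quadratic polynomial to 0 from its values at
    \<open>r\<close>, \<open>2 r\<close>, \<open>3 r\<close>, with weights 3, -3, 1. It shows
    without limits that \<open>T0\<close> is skew, and that conjugation by \<open>l r\<close>, which
    only rescales the nodes, fixes it.\<close>
  have lagrange: "T0 = 3 *\<^sub>R L r - 3 *\<^sub>R L (2 * r) + L (3 * r)" if "r \<noteq> 0" for r
  proof -
    have r: "2 * r \<noteq> 0" "3 * r \<noteq> 0" using that by auto
    have "3 *\<^sub>R L r - 3 *\<^sub>R L (2 * r) + L (3 * r) = (3 - 3 + 1::real) *\<^sub>R T0 + (3 * r - 3 * (2 * r) + 3 * r) *\<^sub>R T1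
        + (3 * (r * r) - 3 * (2 * r * (2 * r)) + 3 * r * (3 * r)) *\<^sub>R T2"
      unfolding L[OF that] L[OF r(1)] L[OF r(2)]
      by (simp only: scaleR_add_right scaleR_scaleR scaleR_minus_left scaleR_add_left scaleR_one
          diff_conv_add_uminus minus_add_distrib add_ac)
    also have "3 * (r * r) - 3 * (2 * r * (2 * r)) + 3 * r * (3 * r) = 0" by (simp add: algebra_simps)
    finally show ?thesis by simp
  qed
  have T0: "T0 \<in> LA"
    by (subst lagrange[of 1]) (auto intro!: LA_closed LA_diff L_LA)
  have lT0: "l r o\<^sub>L T0 o\<^sub>L gi (l r) = T0" if r: "r \<noteq> 0" for r
  proof -
    have lL: "l r (L s (l (1/r) v)) = L (r * s) v" if "s \<noteq> 0" for s v
      using r that ll by (simp add: L_def gil mult.commute)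
    show ?thesis
    proof (rule blinfun_eqI)
      fix v
      have "(l r o\<^sub>L T0 o\<^sub>L gi (l r)) v = 3 *\<^sub>R L (r * 1) v - 3 *\<^sub>R L (r * 2) v + L (r * 3) v"
        by (subst lagrange[of 1])
          (simp_all add: gil[OF r] blinfun.add_left blinfun.add_right blinfun.diff_left blinfun.diff_right
            blinfun.scaleR_left blinfun.scaleR_right lL)
      also have "\<dots> = T0 v" by (subst lagrange[OF r])
          (simp add: blinfun.add_left blinfun.diff_left blinfun.scaleR_left mult.commute)
      finally show "(l r o\<^sub>L T0 o\<^sub>L gi (l r)) v = T0 v" .
    qed
  qed
  obtain PP where PP: "PP \<subseteq> dual_polynomials F \<iota> sm h"
    "H_orbit sm h e (Phi T) = {\<xi> \<in> lie_dual sm h. \<forall>P\<in>PP. P \<xi> = 0}"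
    using zc unfolding zariski_closed_def by blast
  have inorb: "Phi (L s) \<in> H_orbit sm h e (Phi T)" if "s \<noteq> 0" for s
    unfolding H_orbit_def carrier_H L_def coad_Phi[OF lGU[OF that] T, symmetric] using lGU[OF that] le by blast
  have "P (Phi T0) = 0" if P: "P \<in> PP" for P
  proof -
    let ?f = "\<lambda>s::real. P (Phi (T0 + s *\<^sub>R T1 + (s * s) *\<^sub>R T2))"
    have "continuous_on UNIV ?f" using polynomial_curve_continuous P PP(1) by blast
    then have "?f \<midarrow>0\<rightarrow> ?f 0" unfolding continuous_on_def by blast
    moreover have "?f \<midarrow>0\<rightarrow> 0"
    proof (rule Lim_transform_eventually[OF tendsto_const])
      have "?f s = 0" if "s \<noteq> 0" for s using inorb[OF that] PP(2) P L[OF that] by auto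
      then show "\<forall>\<^sub>F s in at 0. 0 = ?f s" by (simp add: eventually_at_filter)
    qed
    ultimately have "?f 0 = 0" using LIM_unique by blast
    then show ?thesis by simp
  qed
  then have "Phi T0 \<in> H_orbit sm h e (Phi T)" unfolding PP(2) using Phi_lie_dual by blast
  then obtain k where k: "k \<in> GU" "k e = e" "Phi T0 = coad sm h k (Phi T)"
    unfolding H_orbit_def carrier_H by auto
  have kT: "T0 = k o\<^sub>L T o\<^sub>L gi k"
    using k(3) Phi_inj[OF T0 LA_conj[OF k(1) T]] coad_Phi[OF k(1) T] by simp
  have gke: "gi k e = e" using k(1,2) gi_left by metis
  \<comment> \<open>Transport of the subgroup \<open>l s\<close>, which centralises
    \<open>T0\<close>, back to the centraliser of \<open>T\<close> by the element \<open>k\<close>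
    of \<open>H\<close> that conjugates \<open>T\<close> to \<open>T0\<close>.\<close>
  define c where "c s = gi k o\<^sub>L l s o\<^sub>L k" for s
  have cGU: "c s \<in> GU" if "s \<noteq> 0" for s unfolding c_def using GU_compose gi_GU k(1) lGU that by blast
  have stab: "c s \<in> H_stabilizer sm h e (Phi T)" if s: "s \<noteq> 0" for s
  proof -
    have "c s o\<^sub>L T o\<^sub>L gi (c s) = T"
    proof (rule blinfun_eqI)
      fix v
      have comm: "l s (T0 w) = T0 (l s w)" for w
        using arg_cong[OF lT0[OF s], of "\<lambda>X. blinfun_apply X (l s w)"] by (simp add: gi_left[OF lGU[OF s]])
      have T0k: "T0 (k w) = k (T w)" for w unfolding kT by (simp add: gi_left[OF k(1)])
      have "c s (T w) = T (c s w)" for w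
      proof -
        have "c s (T w) = gi k (T0 (l s (k w)))" unfolding c_def by (simp add: T0k[symmetric] comm)
        also have "\<dots> = gi k (T0 (k (gi k (l s (k w)))))" by (simp add: gi_right[OF k(1)])
        also have "\<dots> = T (c s w)" unfolding T0k c_def by (simp add: gi_left[OF k(1)])
        finally show ?thesis .
      qed
      then show "(c s o\<^sub>L T o\<^sub>L gi (c s)) v = T v" by (simp add: gi_right[OF cGU[OF s]])
    qed
    moreover have "c s e = e" unfolding c_def by (simp add: k(2) le gke)
    ultimately show ?thesis
      unfolding H_stabilizer_def carrier_H using cGU[OF s] coad_Phi[OF cGU[OF s] T] by simp
  qed
  have inj: "inj_on c {0<..<1}"
  proof (rule inj_onI)
    fix x y :: real assume x: "x \<in> {0<..<1}" and y: "y \<in> {0<..<1}" and eq: "c x = c y"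
    have "l s u = k (c s (gi k u))" for s unfolding c_def by (simp add: gi_right[OF k(1)])
    then have "l x u = l y u" using eq by simp
    moreover have "Q' u = 0" using Q'Q[of u] Qid[OF ne(1)] by simp
    ultimately have "(x - y) *\<^sub>R u = 0" unfolding l Qid[OF ne(1)] by (simp add: algebra_simps)
    then show "x = y" using ne(2) by simp
  qed
  have "c ` {0<..<1} \<subseteq> H_stabilizer sm h e (Phi T)" using stab by auto
  moreover have "infinite (c ` {0<..<1::real})"
    using finite_image_iff[OF inj] infinite_Ioo[of 0 "1::real"] by simp
  ultimately show ?thesis using finite_subset by blast
qed

lemma stable_imp_cyclic:
  assumes T: "T \<in> LA" and st: "Phi T \<in> lie_dual_stab F \<iota> sm h e"
    and u: "\<And>i. h ((blinfun_apply T ^^ i) e) u = 0"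
  shows "u = 0"
proof (rule ccontr)
  assume u0: "u \<noteq> 0"
  define S where "S = {x. \<forall>i. h ((blinfun_apply T ^^ i) e) x = 0}"
  define R where "R = S \<inter> {v. \<forall>x\<in>S. h v x = 0}"
  have S: "esub S" unfolding S_def esub_def by (simp add: h_simps)
  have TS: "T x \<in> S" if "x \<in> S" for x
    unfolding S_def
  proof clarify
    fix i
    have "h ((blinfun_apply T ^^ Suc i) e) x = 0" using that unfolding S_def by blast
    then show "h ((blinfun_apply T ^^ i) e) (T x) = 0" by (simp add: LA_skew[OF T])
  qed
  have SVH: "S \<subseteq> VH"
  proof
    fix x assume "x \<in> S"
    then have "h ((blinfun_apply T ^^ 0) e) x = 0" unfolding S_def by blast
    then show "x \<in> VH" unfolding VH_def using h_sigma[of e x] sigma_0 by simp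
  qed
  have uS: "u \<in> S" unfolding S_def using u by simp
  have fin: "finite (H_stabilizer sm h e (Phi T))" "zariski_closed F \<iota> sm h (H_orbit sm h e (Phi T))"
    using st unfolding lie_dual_stab_def by auto
  show False
  proof (cases "\<exists>x\<in>R. x \<noteq> 0")
    case True
    then obtain x where x: "x \<in> R" "x \<noteq> 0" by blast
    have "esub R" using S esub_orth[of S] unfolding R_def esub_def by blast
    moreover have "T y \<in> R" if "y \<in> R" for y
    proof -
      have "h (T y) z = 0" if "z \<in> S" for z
        using \<open>y \<in> R\<close> TS[OF that] unfolding R_def by (simp add: LA_skew[OF T])
      then show ?thesis using that TS unfolding R_def by blast
    qed
    moreover have "R \<subseteq> VH" using SVH unfolding R_def by blast
    moreover have "h y z = 0" if "y \<in> R" "z \<in> R" for y z using that unfolding R_def by blast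
    ultimately show False using infinite_stabilizer_isotropic[OF T fin(2) _ _ _ _ x] fin(1) by blast
  next
    case False
    then have "x = 0" if "x \<in> S" "\<forall>y\<in>S. h x y = 0" for x using that unfolding R_def by blast
    then show False using infinite_stabilizer_scalars[OF T S TS SVH _ uS u0] fin(1) by blast
  qed
qed

section \<open>The centers of the unitary groups\<close>

text \<open>With \<open>y\<close> the inverse of \<open>h v v\<close>, this is the unitary
  reflection that negates \<open>v\<close> and fixes its orthogonal complement; the repeated summand
  is the factor 2.\<close>

definition reflection :: "'v \<Rightarrow> 'e \<Rightarrow> ('v \<Rightarrow>\<^sub>L 'v)" where
  "reflection v y = Blinfun (\<lambda>x. x - (sm (h x v * y) v + sm (h x v * y) v))"

lemma reflection_apply: "reflection v y x = x - (sm (h x v * y) v + sm (h x v * y) v)"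
  and reflection_elin: "elin (reflection v y)"
  unfolding reflection_def using Blinfun_E_linear[of "\<lambda>x. x - (sm (h x v * y) v + sm (h x v * y) v)"]
  by (simp_all add: h_simps sm_simps algebra_simps)

lemma sigma_inverse_h_self:
  assumes "h v v * y = 1"
  shows "\<sigma> y = y"
proof -
  have "h v v * \<sigma> y = 1" using arg_cong[OF assms, of \<sigma>] by (simp add: sigma_hom h_sigma)
  then have "\<sigma> y = (h v v * y) * \<sigma> y" "y = (h v v * \<sigma> y) * y" using assms by auto
  then show ?thesis by (metis mult.assoc mult.commute)
qed

lemma reflection_GU:
  assumes "h v v * y = 1"
  shows "reflection v y \<in> GU"
proof -
  note sy = sigma_inverse_h_self[OF assms]
  have "h (reflection v y x) (reflection v y z) = h x z" for x z
  proof -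
    define c d where cd: "c = h x v * y" "d = h z v * y"
    define q where "q = h x v * y * h v z"
    have sd: "\<sigma> d = h v z * y" unfolding cd by (simp add: sigma_hom h_sigma sy)
    have q: "c * h v z = q" "\<sigma> d * h x v = q" unfolding sd unfolding cd q_def by (simp_all add: mult_ac)
    have "c * (\<sigma> d * h v v) = q * (h v v * y)" unfolding sd unfolding cd q_def by (simp add: mult_ac)
    then have q': "c * (\<sigma> d * h v v) = q" unfolding assms by simp
    have "h (reflection v y x) (reflection v y z) = h x z - (c * h v z + c * h v z) - (\<sigma> d * h x v + \<sigma> d * h x v)
        + (c * (\<sigma> d * h v v) + c * (\<sigma> d * h v v) + (c * (\<sigma> d * h v v) + c * (\<sigma> d * h v v)))"
      unfolding reflection_apply cd[symmetric]
      by (simp only: h_diff_left h_diff_right h_add_left h_add_right h_sm_left h_sm_right) (simp add: algebra_simps)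
    then show ?thesis unfolding q q' by simp
  qed
  then show ?thesis unfolding GU_def using reflection_elin by simp
qed

text \<open>An operator that commutes with the reflection preserves its \<open>-1\<close>
  eigenspace, which is \<open>Ev\<close>.\<close>

lemma eigenvector_of_commuting_reflection:
  fixes z :: "'v \<Rightarrow>\<^sub>L 'v"
  assumes y: "h v v * y = 1" and c: "z (reflection v y v) = reflection v y (z v)"
  shows "z v = sm (h (z v) v * y) v"
proof -
  have "reflection v y v = - v" using y by (simp add: reflection_apply sm_simps)
  then have c': "- z v = z v - (sm (h (z v) v * y) v + sm (h (z v) v * y) v)"
    using c unfolding reflection_apply[of v y "z v"] by (simp add: blinfun.minus_right)
  have "z v + (z v - (sm (h (z v) v * y) v + sm (h (z v) v * y) v)) = 0" unfolding c'[symmetric] by simp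
  then have "z v + z v = sm (h (z v) v * y) v + sm (h (z v) v * y) v" by (simp add: algebra_simps)
  then have "2 *\<^sub>R z v = 2 *\<^sub>R sm (h (z v) v * y) v" by (simp add: scaleR_2)
  then show ?thesis by simp
qed

text \<open>Every anisotropic vector of \<open>X\<close> is an eigenvector of \<open>z\<close>. A
  vector \<open>w\<close> orthogonal to \<open>v1\<close> may be isotropic, but
  \<open>w + a v1\<close> is anisotropic for a suitable real \<open>a\<close>, and pairing with
  \<open>v1\<close> shows that its eigenvalue is the one of \<open>v1\<close>.\<close>

lemma scalar_of_commuting_reflections:
  assumes z: "z \<in> GU" and X: "esub X" and v1: "v1 \<in> X" and y1: "h v1 v1 * y1 = 1"
    and comm: "\<And>v y x. v \<in> X \<Longrightarrow> h v v * y = 1 \<Longrightarrow> z (reflection v y x) = reflection v y (z x)"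
  shows "(h (z v1) v1 * y1) * \<sigma> (h (z v1) v1 * y1) = 1 \<and> (\<forall>x\<in>X. z x = sm (h (z v1) v1 * y1) x)"
proof -
  define t where "t = h (z v1) v1 * y1"
  have zv1: "z v1 = sm t v1" unfolding t_def by (rule eigenvector_of_commuting_reflection[OF y1 comm[OF v1 y1]])
  have "t * \<sigma> t * h v1 v1 = h v1 v1" using GU_h[OF z, of v1 v1] unfolding zv1 by (simp add: h_simps mult_ac)
  then have "t * \<sigma> t * (h v1 v1 * y1) = h v1 v1 * y1" by (simp add: mult.assoc[symmetric])
  then have tt: "t * \<sigma> t = 1" unfolding y1 by simp
  have perp: "z w = sm t w" if w: "w \<in> X" "h w v1 = 0" for w
  proof -
    have w': "h v1 w = 0" using w(2) h_sigma[of w v1] sigma_0 by simp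
    have eq: "p (h (w + a *\<^sub>R v1) (w + a *\<^sub>R v1)) = p (h w w) + of_real (a * a) * p (h v1 v1)" for a :: real
      by (simp add: h_add_left h_add_right h_scaleR w(2) w' p_add p_mult p_real)
    have p1: "p (h v1 v1) \<noteq> 0" using y1 p_1 p_mult by (metis mult_zero_left zero_neq_one)
    \<comment> \<open>By orthogonality the value is \<open>p (h w w) + a^2 p (h v1 v1)\<close>; with
      nonzero second coefficient it cannot vanish at both \<open>a = 1\<close> and
      \<open>a = 2\<close>.\<close>
    have "\<exists>a::real. a \<noteq> 0 \<and> p (h (w + a *\<^sub>R v1) (w + a *\<^sub>R v1)) \<noteq> 0"
    proof (rule ccontr)
      assume "\<not> ?thesis"
      then have "a \<noteq> 0 \<Longrightarrow> p (h w w) + of_real (a * a) * p (h v1 v1) = 0" for a :: real unfolding eq by blast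
      from this[of 1] this[of 2]
      have "p (h w w) + of_real (1 * 1) * p (h v1 v1) = 0" "p (h w w) + of_real (2 * 2) * p (h v1 v1) = 0" by simp_all
      then have "(p (h w w) + of_real (2 * 2) * p (h v1 v1)) - (p (h w w) + of_real (1 * 1) * p (h v1 v1)) = 0" by simp
      then have "3 * p (h v1 v1) = 0" by (simp add: algebra_simps)
      then show False using p1 by simp
    qed
    then obtain a where a: "a \<noteq> 0" "p (h (w + a *\<^sub>R v1) (w + a *\<^sub>R v1)) \<noteq> 0" by blast
    define x where "x = w + a *\<^sub>R v1"
    have xX: "x \<in> X" unfolding x_def using X w(1) v1 unfolding esub_def by (metis scaleR_compat)
    have "h x x \<noteq> 0" using a(2) p_0 unfolding x_def by auto
    then obtain y where y: "h x x * y = 1" using h_self_unit by blast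
    define \<mu> where "\<mu> = h (z x) x * y"
    have zx: "z x = sm \<mu> x" unfolding \<mu>_def by (rule eigenvector_of_commuting_reflection[OF y comm[OF xX y]])
    have zx2: "z x = z w + a *\<^sub>R sm t v1" unfolding x_def by (simp add: blinfun.add_right blinfun.scaleR_right zv1)
    have "\<sigma> t * h (z w) v1 = 0" using GU_h[OF z, of w v1] w(2) unfolding zv1 by (simp add: h_simps)
    then have hz: "h (z w) v1 = 0" using tt by (metis mult.assoc mult_1 mult_zero_right)
    have "h (z x) v1 = \<iota> (of_real a) * (t * h v1 v1)" unfolding zx2 h_add_left hz h_scaleR h_sm_left by simp
    moreover have "h (z x) v1 = \<mu> * (\<iota> (of_real a) * h v1 v1)" unfolding zx h_sm_left unfolding x_def h_add_left w(2) h_scaleR by simp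
    ultimately have "\<iota> (of_real a) * ((t - \<mu>) * h v1 v1) = 0" by (simp add: algebra_simps)
    then have "(t - \<mu>) * h v1 v1 = 0" using iota_cancel[OF F_closed(8), of a] a(1) by simp
    then have "(t - \<mu>) * (h v1 v1 * y1) = 0" by (simp add: mult.assoc[symmetric])
    then have "t = \<mu>" unfolding y1 by simp
    then have "z w + a *\<^sub>R sm t v1 = sm t w + a *\<^sub>R sm t v1" using zx zx2 unfolding x_def by (simp add: sm_simps sm_scaleR)
    then show ?thesis by simp
  qed
  have "z x = sm t x" if x: "x \<in> X" for x
  proof -
    define w where "w = x - sm (h x v1 * y1) v1"
    have "w \<in> X" unfolding w_def using esub_diff[OF X x] X v1 unfolding esub_def by blast
    moreover have "h w v1 = 0"
    proof -
      have "h w v1 = h x v1 - h x v1 * (h v1 v1 * y1)" unfolding w_def h_diff_left h_sm_left by (simp add: algebra_simps)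
      then show ?thesis unfolding y1 by simp
    qed
    ultimately have zw: "z w = sm t w" by (rule perp)
    have "z x = z w + sm (h x v1 * y1) (z v1)"
      unfolding w_def by (simp add: blinfun.diff_right elinD[OF GU_elin[OF z]])
    also have "\<dots> = sm t x" unfolding zw zv1 unfolding w_def by (simp add: sm_simps mult.commute)
    finally show ?thesis .
  qed
  then show ?thesis unfolding t_def[symmetric] using tt by blast
qed

lemma esub_UNIV: "esub UNIV" and esub_VH: "esub VH"
  unfolding esub_def VH_def by (auto simp: h_simps)

lemma center_G_scalar:
  assumes "z \<in> group_center (grp_G sm h)"
  shows "z \<in> GU" "\<exists>t. t * \<sigma> t = 1 \<and> (\<forall>x. z x = sm t x)"
proof -
  show z: "z \<in> GU" using assms unfolding group_center_def carrier_G by blast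
  have "z (reflection v y x) = reflection v y (z x)" if "h v v * y = 1" for v y x
  proof -
    have "z o\<^sub>L reflection v y = reflection v y o\<^sub>L z"
      using assms reflection_GU[OF that] unfolding group_center_def carrier_G mult_G by blast
    then show ?thesis by (metis blinfun_apply_blinfun_compose)
  qed
  then show "\<exists>t. t * \<sigma> t = 1 \<and> (\<forall>x. z x = sm t x)"
    using scalar_of_commuting_reflections[OF z esub_UNIV UNIV_I h_ee_ei] by blast
qed

section \<open>The center of \<open>H\<close> as norm-one scalars on \<open>VH\<close>\<close>

abbreviation ZH :: "('v \<Rightarrow>\<^sub>L 'v) set" where "ZH \<equiv> group_center (grp_H sm h e)"

lemma ZH_GU: "z \<in> ZH \<Longrightarrow> z \<in> GU" "z \<in> ZH \<Longrightarrow> z e = e"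
  unfolding group_center_def carrier_H by auto

lemma ZH_scalar:
  assumes z: "z \<in> ZH" and v1: "v1 \<in> VH" "h v1 v1 * y1 = 1"
  shows "(h (z v1) v1 * y1) * \<sigma> (h (z v1) v1 * y1) = 1 \<and> (\<forall>x\<in>VH. z x = sm (h (z v1) v1 * y1) x)"
proof (rule scalar_of_commuting_reflections[OF ZH_GU(1)[OF z] esub_VH v1])
  fix v y x assume v: "v \<in> VH" "h v v * y = 1"
  have "reflection v y e = e" using VH_h_right[OF v(1)] by (simp add: reflection_apply sm_simps)
  then have "z o\<^sub>L reflection v y = reflection v y o\<^sub>L z"
    using z reflection_GU[OF v(2)] unfolding group_center_def carrier_H mult_G by blast
  then show "z (reflection v y x) = reflection v y (z x)" by (metis blinfun_apply_blinfun_compose)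
qed

definition zt :: "'e \<Rightarrow> ('v \<Rightarrow>\<^sub>L 'v)" where
  "zt t = Blinfun (\<lambda>v. v + sm (t - 1) (projH v))"

lemma projH_add: "projH (u + v) = projH u + projH v" and projH_sm: "projH (sm a v) = sm a (projH v)"
  unfolding projH_def coef_def by (simp_all add: h_simps sm_simps algebra_simps)

lemma projH_e: "projH e = 0"
  unfolding projH_def coef_def using h_ee_ei by (simp add: sm_simps)

lemma zt_apply: "zt t v = v + sm (t - 1) (projH v)" and zt_elin: "elin (zt t)"
  unfolding zt_def using Blinfun_E_linear[of "\<lambda>v. v + sm (t - 1) (projH v)"]
  by (simp_all add: projH_add projH_sm sm_simps algebra_simps)

lemma zt_GU:
  assumes "t * \<sigma> t = 1"
  shows "zt t \<in> GU"
proof -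
  have "h (zt t v) (zt t w) = h v w" for v w
  proof -
    have z: "zt t v = sm (coef v) e + sm t (projH v)" for v
      unfolding zt_apply by (subst projH_decomp[of v]) (simp add: sm_simps projH_add projH_sm projH_e projH_id[OF projH_VH])
    have "h (zt t v) (zt t w) = h (sm (coef v) e) (sm (coef w) e) + (t * \<sigma> t) * h (projH v) (projH w)"
      unfolding z by (simp add: h_simps VH_h_right[OF projH_VH] VH_h_left[OF projH_VH] algebra_simps)
    also have "\<dots> = h (sm (coef v) e + projH v) (sm (coef w) e + projH w)"
      unfolding assms by (simp add: h_simps VH_h_right[OF projH_VH] VH_h_left[OF projH_VH] algebra_simps)
    finally show ?thesis using projH_decomp[of v] projH_decomp[of w] by simp
  qed
  then show ?thesis unfolding GU_def using zt_elin by simp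
qed

lemma projH_commute:
  assumes "k \<in> GU" "k e = e"
  shows "projH (k v) = k (projH v)"
proof -
  have "h (k v) e = h v e" using GU_h[OF assms(1), of v e] assms(2) by simp
  then show ?thesis unfolding projH_def coef_def
    by (simp add: blinfun.diff_right elinD[OF GU_elin[OF assms(1)]] assms(2))
qed

lemma zt_ZH:
  assumes "t * \<sigma> t = 1"
  shows "zt t \<in> ZH"
  unfolding group_center_def carrier_H mult_G
  using zt_GU[OF assms]
  by (auto simp: zt_apply projH_e sm_simps projH_commute blinfun.add_right blinfun.diff_right elinD[OF GU_elin] intro!: blinfun_eqI)

lemma ZH_eq_zt:
  assumes z: "z \<in> ZH" and v1: "v1 \<in> VH" "h v1 v1 * y1 = 1"
  shows "z = zt (h (z v1) v1 * y1)"
proof (rule blinfun_eqI)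
  fix v
  have "z v = z (sm (coef v) e + projH v)" using projH_decomp[of v] by simp
  also have "\<dots> = sm (coef v) e + sm (h (z v1) v1 * y1) (projH v)"
    using ZH_scalar[OF z v1] projH_VH
    by (simp add: blinfun.add_right elinD[OF GU_elin[OF ZH_GU(1)[OF z]]] ZH_GU(2)[OF z])
  also have "sm (coef v) e = v - projH v" using projH_decomp[of v] by (metis add_diff_cancel_right')
  finally show "z v = zt (h (z v1) v1 * y1) v" unfolding zt_apply by (simp add: sm_simps algebra_simps)
qed

text \<open>The type of \<open>E\<close> carries no norm, so the size of a scalar is measured by its
  two coordinates. They bound \<open>s\<close> and \<open>t\<close> in
  \<open>\<iota> s + \<iota> t * \<delta>\<close>, and multiplication by \<open>\<iota> \<i>\<close>
  and by \<open>\<delta>\<close> is bounded.\<close>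

lemma sm_bound: "\<exists>M\<ge>0. \<forall>a v. norm (sm a v) \<le> M * (cmod (p a) + cmod (p (\<sigma> a))) * norm v"
proof -
  obtain K1 where K1: "K1 > 0" "\<And>v. norm (sm (\<iota> \<i>) v) \<le> norm v * K1" using bounded_linear.pos_bounded[OF bounded_linear_sm] by blast
  obtain K2 where K2: "K2 > 0" "\<And>v. norm (sm \<delta> v) \<le> norm v * K2" using bounded_linear.pos_bounded[OF bounded_linear_sm] by blast
  define M1 where "M1 = 1 + K1"
  have b1: "norm (sm (\<iota> s) v) \<le> cmod s * M1 * norm v" if "s \<in> F" for s v
  proof (cases "F = \<real>")
    case True
    have "s \<in> \<real>" using that True by simp
    then obtain r where r: "s = of_real r" by (rule Reals_cases)
    have "norm (sm (\<iota> s) v) = cmod s * 1 * norm v" unfolding r scaleR_compat by simp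
    also have "\<dots> \<le> cmod s * M1 * norm v" unfolding M1_def using K1(1)
      by (intro mult_right_mono mult_left_mono) auto
    finally show ?thesis .
  next
    case False
    then have FU: "F = UNIV" using base_field by auto
    have "norm (sm (\<iota> s) v) \<le> norm (Re s *\<^sub>R v) + norm (Im s *\<^sub>R sm (\<iota> \<i>) v)"
      unfolding sm_iota_complex[OF FU, of s v] by (rule norm_triangle_ineq)
    also have "\<dots> \<le> cmod s * norm v + cmod s * (norm v * K1)"
      using K1(2)[of v] by (auto intro!: add_mono mult_mono abs_Re_le_cmod abs_Im_le_cmod)
    finally show ?thesis unfolding M1_def by (simp add: algebra_simps)
  qed
  have M1: "M1 \<ge> 0" unfolding M1_def using K1 by simp
  define M where "M = M1 + M1 * K2"
  have "norm (sm a v) \<le> M * (cmod (p a) + cmod (p (\<sigma> a))) * norm v" for a v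
  proof -
    obtain s t where st: "s \<in> F" "t \<in> F" "a = \<iota> s + \<iota> t * \<delta>" using decomp[of a] by blast
    define q where "q = cmod (p a) + cmod (p (\<sigma> a))"
    have pa: "p a = s + t * \<omega>" "p (\<sigma> a) = s - t * \<omega>" using p_decomp[OF st(1,2)] st(3) by auto
    have q0: "q \<ge> 0" unfolding q_def by simp
    have w1: "cmod \<omega> = 1" using omega by auto
    have "2 * s = p a + p (\<sigma> a)" unfolding pa by simp
    then have "cmod (2 * s) \<le> q" unfolding q_def by (metis norm_triangle_ineq)
    then have s: "cmod s \<le> q" using q0 by (simp add: norm_mult)
    have "2 * (t * \<omega>) = p a - p (\<sigma> a)" unfolding pa by simp
    then have "cmod (2 * (t * \<omega>)) \<le> q" unfolding q_def by (metis norm_triangle_ineq4)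
    then have t: "cmod t \<le> q" using q0 by (simp add: norm_mult w1)
    have "norm (sm a v) \<le> norm (sm (\<iota> s) v) + norm (sm (\<iota> t) (sm \<delta> v))"
      unfolding st(3) sm_add_left sm_sm[symmetric] by (rule norm_triangle_ineq)
    also have "\<dots> \<le> cmod s * M1 * norm v + cmod t * M1 * norm (sm \<delta> v)"
      using b1[OF st(1)] b1[OF st(2)] by (intro add_mono)
    also have "\<dots> \<le> q * M1 * norm v + q * M1 * (norm v * K2)"
      using s t K2 M1 q0 by (intro add_mono mult_mono) auto
    finally show ?thesis unfolding M_def q_def by (simp add: algebra_simps)
  qed
  moreover have "M \<ge> 0" unfolding M_def using M1 K2 by simp
  ultimately show ?thesis by blast
qed

lemma projH_bound: "\<exists>K\<ge>0. \<forall>v. norm (projH v) \<le> K * norm v"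
proof -
  have "linear projH"
    by (rule linearI) (auto simp: projH_add projH_sm scaleR_compat[symmetric])
  then obtain K where "K > 0" "\<And>v. norm (projH v) \<le> norm v * K"
    using bounded_linear.pos_bounded unfolding linear_conv_bounded_linear by blast
  then show ?thesis by (intro exI[of _ K]) (auto simp: mult.commute)
qed

lemma continuous_on_p_h [continuous_intros]:
  assumes "continuous_on S u" "continuous_on S v"
  shows "continuous_on S (\<lambda>x. p (h (u x) (v x)))"
  by (rule bounded_bilinear.continuous_on[OF bounded_bilinear_p_h assms])

lemma closed_ZH: "closed ZH"
proof -
  let ?H = "carrier (grp_H sm h e)"
  have eq: "ZH = (\<Inter>a. \<Inter>v. {X. blinfun_apply X (sm a v) = sm a (X v)}) \<inter>
     (\<Inter>v. \<Inter>w. {X. p (h (blinfun_apply X v) (X w)) = p (h v w)}) \<inter> {X. blinfun_apply X e = e} \<inter>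
     (\<Inter>k\<in>?H. \<Inter>v. {X. blinfun_apply X (blinfun_apply k v) = k (X v)})"
  proof (intro equalityI subsetI)
    fix X assume X: "X \<in> ZH"
    have "X (k v) = k (X v)" if "k \<in> ?H" for k v
    proof -
      have "X o\<^sub>L k = k o\<^sub>L X" using X that unfolding group_center_def mult_G by blast
      then show ?thesis by (metis blinfun_apply_blinfun_compose)
    qed
    then show "X \<in> (\<Inter>a. \<Inter>v. {X. blinfun_apply X (sm a v) = sm a (X v)}) \<inter>
     (\<Inter>v. \<Inter>w. {X. p (h (blinfun_apply X v) (X w)) = p (h v w)}) \<inter> {X. blinfun_apply X e = e} \<inter>
     (\<Inter>k\<in>?H. \<Inter>v. {X. blinfun_apply X (blinfun_apply k v) = k (X v)})"
      using ZH_GU[OF X] by (simp add: GU_h elinD[OF GU_elin])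
  next
    fix X assume X: "X \<in> (\<Inter>a. \<Inter>v. {X. blinfun_apply X (sm a v) = sm a (X v)}) \<inter>
     (\<Inter>v. \<Inter>w. {X. p (h (blinfun_apply X v) (X w)) = p (h v w)}) \<inter> {X. blinfun_apply X e = e} \<inter>
     (\<Inter>k\<in>?H. \<Inter>v. {X. blinfun_apply X (blinfun_apply k v) = k (X v)})"
    have pp: "p (h (X v) (X w)) = p (h v w)" for v w using X by simp
    have "h (X v) (X w) = h v w" for v w
      by (rule p_eqI) (simp_all add: pp h_sigma)
    then have "X \<in> GU" unfolding GU_def elin_def using X by simp
    then show "X \<in> ZH" unfolding group_center_def mult_G carrier_H using X
      by (auto simp: carrier_H intro!: blinfun_eqI)
  qed
  have c1: "closed {X. blinfun_apply X (sm a v) = sm a (blinfun_apply X v)}" for a v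
    by (intro closed_Collect_eq continuous_on_compose2[OF linear_continuous_on[OF bounded_linear_sm]] continuous_intros) auto
  have c2: "closed {X. p (h (blinfun_apply X v) (blinfun_apply X w)) = p (h v w)}" for v w
    by (intro closed_Collect_eq continuous_intros)
  have c3: "closed {X. blinfun_apply X (blinfun_apply k v) = blinfun_apply k (blinfun_apply X v)}" for k v
    by (intro closed_Collect_eq continuous_intros)
  have c4: "closed {X. blinfun_apply X e = e}" by (intro closed_Collect_eq continuous_intros)
  show ?thesis unfolding eq by (intro closed_Int closed_INT ballI c1 c2 c3 c4)
qed

end

section \<open>Haar measure of small discs in the center\<close>

text \<open>Translation parameters for the packing argument: about as many 1-separated points of
  \<open>F\<close> in a disc of radius \<open>2 m\<close> as its dimension permits, which produces
  the exponent \<open>[F:\<real>]\<close>.\<close>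

lemma ex_separated_grid:
  assumes "F \<in> {\<real>, UNIV}"
  shows "\<exists>J. finite J \<and> J \<subseteq> F \<and> card J = m ^ deg_over_real F \<and> (\<forall>j\<in>J. cmod j \<le> 2 * real m) \<and>
     (\<forall>j\<in>J. \<forall>k\<in>J. j \<noteq> k \<longrightarrow> cmod (j - k) \<ge> 1)"
proof (cases "F = \<real>")
  case True
  let ?J = "(of_nat :: nat \<Rightarrow> complex) ` {..<m}"
  have "card ?J = m" by (subst card_image) (auto intro: inj_onI)
  moreover have "cmod (of_nat j - of_nat k) \<ge> 1" if "j \<noteq> k" for j k :: nat
  proof -
    have "complex_of_nat j - of_nat k = of_int (int j - int k)" by simp
    then have "cmod (of_nat j - of_nat k) = \<bar>real_of_int (int j - int k)\<bar>" by (metis norm_of_int)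
    also have "\<dots> \<ge> 1" using that by linarith
    finally show ?thesis .
  qed
  ultimately show ?thesis using True by (intro exI[of _ ?J]) (auto simp: deg_over_real_def)
next
  case False
  then have F: "F = UNIV" using assms by auto
  have "\<i> \<notin> \<real>" by (simp add: complex_is_Real_iff)
  then have nR: "UNIV \<noteq> (\<real> :: complex set)" by blast
  let ?g = "\<lambda>(k, l). Complex (real k) (real l)"
  let ?J = "?g ` ({..<m} \<times> {..<m})"
  have "card ?J = m * m" by (subst card_image) (auto intro: inj_onI)
  moreover have "cmod j \<le> 2 * real m" if jJ: "j \<in> ?J" for j
  proof -
    obtain k l where kl: "j = Complex (real k) (real l)" "k < m" "l < m" using jJ by auto
    have "cmod j \<le> \<bar>Re j\<bar> + \<bar>Im j\<bar>" by (rule cmod_le)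
    then show ?thesis using kl by simp
  qed
  moreover have "cmod (j - k) \<ge> 1" if jk: "j \<in> ?J" "k \<in> ?J" "j \<noteq> k" for j k
  proof -
    obtain a b c d where j: "j = Complex (real a) (real b)" and k: "k = Complex (real c) (real d)" using jk by auto
    have "a \<noteq> c \<or> b \<noteq> d" using jk(3) j k by auto
    then show ?thesis
    proof
      assume "a \<noteq> c"
      then have "\<bar>Re (j - k)\<bar> \<ge> 1" unfolding j k by simp
      then show ?thesis using abs_Re_le_cmod[of "j - k"] by linarith
    next
      assume "b \<noteq> d"
      then have "\<bar>Im (j - k)\<bar> \<ge> 1" unfolding j k by simp
      then show ?thesis using abs_Im_le_cmod[of "j - k"] by linarith
    qed
  qed
  ultimately show ?thesis unfolding F using nR
    by (intro exI[of _ ?J]) (auto simp: deg_over_real_def power2_eq_square)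
qed

text \<open>An anisotropic vector of \<open>VH\<close> serves to read off the scalar by which a
  central element acts.\<close>

locale GGP_anisotropic = GGP_frame F \<iota> \<sigma> sm h n e p \<delta> \<omega> B f
  for F :: "complex set" and \<iota> :: "complex \<Rightarrow> 'e::comm_ring_1" and \<sigma> :: "'e \<Rightarrow> 'e"
    and sm :: "'e \<Rightarrow> 'v::euclidean_space \<Rightarrow> 'v" and h :: "'v \<Rightarrow> 'v \<Rightarrow> 'e" and n :: nat and e :: 'v
    and p :: "'e \<Rightarrow> complex" and \<delta> :: 'e and \<omega> :: complex and B :: "'v set" and f :: "'v \<Rightarrow> 'v" +
  fixes v1 :: 'v and y1 :: 'e
  assumes v1: "v1 \<in> VH" and y1: "h v1 v1 * y1 = 1"
begin

definition tc :: "('v \<Rightarrow>\<^sub>L 'v) \<Rightarrow> 'e" where "tc z = h (z v1) v1 * y1"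

text \<open>A character of \<open>ZH\<close>, used as its coordinate. The other coordinate of the
  scalar is \<open>1 / \<theta> z\<close>, so \<open>\<theta>\<close> alone determines the
  element.\<close>

definition \<theta> :: "('v \<Rightarrow>\<^sub>L 'v) \<Rightarrow> complex" where "\<theta> z = p (tc z)"

lemma tc_zt: "tc (zt t) = t"
proof -
  have "zt t v1 = sm t v1" unfolding zt_apply projH_id[OF v1] by (simp add: sm_simps)
  then have "tc (zt t) = t * (h v1 v1 * y1)" unfolding tc_def by (simp add: h_simps mult.assoc)
  then show ?thesis unfolding y1 by simp
qed

lemma ZH_tc:
  assumes "z \<in> ZH"
  shows "tc z * \<sigma> (tc z) = 1" "x \<in> VH \<Longrightarrow> z x = sm (tc z) x" "z = zt (tc z)"
  unfolding tc_def using ZH_scalar[OF assms v1 y1] ZH_eq_zt[OF assms v1 y1] by auto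

lemma p_sigma_tc: "z \<in> ZH \<Longrightarrow> \<theta> z * p (\<sigma> (tc z)) = 1"
  unfolding \<theta>_def using ZH_tc(1) p_1 by (metis p_mult)

lemma theta_nonzero: "z \<in> ZH \<Longrightarrow> \<theta> z \<noteq> 0"
  using p_sigma_tc by fastforce

lemma p_sigma_tc': "z \<in> ZH \<Longrightarrow> p (\<sigma> (tc z)) = 1 / \<theta> z"
  using p_sigma_tc theta_nonzero by (metis nonzero_mult_div_cancel_left)

lemma ZH_compose: "z \<in> ZH \<Longrightarrow> z' \<in> ZH \<Longrightarrow> z o\<^sub>L z' \<in> ZH"
proof -
  assume z: "z \<in> ZH" "z' \<in> ZH"
  have c: "z (k v) = k (z v)" if "k \<in> carrier (grp_H sm h e)" "z \<in> ZH" for k v z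
  proof -
    have "z o\<^sub>L k = k o\<^sub>L z" using that unfolding group_center_def mult_G by blast
    then show ?thesis by (metis blinfun_apply_blinfun_compose)
  qed
  have "(z o\<^sub>L z') o\<^sub>L k = k o\<^sub>L (z o\<^sub>L z')" if "k \<in> carrier (grp_H sm h e)" for k
    by (rule blinfun_eqI) (simp only: blinfun_apply_blinfun_compose c[OF that z(1)] c[OF that z(2)])
  moreover have "z o\<^sub>L z' \<in> carrier (grp_H sm h e)"
    unfolding carrier_H using ZH_GU[OF z(1)] ZH_GU[OF z(2)] GU_compose by simp
  ultimately show ?thesis unfolding group_center_def mult_G by blast
qed

lemma theta_mult:
  assumes "z \<in> ZH" "z' \<in> ZH"
  shows "\<theta> (z o\<^sub>L z') = \<theta> z * \<theta> z'"
proof -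
  have "(z o\<^sub>L z') v1 = sm (tc z' * tc z) v1"
    using ZH_tc(2)[OF assms(1) v1] ZH_tc(2)[OF assms(2) v1] elinD[OF GU_elin[OF ZH_GU(1)[OF assms(1)]]]
    by (simp add: sm_sm)
  then have "tc (z o\<^sub>L z') = tc z' * tc z * (h v1 v1 * y1)" unfolding tc_def by (simp add: h_simps mult.assoc)
  then show ?thesis unfolding \<theta>_def y1 by (simp add: p_mult mult.commute)
qed

lemma continuous_theta: "continuous_on S \<theta>"
  unfolding \<theta>_def tc_def p_mult by (intro continuous_intros)

lemma ZH_id: "id_blinfun \<in> ZH"
  unfolding group_center_def carrier_H mult_G using GU_id by (auto intro!: blinfun_eqI)

lemma theta_id: "\<theta> id_blinfun = 1"
  unfolding \<theta>_def tc_def by (simp add: y1 p_1)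

text \<open>On the annulus both coordinates \<open>\<theta> z\<close> and
  \<open>1 / \<theta> z\<close> of the scalar are at most 4 in modulus, so subtracting 1 gives two
  coordinates of modulus at most 5. With closedness of \<open>ZH\<close> this makes the annulus
  compact and its Haar measure finite.\<close>

lemma ZH_norm_bound: "\<exists>M\<ge>1. \<forall>z\<in>ZH. 1/4 \<le> cmod (\<theta> z) \<and> cmod (\<theta> z) \<le> 4 \<longrightarrow> norm z \<le> M"
proof -
  obtain M where M: "M \<ge> 0" "\<And>a v. norm (sm a v) \<le> M * (cmod (p a) + cmod (p (\<sigma> a))) * norm v" using sm_bound by blast
  obtain K where K: "K \<ge> 0" "\<And>v. norm (projH v) \<le> K * norm v" using projH_bound by blast
  have "norm z \<le> 1 + M * 10 * K" if z: "z \<in> ZH" "1/4 \<le> cmod (\<theta> z)" "cmod (\<theta> z) \<le> 4" for z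
  proof (rule norm_blinfun_bound)
    show "0 \<le> 1 + M * 10 * K" using M K by simp
    fix v
    have "cmod (p (tc z - 1)) \<le> 5"
      using z(3) norm_triangle_ineq4[of "\<theta> z" 1] unfolding p_diff p_1 \<theta>_def by simp
    moreover have "cmod (p (\<sigma> (tc z - 1))) \<le> 5"
    proof -
      have "cmod (1 / \<theta> z) \<le> 4" using z(2) theta_nonzero[OF z(1)] by (simp add: norm_divide field_simps)
      then show ?thesis using norm_triangle_ineq4[of "1 / \<theta> z" 1]
        unfolding sigma_diff p_diff sigma_hom p_1 p_sigma_tc'[OF z(1)] by simp
    qed
    ultimately have b: "cmod (p (tc z - 1)) + cmod (p (\<sigma> (tc z - 1))) \<le> 10" by simp
    have "z v = v + sm (tc z - 1) (projH v)" using ZH_tc(3)[OF z(1)] zt_apply by metis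
    then have "norm (z v) \<le> norm v + norm (sm (tc z - 1) (projH v))" by (simp add: norm_triangle_ineq)
    also have "\<dots> \<le> norm v + M * 10 * (K * norm v)"
    proof -
      have "norm (sm (tc z - 1) (projH v)) \<le> M * (cmod (p (tc z - 1)) + cmod (p (\<sigma> (tc z - 1)))) * norm (projH v)" by (rule M(2))
      also have "\<dots> \<le> M * 10 * (K * norm v)" using b M(1) K by (intro mult_mono mult_left_mono) auto
      finally show ?thesis by simp
    qed
    finally show "norm (z v) \<le> (1 + M * 10 * K) * norm v" by (simp add: algebra_simps)
  qed
  then show ?thesis using M(1) K(1) by (intro exI[of _ "1 + M * 10 * K"]) auto
qed

lemma compact_ZH_annulus: "compact {z \<in> ZH. 1/4 \<le> cmod (\<theta> z) \<and> cmod (\<theta> z) \<le> 4}"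
proof -
  obtain M where M: "\<forall>z\<in>ZH. 1/4 \<le> cmod (\<theta> z) \<and> cmod (\<theta> z) \<le> 4 \<longrightarrow> norm z \<le> M" using ZH_norm_bound by blast
  have eq: "{z \<in> ZH. 1/4 \<le> cmod (\<theta> z) \<and> cmod (\<theta> z) \<le> 4} = ZH \<inter> {z. 1/4 \<le> cmod (\<theta> z)} \<inter> {z. cmod (\<theta> z) \<le> 4}" by blast
  have "closed {z \<in> ZH. 1/4 \<le> cmod (\<theta> z) \<and> cmod (\<theta> z) \<le> 4}"
    unfolding eq by (intro closed_Int closed_ZH closed_Collect_le continuous_intros continuous_theta)
  moreover have "bounded {z \<in> ZH. 1/4 \<le> cmod (\<theta> z) \<and> cmod (\<theta> z) \<le> 4}"
    by (rule boundedI[of _ M]) (use M in auto)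
  ultimately show ?thesis by (simp add: compact_eq_bounded_closed)
qed

lemma near_one_annulus: "cmod (t - 1) \<le> 1/20 \<Longrightarrow> 19/20 \<le> cmod t \<and> cmod t \<le> 21/20"
  using norm_triangle_ineq2[of 1 t] norm_triangle_ineq2[of t 1] by (simp add: norm_minus_commute)

lemma compact_ZH_disc: "compact {z \<in> ZH. cmod (\<theta> z - 1) \<le> 1/20 \<and> cmod (\<theta> z - c) \<le> s}"
proof -
  have "{z \<in> ZH. cmod (\<theta> z - 1) \<le> 1/20 \<and> cmod (\<theta> z - c) \<le> s} =
    {z \<in> ZH. 1/4 \<le> cmod (\<theta> z) \<and> cmod (\<theta> z) \<le> 4} \<inter> ({z. cmod (\<theta> z - 1) \<le> 1/20} \<inter> {z. cmod (\<theta> z - c) \<le> s})"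
    using near_one_annulus by fastforce
  moreover have "closed ({z. cmod (\<theta> z - 1) \<le> 1/20} \<inter> {z. cmod (\<theta> z - c) \<le> s})"
    by (intro closed_Int closed_Collect_le continuous_intros continuous_theta)
  ultimately show ?thesis using compact_Int_closed[OF compact_ZH_annulus] by simp
qed

lemma compact_in_sets:
  assumes "is_haar_measure ZH \<mu>" "compact S" "S \<subseteq> ZH"
  shows "S \<in> sets \<mu>"
proof -
  have "S \<in> sets (restrict_space borel ZH)"
    using assms(2,3) closed_ZH compact_imp_closed[OF assms(2)] by (subst sets_restrict_space_iff) auto
  then show ?thesis using assms(1) unfolding is_haar_measure_def by simp
qed

text \<open>Packing: about \<open>s^(-q)\<close> translates of the disc are disjoint and lie in the
  fixed compact annulus \<open>K0\<close>. Translation invariance then bounds the measure of each by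
  a multiple of \<open>s^q\<close>.\<close>

lemma haar_disc_bound:
  assumes haar: "is_haar_measure ZH \<mu>"
  shows "\<exists>C>0. \<forall>c s. cmod (c - 1) \<le> 1/20 \<longrightarrow> 0 < s \<longrightarrow>
     emeasure \<mu> {z \<in> ZH. cmod (\<theta> z - 1) \<le> 1/20 \<and> cmod (\<theta> z - c) \<le> s} \<le> ennreal (C * s ^ deg_over_real F)"
proof -
  define K0 where "K0 = {z \<in> ZH. 1/4 \<le> cmod (\<theta> z) \<and> cmod (\<theta> z) \<le> 4}"
  have K0: "compact K0" "K0 \<subseteq> ZH" unfolding K0_def by (rule compact_ZH_annulus) blast
  have K0s: "K0 \<in> sets \<mu>" by (rule compact_in_sets[OF haar K0])
  have "emeasure \<mu> K0 < \<infinity>" using haar K0 unfolding is_haar_measure_def by blast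
  then obtain d where d: "d \<ge> 0" "emeasure \<mu> K0 = ennreal d" by (cases "emeasure \<mu> K0") auto
  define q where "q = deg_over_real F"
  define C where "C = (d + 1) * 72 ^ q"
  have "emeasure \<mu> {z \<in> ZH. cmod (\<theta> z - 1) \<le> 1/20 \<and> cmod (\<theta> z - c) \<le> s} \<le> ennreal (C * s ^ q)"
    if s0: "0 < s" for c s
  proof -
    define A where "A = {z \<in> ZH. cmod (\<theta> z - 1) \<le> 1/20 \<and> cmod (\<theta> z - c) \<le> s}"
    have Ac: "compact A" "A \<subseteq> ZH" unfolding A_def by (rule compact_ZH_disc) blast
    have As: "A \<in> sets \<mu>" by (rule compact_in_sets[OF haar Ac])
    show ?thesis unfolding A_def[symmetric]
    proof (cases "s \<le> 1/36")
      case False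
      \<comment> \<open>For large \<open>s\<close> the finite measure of \<open>K0\<close> is
        enough, since \<open>72 s\<close> exceeds 1.\<close>
      have "A \<subseteq> K0" unfolding A_def K0_def using near_one_annulus by fastforce
      then have "emeasure \<mu> A \<le> ennreal d" using emeasure_mono[OF _ K0s] d by metis
      also have "d \<le> C * s ^ q"
      proof -
        have "1 \<le> (72 * s) ^ q" using False by (intro one_le_power) simp
        then have "(d + 1) * 1 \<le> (d + 1) * (72 * s) ^ q" using d by (intro mult_left_mono) auto
        then show ?thesis unfolding C_def by (simp add: power_mult_distrib mult.assoc)
      qed
      finally show "emeasure \<mu> A \<le> ennreal (C * s ^ q)" by (simp add: ennreal_leI)
    next
      case True
      \<comment> \<open>The 36 keeps the parameters below at modulus at most
        \<open>9 s * 2 m \<le> 1/2\<close>, so that translates stay in the annulus; rounding down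
        costs at most a factor 2, whence the 72.\<close>
      define m where "m = nat \<lfloor>1 / (36 * s)\<rfloor>"
      have x1: "1 / (36 * s) \<ge> 1" using True s0 by (simp add: field_simps)
      have fl: "\<lfloor>1 / (36 * s)\<rfloor> \<ge> 1" using floor_mono[OF x1] by simp
      have mm: "real m = of_int \<lfloor>1 / (36 * s)\<rfloor>" unfolding m_def using fl by (simp only: of_nat_nat)
      have m_le: "real m \<le> 1 / (36 * s)" unfolding mm by (rule of_int_floor_le)
      have "1 / (36 * s) < real m + 1" unfolding mm by linarith
      moreover have "1 \<le> real m" unfolding mm using fl by linarith
      ultimately have m_ge: "1 / (72 * s) \<le> real m"
      proof -
        assume a: "1 / (36 * s) < real m + 1" "1 \<le> real m"
        have "1 / (72 * s) = (1 / (36 * s)) / 2" by simp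
        then show ?thesis using a by linarith
      qed
      obtain J where J: "finite J" "J \<subseteq> F" "card J = m ^ q" "\<And>j. j \<in> J \<Longrightarrow> cmod j \<le> 2 * real m"
        "\<And>j k. j \<in> J \<Longrightarrow> k \<in> J \<Longrightarrow> j \<noteq> k \<Longrightarrow> cmod (j - k) \<ge> 1"
        using ex_separated_grid[OF base_field, of m] unfolding q_def by blast
      define x where "x j = of_real (9 * s) * j" for j :: complex
      have xF: "x j \<in> F" if "j \<in> J" for j unfolding x_def using F_closed(4)[OF F_closed(8)] J(2) that by blast
      have "\<forall>j\<in>J. \<exists>t. p t = exp (\<omega> * x j) \<and> p (\<sigma> t) = exp (- (\<omega> * x j))"
        using ex_norm_one xF by blast
      then obtain t where t: "\<And>j. j \<in> J \<Longrightarrow> p (t j) = exp (\<omega> * x j)"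
        "\<And>j. j \<in> J \<Longrightarrow> p (\<sigma> (t j)) = exp (- (\<omega> * x j))" by metis
      have t1: "t j * \<sigma> (t j) = 1" if "j \<in> J" for j
        by (rule p_eqI) (simp_all add: p_mult sigma_hom t[OF that] p_1 exp_minus)
      define w where "w j = zt (t j)" for j
      have wZ: "w j \<in> ZH" if "j \<in> J" for j unfolding w_def by (rule zt_ZH[OF t1[OF that]])
      have thw: "\<theta> (w j) = exp (\<omega> * x j)" if "j \<in> J" for j unfolding \<theta>_def w_def tc_zt by (rule t(1)[OF that])
      have cw: "cmod \<omega> = 1" using omega by auto
      have cx: "cmod (\<omega> * x j) \<le> 1/2" if "j \<in> J" for j
      proof -
        have "cmod (\<omega> * x j) = 9 * s * cmod j" unfolding x_def using s0 by (simp add: norm_mult cw)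
        also have "\<dots> \<le> 9 * s * (2 * real m)" using J(4)[OF that] s0 by (intro mult_left_mono) auto
        also have "\<dots> \<le> 9 * s * (2 * (1 / (36 * s)))" using m_le s0 by (intro mult_left_mono) auto
        also have "\<dots> = 1/2" using s0 by simp
        finally show ?thesis .
      qed
      have ex2: "cmod (exp y) \<le> 2" if "cmod y \<le> 1/2" for y :: complex
      proof -
        have "cmod (exp y) \<le> exp (cmod y)" by (rule norm_exp)
        also have "\<dots> \<le> exp (1/2)" using that by simp
        also have "\<dots> \<le> 2" by (rule exp_half_le2)
        finally show ?thesis .
      qed
      have ex3: "cmod (exp y) \<ge> 1/2" if "cmod y \<le> 1/2" for y :: complex
      proof -
        have "cmod (exp y) * cmod (exp (- y)) = 1" by (simp add: mult_exp_exp)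
        moreover have "cmod (exp y) * cmod (exp (- y)) \<le> cmod (exp y) * 2" using ex2[of "- y"] that by (intro mult_left_mono) auto
        ultimately show ?thesis by simp
      qed
      have A_near: "19/20 \<le> cmod (\<theta> z) \<and> cmod (\<theta> z) \<le> 21/20" if "z \<in> A" for z
        using near_one_annulus that unfolding A_def by blast
      have sub: "(\<lambda>z. w j o\<^sub>L z) ` A \<subseteq> K0" if j: "j \<in> J" for j
      proof
        fix y assume "y \<in> (\<lambda>z. w j o\<^sub>L z) ` A"
        then obtain z where z: "z \<in> A" "y = w j o\<^sub>L z" by blast
        have zZ: "z \<in> ZH" using z Ac by blast
        have "cmod (\<theta> y) = cmod (exp (\<omega> * x j)) * cmod (\<theta> z)"
          unfolding z theta_mult[OF wZ[OF j] zZ] thw[OF j] by (rule norm_mult)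
        moreover have "cmod (exp (\<omega> * x j)) * cmod (\<theta> z) \<le> 2 * (21/20)"
          using ex2[OF cx[OF j]] A_near[OF z(1)] by (intro mult_mono) auto
        moreover have "(1/2) * (19/20) \<le> cmod (exp (\<omega> * x j)) * cmod (\<theta> z)"
          using ex3[OF cx[OF j]] A_near[OF z(1)] by (intro mult_mono) auto
        ultimately show "y \<in> K0" unfolding K0_def using ZH_compose[OF wZ[OF j] zZ] z(2) by simp
      qed
      have disj: "disjoint_family_on (\<lambda>j. (\<lambda>z. w j o\<^sub>L z) ` A) J"
        unfolding disjoint_family_on_def
      proof (intro ballI impI, rule ccontr)
        fix j k assume j: "j \<in> J" and k: "k \<in> J" and ne: "j \<noteq> k"
          and "(\<lambda>z. w j o\<^sub>L z) ` A \<inter> (\<lambda>z. w k o\<^sub>L z) ` A \<noteq> {}"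
        then obtain z z' where z: "z \<in> A" "z' \<in> A" "w j o\<^sub>L z = w k o\<^sub>L z'" by blast
        have zZ: "z \<in> ZH" "z' \<in> ZH" using z Ac by blast+
        define y where "y = \<omega> * x j - \<omega> * x k"
        have "exp (\<omega> * x j) * \<theta> z = exp (\<omega> * x k) * \<theta> z'"
          using arg_cong[OF z(3), of \<theta>] theta_mult[OF wZ[OF j] zZ(1)] theta_mult[OF wZ[OF k] zZ(2)] thw[OF j] thw[OF k] by simp
        then have "exp y * \<theta> z = \<theta> z'" unfolding y_def exp_diff by (simp add: field_simps)
        then have "(exp y - 1) * \<theta> z = \<theta> z' - \<theta> z" by (simp add: algebra_simps)
        then have "cmod (exp y - 1) * cmod (\<theta> z) = cmod (\<theta> z' - \<theta> z)" by (metis norm_mult)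
        also have "\<theta> z' - \<theta> z = (\<theta> z' - c) - (\<theta> z - c)" by simp
        also have "cmod \<dots> \<le> cmod (\<theta> z' - c) + cmod (\<theta> z - c)" by (rule norm_triangle_ineq4)
        also have "\<dots> \<le> 2 * s" using z(1,2) unfolding A_def by auto
        finally have b1: "cmod (exp y - 1) * cmod (\<theta> z) \<le> 2 * s" .
        have "cmod (exp y - 1) * (19/20) \<le> cmod (exp y - 1) * cmod (\<theta> z)" using A_near[OF z(1)] by (intro mult_left_mono) auto
        with b1 have b2: "cmod (exp y - 1) \<le> (40/19) * s" by simp
        have "cmod y \<le> cmod (\<omega> * x j) + cmod (\<omega> * x k)" unfolding y_def by (rule norm_triangle_ineq4)
        then have y1: "cmod y \<le> 1" using cx[OF j] cx[OF k] by simp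
        \<comment> \<open>Overlapping translates force \<open>exp y\<close> to be within
          \<open>(40/19) s\<close> of 1, hence \<open>y\<close> to have modulus at most
          \<open>(80/19) s\<close>. This is below the grid spacing \<open>9 s\<close>.\<close>
        have "Ln (exp y) = y"
          using abs_Im_le_cmod[of y] y1 pi_gt3 by (intro Ln_exp) auto
        moreover have "cmod (Ln (1 + (exp y - 1))) \<le> 2 * cmod (exp y - 1)"
          using b2 True by (intro norm_Ln_le) auto
        ultimately have "cmod y \<le> (80/19) * s" using b2 by simp
        moreover have "cmod y = 9 * s * cmod (j - k)"
        proof -
          have "y = \<omega> * (of_real (9 * s) * (j - k))" unfolding y_def x_def by (simp add: algebra_simps)
          then show ?thesis using s0 by (simp add: norm_mult cw)
        qed
        moreover have "9 * s * cmod (j - k) \<ge> 9 * s * 1" using J(5)[OF j k ne] s0 by (intro mult_left_mono) auto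
        ultimately show False using s0 by simp
      qed
      have tr: "(\<lambda>z. w j o\<^sub>L z) ` A \<in> sets \<mu>" if "j \<in> J" for j
      proof (rule compact_in_sets[OF haar])
        show "compact ((\<lambda>z. w j o\<^sub>L z) ` A)" by (intro compact_continuous_image Ac continuous_intros)
        show "(\<lambda>z. w j o\<^sub>L z) ` A \<subseteq> ZH" using sub[OF that] K0 by blast
      qed
      have inv: "emeasure \<mu> ((\<lambda>z. w j o\<^sub>L z) ` A) = emeasure \<mu> A" if "j \<in> J" for j
        using haar As wZ[OF that] unfolding is_haar_measure_def by blast
      have "of_nat (m ^ q) * emeasure \<mu> A = (\<Sum>j\<in>J. emeasure \<mu> ((\<lambda>z. w j o\<^sub>L z) ` A))"
        using inv by (simp add: J(3))
      also have "\<dots> = emeasure \<mu> (\<Union>j\<in>J. (\<lambda>z. w j o\<^sub>L z) ` A)"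
        by (rule sum_emeasure) (use tr disj J(1) in auto)
      also have "\<dots> \<le> emeasure \<mu> K0" by (rule emeasure_mono[OF _ K0s]) (use sub in blast)
      finally have main: "of_nat (m ^ q) * emeasure \<mu> A \<le> ennreal d" unfolding d .
      have m0: "real m > 0" using \<open>1 \<le> real m\<close> by linarith
      have "emeasure \<mu> A < \<infinity>" using haar Ac unfolding is_haar_measure_def by blast
      then obtain a where a: "a \<ge> 0" "emeasure \<mu> A = ennreal a" by (cases "emeasure \<mu> A") auto
      have "ennreal (real m ^ q * a) \<le> ennreal d"
        using main a m0 by (simp add: ennreal_mult ennreal_of_nat_eq_real_of_nat)
      then have ma: "real m ^ q * a \<le> d" using d by (simp add: ennreal_le_iff)
      have "(1 / (72 * s)) ^ q * a \<le> real m ^ q * a" using m_ge s0 a by (intro mult_right_mono power_mono) auto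
      then have "(1 / (72 * s)) ^ q * a \<le> d + 1" using ma by linarith
      then have "a \<le> (d + 1) * (72 * s) ^ q" using s0 by (simp add: power_divide field_simps)
      then have "a \<le> C * s ^ q" unfolding C_def by (simp add: power_mult_distrib mult.assoc)
      then show "emeasure \<mu> A \<le> ennreal (C * s ^ q)" unfolding a by (rule ennreal_leI)
    qed
  qed
  moreover have "C > 0" unfolding C_def using d by simp
  ultimately show ?thesis unfolding q_def by blast
qed

end

section \<open>The volume bound\<close>

text \<open>
  If \<open>\<bar>B + C\<bar>\<close> is large then the function is bounded below near 1, otherwise \<open>\<bar>B - C\<bar>\<close> is large and
  the function is expanding near 1.
\<close>

lemma laurent_small_set_diameter:
  fixes A B C t s :: complex
  assumes L: "L = max (cmod B) (cmod C)" and A: "cmod A \<le> L / 8"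
    and t: "cmod (t - 1) \<le> 1/20" and s: "cmod (s - 1) \<le> 1/20"
    and ft: "cmod (A + B * t + C / t) \<le> \<kappa>" and fs: "cmod (A + B * s + C / s) \<le> \<kappa>"
  shows "L * cmod (t - s) \<le> 8 * \<kappa>"
proof -
  have tb: "19/20 \<le> cmod t" "cmod t \<le> 21/20"
    using t norm_triangle_ineq2[of 1 t] norm_triangle_ineq2[of t 1] by (simp_all add: norm_minus_commute)
  have sb: "19/20 \<le> cmod s"
    using s norm_triangle_ineq2[of 1 s] by (simp add: norm_minus_commute)
  have nz: "t \<noteq> 0" "s \<noteq> 0" using tb sb by auto
  have L0: "L \<ge> 0" "cmod B \<le> L" "cmod C \<le> L" unfolding L by (auto simp: le_max_iff_disj)
  have "2 * L \<le> cmod (B + C) + cmod (B - C)"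
  proof -
    have "2 * cmod B = cmod ((B + C) + (B - C))" by (simp add: norm_mult)
    also have "\<dots> \<le> cmod (B + C) + cmod (B - C)" by (rule norm_triangle_ineq)
    finally have 1: "2 * cmod B \<le> cmod (B + C) + cmod (B - C)" .
    have "2 * cmod C = cmod ((B + C) - (B - C))" by (simp add: norm_mult)
    also have "\<dots> \<le> cmod (B + C) + cmod (B - C)" by (rule norm_triangle_ineq4)
    finally show ?thesis using 1 unfolding L by linarith
  qed
  then consider "cmod (B + C) \<ge> L" | "cmod (B - C) \<ge> L" by linarith
  then show ?thesis
  proof cases
    case 1
    \<comment> \<open>For \<open>t\<close> near 1 the function is close to
      \<open>A + (B + C)\<close>, so \<open>\<kappa>\<close> is at least \<open>L / 2\<close> and
      the crude bound \<open>cmod (t - s) \<le> 1\<close> suffices.\<close>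
    have eq: "B + C = (A + B * t + C / t) - A - B * (t - 1) + C * ((t - 1) / t)"
      using nz by (simp add: field_simps)
    have i: "cmod ((t - 1) / t) \<le> 1/19"
    proof -
      have "cmod (t - 1) \<le> (1/19) * (19/20)" using t by simp
      also have "\<dots> \<le> (1/19) * cmod t" using tb by (intro mult_left_mono) auto
      finally show ?thesis using nz by (simp add: norm_divide divide_le_eq)
    qed
    have b1: "cmod (B * (t - 1)) \<le> L * (1/20)" unfolding norm_mult using L0 t by (intro mult_mono) auto
    have b2: "cmod (C * ((t - 1) / t)) \<le> L * (1/19)" unfolding norm_mult using L0 i by (intro mult_mono) auto
    have "cmod (B + C) \<le> cmod ((A + B * t + C / t) - A - B * (t - 1)) + cmod (C * ((t - 1) / t))"
      by (subst eq) (rule norm_triangle_ineq)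
    moreover have "cmod ((A + B * t + C / t) - A - B * (t - 1)) \<le> cmod ((A + B * t + C / t) - A) + cmod (B * (t - 1))"
      by (rule norm_triangle_ineq4)
    moreover have "cmod ((A + B * t + C / t) - A) \<le> cmod (A + B * t + C / t) + cmod A" by (rule norm_triangle_ineq4)
    ultimately have k: "L / 2 \<le> \<kappa>" using 1 b1 b2 ft A L0 by linarith
    have "cmod (t - s) \<le> cmod (t - 1) + cmod (s - 1)" using norm_triangle_ineq4[of "t - 1" "s - 1"] by simp
    then have "cmod (t - s) \<le> 1" using t s by linarith
    then have "L * cmod (t - s) \<le> L * 1" using L0 by (intro mult_left_mono) auto
    then show ?thesis using k L0 by linarith
  next
    case 2
    \<comment> \<open>The difference quotient is \<open>B - C / (t s)\<close>, a perturbation of the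
      derivative \<open>B - C\<close> at 1 by at most \<open>L / 8\<close>.\<close>
    have eq: "(A + B * t + C / t) - (A + B * s + C / s) = (t - s) * ((B - C) + C * ((t * s - 1) / (t * s)))"
      using nz by (simp add: field_simps)
    have ts: "cmod (t * s) \<ge> (19/20) * (19/20)" unfolding norm_mult using tb sb by (intro mult_mono) auto
    have "t * s - 1 = t * (s - 1) + (t - 1)" by (simp add: algebra_simps)
    then have "cmod (t * s - 1) \<le> cmod t * cmod (s - 1) + cmod (t - 1)" by (metis norm_mult norm_triangle_ineq)
    also have "\<dots> \<le> (21/20) * (1/20) + 1/20" using tb s t by (intro add_mono mult_mono) auto
    also have "\<dots> \<le> (1/8) * ((19/20) * (19/20))" by simp
    also have "\<dots> \<le> (1/8) * cmod (t * s)" using ts by (intro mult_left_mono) auto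
    finally have "cmod ((t * s - 1) / (t * s)) \<le> 1/8" using nz by (simp add: norm_divide divide_le_eq)
    then have b: "cmod (C * ((t * s - 1) / (t * s))) \<le> L * (1/8)" unfolding norm_mult[of C] using L0 by (intro mult_mono) auto
    have "cmod (B - C) \<le> cmod ((B - C) + C * ((t * s - 1) / (t * s))) + cmod (C * ((t * s - 1) / (t * s)))"
      by (metis add_diff_cancel norm_triangle_ineq4)
    then have l: "L / 2 \<le> cmod ((B - C) + C * ((t * s - 1) / (t * s)))" using 2 b L0 by linarith
    have "cmod (t - s) * (L / 2) \<le> cmod (t - s) * cmod ((B - C) + C * ((t * s - 1) / (t * s)))"
      using l by (intro mult_left_mono) auto
    also have "\<dots> = cmod ((A + B * t + C / t) - (A + B * s + C / s))" unfolding eq norm_mult ..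
    also have "\<dots> \<le> \<kappa> + \<kappa>" using norm_triangle_ineq4[of "A + B * t + C / t" "A + B * s + C / s"] ft fs by linarith
    finally have "cmod (t - s) * L \<le> 4 * \<kappa>" by simp
    moreover have "\<kappa> \<ge> 0" using ft norm_ge_zero order_trans by blast
    ultimately show ?thesis by (simp add: mult.commute)
  qed
qed

section \<open>Norm estimates for powers of operators\<close>

lemma funpow_blinfun_bound:
  fixes A :: "'a::real_normed_vector \<Rightarrow>\<^sub>L 'a"
  assumes "norm A \<le> R"
  shows "norm ((blinfun_apply A ^^ i) v) \<le> R ^ i * norm v"
proof (induction i)
  case (Suc i)
  have "norm ((blinfun_apply A ^^ Suc i) v) \<le> norm A * norm ((blinfun_apply A ^^ i) v)" by (simp add: norm_blinfun)
  also have "\<dots> \<le> R * (R ^ i * norm v)"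
    using Suc assms order_trans[OF norm_ge_zero assms] by (intro mult_mono) auto
  finally show ?case by (simp add: mult.assoc)
qed simp

lemma funpow_blinfun_lipschitz:
  fixes A C :: "'a::real_normed_vector \<Rightarrow>\<^sub>L 'a"
  assumes "norm A \<le> R" "norm C \<le> R" "1 \<le> R"
  shows "norm ((blinfun_apply A ^^ i) v - (blinfun_apply C ^^ i) v) \<le> real i * R ^ i * norm (A - C) * norm v"
proof (induction i)
  case (Suc i)
  let ?a = "(blinfun_apply A ^^ i) v" and ?c = "(blinfun_apply C ^^ i) v"
  have "(blinfun_apply A ^^ Suc i) v - (blinfun_apply C ^^ Suc i) v = A (?a - ?c) + (A - C) ?c"
    by (simp add: blinfun.diff_left blinfun.diff_right)
  then have "norm ((blinfun_apply A ^^ Suc i) v - (blinfun_apply C ^^ Suc i) v) \<le> norm (A (?a - ?c)) + norm ((A - C) ?c)"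
    by (metis norm_triangle_ineq)
  also have "\<dots> \<le> norm A * norm (?a - ?c) + norm (A - C) * norm ?c" by (intro add_mono norm_blinfun)
  also have "\<dots> \<le> R * (real i * R ^ i * norm (A - C) * norm v) + norm (A - C) * (R * (R ^ i * norm v))"
  proof (intro add_mono mult_mono)
    have "norm ?c \<le> R ^ i * norm v" by (rule funpow_blinfun_bound[OF assms(2)])
    also have "\<dots> = 1 * (R ^ i * norm v)" by simp
    also have "\<dots> \<le> R * (R ^ i * norm v)" using assms(3) by (intro mult_right_mono) auto
    finally show "norm ?c \<le> R * (R ^ i * norm v)" .
  qed (use Suc assms in auto)
  also have "\<dots> = real (Suc i) * R ^ Suc i * norm (A - C) * norm v" by (simp add: algebra_simps)
  finally show ?case .
qed simp

section \<open>Neighborhoods in the adjoint group\<close>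

lemma subgroup_group_center:
  fixes G (structure)
  assumes "group G"
  shows "subgroup (group_center G) G"
proof -
  interpret group G by (rule assms)
  show ?thesis
  proof (rule subgroupI)
    show "group_center G \<subseteq> carrier G" unfolding group_center_def by blast
    show "group_center G \<noteq> {}" unfolding group_center_def by (auto intro!: exI[of _ "\<one>"])
    fix a assume a: "a \<in> group_center G"
    then have aG: "a \<in> carrier G" unfolding group_center_def by blast
    have "inv a \<otimes> g = g \<otimes> inv a" if g: "g \<in> carrier G" for g
    proof -
      have "inv a \<otimes> g = inv a \<otimes> ((g \<otimes> a) \<otimes> inv a)" using aG g by (simp add: m_assoc)
      also have "g \<otimes> a = a \<otimes> g" using a g unfolding group_center_def by auto
      also have "inv a \<otimes> ((a \<otimes> g) \<otimes> inv a) = g \<otimes> inv a"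
        using aG g by (simp add: m_assoc[symmetric])
      finally show ?thesis .
    qed
    then show "inv a \<in> group_center G" unfolding group_center_def using aG by simp
    fix b assume b: "b \<in> group_center G"
    then have bG: "b \<in> carrier G" unfolding group_center_def by blast
    have "(a \<otimes> b) \<otimes> g = g \<otimes> (a \<otimes> b)" if g: "g \<in> carrier G" for g
    proof -
      have "(a \<otimes> b) \<otimes> g = a \<otimes> (b \<otimes> g)" using aG bG g by (rule m_assoc)
      also have "b \<otimes> g = g \<otimes> b" using b g unfolding group_center_def by auto
      also have "a \<otimes> (g \<otimes> b) = (a \<otimes> g) \<otimes> b" using aG bG g by (simp add: m_assoc)
      also have "a \<otimes> g = g \<otimes> a" using a g unfolding group_center_def by auto
      finally show ?thesis using aG bG g by (simp add: m_assoc)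
    qed
    then show "a \<otimes> b \<in> group_center G" unfolding group_center_def using aG bG by simp
  qed
qed

context GGP_frame
begin

abbreviation ZG :: "('v \<Rightarrow>\<^sub>L 'v) set" where "ZG \<equiv> group_center (grp_G sm h)"

lemma coset_elem: "g \<in> ZG #>\<^bsub>grp_G sm h\<^esub> g0 \<longleftrightarrow> (\<exists>z\<in>ZG. g = z o\<^sub>L g0)"
  unfolding r_coset_def mult_G by blast

text \<open>The quotient map is open: the preimage of the image of \<open>GU \<inter> W\<close> is
  the union of its translates by central elements, each relatively open.\<close>

lemma adjoint_neighborhood:
  assumes W: "open W" "id_blinfun \<in> W"
  shows "is_neighborhood (adjoint_topology (grp_G sm h)) \<one>\<^bsub>adjoint_group (grp_G sm h)\<^esub>
    ((\<lambda>g. ZG #>\<^bsub>grp_G sm h\<^esub> g) ` (GU \<inter> W))"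
proof -
  interpret G: group "grp_G sm h" by (rule group_G)
  note sub = subgroup_group_center[OF group_G]
  let ?q = "\<lambda>g. ZG #>\<^bsub>grp_G sm h\<^esub> g"
  let ?U = "?q ` (GU \<inter> W)"
  have carr: "carrier (adjoint_group (grp_G sm h)) = ?q ` GU"
    unfolding adjoint_group_def carrier_FactGroup carrier_G ..
  have idZ: "id_blinfun \<in> ZG" using subgroup.one_closed[OF sub] unfolding mult_G .
  have eq: "{g \<in> GU. ?q g \<in> ?U} = (\<Union>z\<in>ZG. GU \<inter> (\<lambda>g. gi z o\<^sub>L g) -` W)"
  proof (intro equalityI subsetI)
    fix g assume "g \<in> {g \<in> GU. ?q g \<in> ?U}"
    then obtain g0 where g: "g \<in> GU" "g0 \<in> GU" "g0 \<in> W" "?q g = ?q g0" by auto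
    have "g \<in> ?q g" unfolding coset_elem using idZ by (intro bexI[of _ id_blinfun]) (auto intro!: blinfun_eqI)
    then obtain z where z: "z \<in> ZG" "g = z o\<^sub>L g0" unfolding g(4) coset_elem by blast
    have "gi z o\<^sub>L g = g0" unfolding z(2) by (rule blinfun_eqI) (simp add: gi_left[OF center_G_scalar(1)[OF z(1)]])
    then have "gi z o\<^sub>L g \<in> W" using g(3) by simp
    then show "g \<in> (\<Union>z\<in>ZG. GU \<inter> (\<lambda>g. gi z o\<^sub>L g) -` W)" using z(1) g(1) by blast
  next
    fix g assume "g \<in> (\<Union>z\<in>ZG. GU \<inter> (\<lambda>g. gi z o\<^sub>L g) -` W)"
    then obtain z where z: "z \<in> ZG" "g \<in> GU" "gi z o\<^sub>L g \<in> W" by auto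
    have zG: "z \<in> GU" by (rule center_G_scalar(1)[OF z(1)])
    define g0 where "g0 = gi z o\<^sub>L g"
    have g0: "g0 \<in> GU" unfolding g0_def by (rule GU_compose[OF gi_GU[OF zG] z(2)])
    have "g = z o\<^sub>L g0" unfolding g0_def by (rule blinfun_eqI) (simp add: gi_right[OF zG])
    then have "g \<in> ?q g0" unfolding coset_elem using z(1) by blast
    then have "?q g0 = ?q g" using G.repr_independence[OF _ _ sub] g0 unfolding carrier_G by blast
    then show "g \<in> {g \<in> GU. ?q g \<in> ?U}" using z g0 unfolding g0_def by auto
  qed
  have op: "openin (top_of_set GU) {g \<in> GU. ?q g \<in> ?U}"
    unfolding eq
  proof (intro openin_Union ballI, elim imageE)
    fix S z assume S: "S = GU \<inter> (\<lambda>g. gi z o\<^sub>L g) -` W"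
    have "open ((\<lambda>g. gi z o\<^sub>L g) -` W)" by (intro open_vimage W continuous_intros)
    then show "openin (top_of_set GU) S" unfolding S by (simp add: openin_open_Int)
  qed
  have openU: "openin (adjoint_topology (grp_G sm h)) ?U"
    unfolding openin_adjoint_topology carr carrier_G using op by blast
  have "\<one>\<^bsub>adjoint_group (grp_G sm h)\<^esub> = ?q id_blinfun"
    unfolding adjoint_group_def one_FactGroup using G.coset_mult_one[of ZG] subgroup.subset[OF sub] by (simp add: mult_G)
  then have "\<one>\<^bsub>adjoint_group (grp_G sm h)\<^esub> \<in> ?U" using W GU_id by blast
  then show ?thesis unfolding is_neighborhood_def interior_of_def using openin_subset[OF openU] openU by blast
qed

section \<open>Comparison of \<open>d_H\<close> with the \<open>VH\<close>-component\<close>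

lemma F_norm_bound:
  assumes "is_F_norm F \<iota> sm N"
  shows "\<exists>C\<ge>0. \<forall>v. 0 \<le> N v \<and> N v \<le> (C * norm v) ^ deg_over_real F"
proof -
  obtain \<nu> where nu: "\<And>v. \<nu> v \<ge> 0" "\<And>v. \<nu> v = 0 \<longleftrightarrow> v = 0" "\<And>v w. \<nu> (v + w) \<le> \<nu> v + \<nu> w"
    "\<And>t v. t \<in> F \<Longrightarrow> \<nu> (sm (\<iota> t) v) = cmod t * \<nu> v" "\<And>v. N v = \<nu> v ^ deg_over_real F"
    using assms unfolding is_F_norm_def by blast
  have scale: "\<nu> (r *\<^sub>R v) = \<bar>r\<bar> * \<nu> v" for r v
    using nu(4)[OF F_closed(8), of r v] by (simp add: scaleR_compat)
  have sum: "\<nu> (\<Sum>i\<in>I. g i) \<le> (\<Sum>i\<in>I. \<nu> (g i))" if "finite I" for I :: "'v set" and g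
    using that
  proof induction
    case empty
    then show ?case using nu(2)[of 0] by simp
  next
    case (insert x I)
    then show ?case using nu(3)[of "g x" "\<Sum>i\<in>I. g i"] by simp
  qed
  define C where "C = (\<Sum>b\<in>Basis. \<nu> (b::'v))"
  have C0: "C \<ge> 0" unfolding C_def by (intro sum_nonneg nu(1))
  have "\<nu> v \<le> C * norm v" for v
  proof -
    have "\<nu> v = \<nu> (\<Sum>b\<in>Basis. (v \<bullet> b) *\<^sub>R b)" by (simp add: euclidean_representation)
    also have "\<dots> \<le> (\<Sum>b\<in>Basis. \<nu> ((v \<bullet> b) *\<^sub>R b))" by (rule sum) simp
    also have "\<dots> \<le> (\<Sum>b\<in>Basis. norm v * \<nu> b)"
      unfolding scale by (intro sum_mono mult_right_mono nu(1) Basis_le_norm)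
    finally show ?thesis unfolding C_def by (simp add: sum_distrib_left mult.commute)
  qed
  then have "0 \<le> N v \<and> N v \<le> (C * norm v) ^ deg_over_real F" for v
    unfolding nu(5) using nu(1) by (auto intro!: power_mono)
  then show ?thesis using C0 by blast
qed

lemma unit_inverse_eq: "a * b = 1 \<Longrightarrow> unit_inverse a = (b::'e)"
  unfolding unit_inverse_def by (rule the_equality) (auto, metis mult.assoc mult.commute mult_1)

text \<open>The norm-one factor \<open>l\<close>, by which two lifts differ, cancels on dividing by
  \<open>h (g e) e\<close>. After normalisation both vectors have the same component along
  \<open>e\<close>, so their difference is the scaled \<open>VH\<close>-component.\<close>

lemma dtilde_H_scaled:
  assumes g: "blinfun_apply g e = sm l x" and l: "l * \<sigma> l = 1" and b: "h x e * b = 1"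
  shows "dtilde_H sm h e N g = ennreal (N (sm b (projH x)))"
proof -
  have hg: "h (g e) e * (\<sigma> l * b) = 1"
  proof -
    have "h (g e) e * (\<sigma> l * b) = (l * \<sigma> l) * (h x e * b)" unfolding g h_sm_left by (simp add: mult_ac)
    then show ?thesis unfolding l b by simp
  qed
  have "sm (\<sigma> l * b) (sm l x) - sm ei e = sm b (projH x)"
  proof -
    have "sm (\<sigma> l * b) (sm l x) = sm ((l * \<sigma> l) * b) x" by (simp add: sm_sm mult_ac)
    also have "\<dots> = sm b x" unfolding l by simp
    also have "\<dots> = sm b (sm (coef x) e + projH x)" using projH_decomp[of x] by simp
    also have "\<dots> = sm ((h x e * b) * ei) e + sm b (projH x)" unfolding coef_def by (simp add: sm_add_right sm_sm mult_ac)
    finally show ?thesis unfolding b by simp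
  qed
  moreover have "h (sm l x) e dvd 1" using hg unfolding g by (metis dvd_triv_left)
  ultimately show ?thesis
    unfolding dtilde_H_def Let_def unit_inverse_eq[OF h_ee_ei] g unit_inverse_eq[OF hg[unfolded g]] by simp
qed

lemma center_G_gi:
  assumes "z \<in> ZG" "l * \<sigma> l = 1" "\<And>x. z x = sm l x"
  shows "gi z x = sm (\<sigma> l) x"
proof -
  have "z (sm (\<sigma> l) x) = x" unfolding assms(3) sm_sm assms(2) sm_one ..
  then show ?thesis using gi_left[OF center_G_scalar(1)[OF assms(1)], of "sm (\<sigma> l) x"] by simp
qed

text \<open>The term of \<open>d_H\<close> for the inverse is directly the scaled component
  \<open>u\<close>. For the other one, apply \<open>projH\<close> to
  \<open>e = g (\<alpha> e + u)\<close>: this expresses \<open>projH (g e)\<close> as a bounded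
  scalar times \<open>projH (g u)\<close>. The central factor \<open>z\<close> only changes the
  lift.\<close>

lemma d_H_bound:
  assumes "is_F_norm F \<iota> sm N"
  shows "\<exists>C>0. \<forall>g\<in>GU. \<forall>z\<in>ZG. norm g \<le> 2 \<and> 1/2 \<le> cmod (p (coef (gi g e))) \<and> 1/2 \<le> cmod (p (\<sigma> (coef (gi g e)))) \<longrightarrow>
    d_H sm h e N (z o\<^sub>L g) \<le> ennreal (C * norm (projH (gi g e)) ^ deg_over_real F)"
proof -
  obtain CN where CN: "CN \<ge> 0" "\<And>v. 0 \<le> N v" "\<And>v. N v \<le> (CN * norm v) ^ deg_over_real F"
    using F_norm_bound[OF assms] by blast
  obtain M where M: "M \<ge> 0" "\<And>a v. norm (sm a v) \<le> M * (cmod (p a) + cmod (p (\<sigma> a))) * norm v" using sm_bound by blast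
  obtain K where K: "K \<ge> 0" "\<And>v. norm (projH v) \<le> K * norm v" using projH_bound by blast
  define q where "q = deg_over_real F"
  define k where "k = cmod (p ei)"
  define D1 where "D1 = CN * (M * (4 * k))"
  define D2 where "D2 = CN * (M * (4 * k) * (M * 4 * (K * 2)))"
  have k0: "k \<ge> 0" unfolding k_def by simp
  have D0: "D1 \<ge> 0" "D2 \<ge> 0" unfolding D1_def D2_def using CN M K k0 by auto
  have sei: "\<sigma> ei = ei" by (rule sigma_inverse_h_self[OF h_ee_ei])
  have pee: "p (h e e) * p ei = 1" using h_ee_ei p_1 by (metis p_mult)
  have "d_H sm h e N (z o\<^sub>L g) \<le> ennreal ((D1 ^ q + D2 ^ q + 1) * norm (projH (gi g e)) ^ q)"
    if g: "g \<in> GU" and z: "z \<in> ZG" and ng: "norm g \<le> 2" and a1: "1/2 \<le> cmod (p (coef (gi g e)))"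
      and a2: "1/2 \<le> cmod (p (\<sigma> (coef (gi g e))))" for g z
  proof -
    define w where "w = gi g e"
    define u where "u = projH w"
    define \<alpha> where "\<alpha> = coef w"
    note a1 = a1[folded w_def, folded \<alpha>_def] and a2 = a2[folded w_def, folded \<alpha>_def]
    have zG: "z \<in> GU" by (rule center_G_scalar(1)[OF z])
    obtain l where l: "l * \<sigma> l = 1" "\<And>x. z x = sm l x" using center_G_scalar(2)[OF z] by blast
    have "p \<alpha> \<noteq> 0" "p (\<sigma> \<alpha>) \<noteq> 0" using a1 a2 by auto
    then obtain \<alpha>' where \<alpha>': "\<alpha> * \<alpha>' = 1" using ex_inverse by blast
    have sl: "\<sigma> l * \<sigma> (\<sigma> l) = 1" using l(1) by (simp add: sigma_hom mult.commute)
    have pa: "p \<alpha> * p \<alpha>' = 1" "p (\<sigma> \<alpha>) * p (\<sigma> \<alpha>') = 1"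
      using \<alpha>' p_1 sigma_hom by (metis p_mult)+
    have half: "cmod y \<le> 2" if "x * y = 1" "1/2 \<le> cmod x" for x y
    proof -
      have "cmod x * cmod y = 1" using that(1) by (metis norm_mult norm_one)
      moreover have "(1/2) * cmod y \<le> cmod x * cmod y" using that(2) by (intro mult_right_mono) auto
      ultimately show ?thesis by simp
    qed
    have a': "cmod (p \<alpha>') \<le> 2" "cmod (p (\<sigma> \<alpha>')) \<le> 2" using half[OF pa(1) a1] half[OF pa(2) a2] by auto
    \<comment> \<open>The inverse of \<open>h w e = \<alpha> h(e, e)\<close>; applying
      \<open>\<sigma>\<close> inverts \<open>h (g e) e\<close>, so one bound on the coordinates
      serves both terms.\<close>
    define b where "b = \<alpha>' * ei"
    have hw: "h w e = \<alpha> * h e e"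
    proof -
      have "\<alpha> * h e e = h w e * (h e e * ei)" unfolding \<alpha>_def coef_def by (simp add: mult_ac)
      then show ?thesis unfolding h_ee_ei by simp
    qed
    have b: "h w e * b = 1"
    proof -
      have "h w e * b = (\<alpha> * \<alpha>') * (h e e * ei)" unfolding hw b_def by (simp add: mult_ac)
      then show ?thesis unfolding \<alpha>' h_ee_ei by simp
    qed
    have pb: "cmod (p b) + cmod (p (\<sigma> b)) \<le> 4 * k"
    proof -
      have "cmod (p b) \<le> 2 * k" unfolding b_def p_mult norm_mult k_def using a' by (intro mult_right_mono) auto
      moreover have "cmod (p (\<sigma> b)) \<le> 2 * k"
        unfolding b_def p_mult sigma_hom sei norm_mult k_def using a' by (intro mult_right_mono) auto
      ultimately show ?thesis by simp
    qed
    have b': "h (g e) e * \<sigma> b = 1"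
    proof -
      have "h (g e) e = \<sigma> (h w e)" unfolding h_sigma w_def by (rule GU_adj[OF g])
      then have "h (g e) e * \<sigma> b = \<sigma> (h w e * b)" by (simp add: sigma_hom)
      then show ?thesis unfolding b by (simp add: sigma_hom)
    qed
    have e1: "(z o\<^sub>L g) e = sm l (g e)" by (simp add: l(2))
    have e2: "(gi (z o\<^sub>L g)) e = sm (\<sigma> l) w"
      unfolding gi_compose[OF zG g] w_def by (simp add: center_G_gi[OF z l] elinD[OF GU_elin[OF gi_GU[OF g]]])
    have dt2: "dtilde_H sm h e N (gi (z o\<^sub>L g)) = ennreal (N (sm b u))"
      unfolding u_def by (rule dtilde_H_scaled[OF e2 sl b])
    have dt1: "dtilde_H sm h e N (z o\<^sub>L g) = ennreal (N (sm (\<sigma> b) (projH (g e))))"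
      by (rule dtilde_H_scaled[OF e1 l(1) b'])
    have nu: "norm (sm b u) \<le> M * (4 * k) * norm u"
      using M(2)[of b u] pb M(1) by (meson mult_left_mono mult_right_mono norm_ge_zero order_trans)
    have u': "norm (projH (g e)) \<le> M * 4 * (K * 2) * norm u"
    proof -
      have w: "w = sm \<alpha> e + u" unfolding \<alpha>_def u_def by (rule projH_decomp)
      have "e = g w" unfolding w_def by (simp add: gi_right[OF g])
      also have "\<dots> = sm \<alpha> (g e) + g u" by (subst w) (simp add: blinfun.add_right elinD[OF GU_elin[OF g]])
      finally have "projH e = sm \<alpha> (projH (g e)) + projH (g u)" by (metis projH_add projH_sm)
      then have "sm \<alpha>' (sm \<alpha> (projH (g e)) + projH (g u)) = 0" unfolding projH_e by (simp add: sm_zero_right)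
      then have "projH (g e) = - sm \<alpha>' (projH (g u))"
        using \<alpha>' by (simp add: sm_add_right sm_sm mult.commute[of \<alpha>'] sm_one eq_neg_iff_add_eq_0)
      then have "norm (projH (g e)) \<le> M * (cmod (p \<alpha>') + cmod (p (\<sigma> \<alpha>'))) * norm (projH (g u))" using M(2) by simp
      also have "\<dots> \<le> M * 4 * (K * (2 * norm u))"
      proof (intro mult_mono mult_left_mono)
        have "norm (projH (g u)) \<le> K * norm (g u)" by (rule K(2))
        also have "\<dots> \<le> K * (2 * norm u)"
          using norm_blinfun[of g u] mult_right_mono[OF ng norm_ge_zero[of u]] K(1) by (intro mult_left_mono) auto
        finally show "norm (projH (g u)) \<le> K * (2 * norm u)" .
      qed (use a' M K in auto)
      finally show ?thesis by simp
    qed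
    have nu': "norm (sm (\<sigma> b) (projH (g e))) \<le> M * (4 * k) * (M * 4 * (K * 2) * norm u)"
    proof -
      have "norm (sm (\<sigma> b) (projH (g e))) \<le> M * (cmod (p (\<sigma> b)) + cmod (p b)) * norm (projH (g e))"
        using M(2)[of "\<sigma> b" "projH (g e)"] by (simp add: sigma_hom)
      also have "\<dots> \<le> M * (4 * k) * (M * 4 * (K * 2) * norm u)"
        using pb u' M(1) k0 by (intro mult_mono mult_left_mono) auto
      finally show ?thesis .
    qed
    have "N (sm b u) \<le> (D1 * norm u) ^ q"
    proof -
      have "CN * norm (sm b u) \<le> D1 * norm u" unfolding D1_def using nu CN(1) by (metis mult.assoc mult_left_mono)
      then show ?thesis using CN(3)[of "sm b u"] CN(1) power_mono[of "CN * norm (sm b u)" "D1 * norm u" q]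
        unfolding q_def by (meson mult_nonneg_nonneg norm_ge_zero order_trans)
    qed
    moreover have "N (sm (\<sigma> b) (projH (g e))) \<le> (D2 * norm u) ^ q"
    proof -
      have "CN * norm (sm (\<sigma> b) (projH (g e))) \<le> D2 * norm u"
        unfolding D2_def using nu' CN(1) by (metis mult.assoc mult_left_mono)
      then show ?thesis using CN(3)[of "sm (\<sigma> b) (projH (g e))"] CN(1)
          power_mono[of "CN * norm (sm (\<sigma> b) (projH (g e)))" "D2 * norm u" q]
        unfolding q_def by (meson mult_nonneg_nonneg norm_ge_zero order_trans)
    qed
    ultimately have tot: "N (sm (\<sigma> b) (projH (g e))) + N (sm b u) \<le> (D1 ^ q + D2 ^ q + 1) * norm u ^ q"
      unfolding power_mult_distrib distrib_right mult_1 using zero_le_power[OF norm_ge_zero[of u], of q] by linarith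
    have "d_H sm h e N (z o\<^sub>L g) \<le> dtilde_H sm h e N (z o\<^sub>L g) + dtilde_H sm h e N (gi (z o\<^sub>L g))"
      unfolding d_H_def gi_def by simp
    also have "\<dots> = ennreal (N (sm (\<sigma> b) (projH (g e))) + N (sm b u))"
      unfolding dt1 dt2 by (rule ennreal_plus[symmetric]) (auto simp: CN(2))
    also have "\<dots> \<le> ennreal ((D1 ^ q + D2 ^ q + 1) * norm u ^ q)" by (rule ennreal_leI[OF tot])
    finally show ?thesis unfolding u_def w_def .
  qed
  moreover have "D1 ^ q + D2 ^ q + 1 > 0" using D0 by (simp add: add_nonneg_pos)
  ultimately show ?thesis unfolding q_def by blast
qed

section \<open>Cyclicity, uniformly on compact sets\<close>

lemma continuous_funpow_e: "continuous_on S (\<lambda>x :: ('v \<Rightarrow>\<^sub>L 'v) \<times> 'v. (blinfun_apply (fst x) ^^ i) e)"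
  by (induction i) (auto intro!: continuous_intros)

text \<open>For each stable \<open>T\<close> and unit vector \<open>u\<close> some power of
  \<open>T\<close> detects \<open>u\<close>. Compactness of the set of such pairs bounds the powers
  required and gives a positive lower bound for the sum of the detecting functions.\<close>

lemma cyclic_lower_bound:
  assumes K: "compact K" "K \<subseteq> lie_dual_stab F \<iota> sm h e"
  shows "\<exists>m c. c > 0 \<and> (\<forall>T\<in>LA. Phi T \<in> K \<longrightarrow> (\<forall>u. \<exists>i\<le>m. c * norm u \<le>
     max (cmod (p (h ((blinfun_apply T ^^ i) e) u))) (cmod (p (h u ((blinfun_apply T ^^ i) e))))))"
proof -
  have Kd: "K \<subseteq> lie_dual sm h" using K(2) unfolding lie_dual_stab_def by blast
  define X where "X = Tmap ` K \<times> sphere (0::'v) 1"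
  have Xc: "compact X" unfolding X_def
    by (intro compact_Times compact_continuous_image K continuous_on_subset[OF continuous_Tmap]) auto
  define G where "G i x = cmod (p (h ((blinfun_apply (fst x) ^^ i) e) (snd x))) + cmod (p (h (snd x) ((blinfun_apply (fst x) ^^ i) e)))"
    for i and x :: "('v \<Rightarrow>\<^sub>L 'v) \<times> 'v"
  have Gc: "continuous_on S (G i)" for S i
    unfolding G_def by (intro continuous_intros continuous_funpow_e)
  have G0: "G i x \<ge> 0" for i x unfolding G_def by simp
  have pos: "\<exists>i. G i x > 0" if xX: "x \<in> X" for x
  proof (rule ccontr)
    assume "\<not> ?thesis"
    then have "\<not> G i x > 0" for i by blast
    then have z: "G i x = 0" for i using G0[of i x] by (metis less_eq_real_def)
    obtain \<xi> where xi: "\<xi> \<in> K" "fst x = Tmap \<xi>" using xX unfolding X_def by auto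
    have xid: "\<xi> \<in> lie_dual sm h" using xi Kd by blast
    have "snd x = 0"
    proof (rule stable_imp_cyclic[OF Tmap_LA[OF xid]])
      show "Phi (Tmap \<xi>) \<in> lie_dual_stab F \<iota> sm h e" unfolding Phi_Tmap[OF xid] using xi K(2) by blast
      fix i
      have "p (h ((blinfun_apply (Tmap \<xi>) ^^ i) e) (snd x)) = 0" "p (h (snd x) ((blinfun_apply (Tmap \<xi>) ^^ i) e)) = 0"
        using z[of i] unfolding G_def xi(2) by (simp_all add: add_nonneg_eq_0_iff)
      then show "h ((blinfun_apply (Tmap \<xi>) ^^ i) e) (snd x) = 0" by (intro p_inj) (simp_all add: h_sigma)
    qed
    then show False using xX unfolding X_def by auto
  qed
  have opn: "open {x. G i x > 0}" for i
    by (intro open_Collect_less continuous_on_const Gc)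
  have cov: "X \<subseteq> (\<Union>i\<in>UNIV. {x. G i x > 0})" using pos by blast
  obtain I where I: "I \<subseteq> UNIV" "finite I" "X \<subseteq> (\<Union>i\<in>I. {x. G i x > 0})"
    by (rule compactE_image[OF Xc opn cov])
  define g where "g x = (\<Sum>i\<in>I. G i x)" for x
  have gpos: "g x > 0" if xX: "x \<in> X" for x
  proof -
    have "x \<in> (\<Union>i\<in>I. {x. G i x > 0})" using I(3) xX by (rule subsetD)
    then obtain i where "i \<in> I" "G i x > 0" by blast
    then show ?thesis unfolding g_def using sum_pos2[OF I(2), of i "\<lambda>i. G i x"] G0 by blast
  qed
  have gc: "continuous_on X g" unfolding g_def by (intro continuous_intros Gc)
  obtain c0 where c0: "c0 > 0" "\<And>x. x \<in> X \<Longrightarrow> c0 \<le> g x"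
  proof (cases "X = {}")
    case True
    then show thesis using that[of 1] by auto
  next
    case False
    obtain x0 where "x0 \<in> X" "\<forall>x\<in>X. g x0 \<le> g x" using continuous_attains_inf[OF Xc False gc] by blast
    then show thesis using that[of "g x0"] gpos by blast
  qed
  define m where "m = Max (insert 0 I)"
  \<comment> \<open>Were all maxima below \<open>c\<close>, the at most \<open>card I\<close> terms
    of the sum, each at most \<open>2 c\<close>, would add up to less than
    \<open>c0\<close>.\<close>
  define c where "c = c0 / (2 * (real (card I) + 1))"
  have cpos: "c > 0" unfolding c_def using c0 by simp
  have main: "\<exists>i\<le>m. c \<le> max (cmod (p (h ((blinfun_apply T ^^ i) e) u))) (cmod (p (h u ((blinfun_apply T ^^ i) e))))"
    if T: "T \<in> LA" "Phi T \<in> K" and u: "norm u = 1" for T u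
  proof (rule ccontr)
    assume neg: "\<not> ?thesis"
    have "(T, u) \<in> X" unfolding X_def using T u Tmap_Phi[OF T(1)] by force
    then have "c0 \<le> g (T, u)" by (rule c0(2))
    also have "\<dots> \<le> (\<Sum>i\<in>I. 2 * c)"
      unfolding g_def
    proof (rule sum_mono)
      fix i assume "i \<in> I"
      then have "i \<le> m" unfolding m_def using I(2) by simp
      then have "\<not> c \<le> max (cmod (p (h ((blinfun_apply T ^^ i) e) u))) (cmod (p (h u ((blinfun_apply T ^^ i) e))))"
        using neg by blast
      then show "G i (T, u) \<le> 2 * c" unfolding G_def by (simp add: le_max_iff_disj not_le)
    qed
    also have "\<dots> = real (card I) * (2 * c)" by simp
    also have "\<dots> < (real (card I) + 1) * (2 * c)" using cpos by simp
    also have "\<dots> = c0" unfolding c_def by (simp add: field_simps)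
    finally show False by simp
  qed
  have "\<exists>i\<le>m. c * norm u \<le> max (cmod (p (h ((blinfun_apply T ^^ i) e) u))) (cmod (p (h u ((blinfun_apply T ^^ i) e))))"
    if T: "T \<in> LA" "Phi T \<in> K" for T u
  proof (cases "u = 0")
    case True
    then show ?thesis by (intro exI[of _ 0]) (auto simp: le_max_iff_disj)
  next
    case False
    define r where "r = norm u"
    have r: "r > 0" unfolding r_def using False by simp
    obtain i where i: "i \<le> m" "c \<le> max (cmod (p (h ((blinfun_apply T ^^ i) e) ((1/r) *\<^sub>R u)))) (cmod (p (h ((1/r) *\<^sub>R u) ((blinfun_apply T ^^ i) e))))"
      using main[OF T, of "(1/r) *\<^sub>R u"] r unfolding r_def by auto
    have "c \<le> (1/r) * max (cmod (p (h ((blinfun_apply T ^^ i) e) u))) (cmod (p (h u ((blinfun_apply T ^^ i) e))))"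
      using i(2) r unfolding p_h_scaleR norm_mult by (simp add: max_mult_distrib_left norm_divide)
    then have "c * r \<le> max (cmod (p (h ((blinfun_apply T ^^ i) e) u))) (cmod (p (h u ((blinfun_apply T ^^ i) e))))"
      using r by (simp add: field_simps)
    then show ?thesis using i(1) unfolding r_def by blast
  qed
  then show ?thesis using cpos by blast
qed

lemma funpow_LA:
  assumes T: "T \<in> LA"
  shows "(blinfun_apply T ^^ i) (x + y) = (blinfun_apply T ^^ i) x + (blinfun_apply T ^^ i) y"
    "(blinfun_apply T ^^ i) (sm a x) = sm a ((blinfun_apply T ^^ i) x)"
    "h ((blinfun_apply T ^^ i) x) y = (- 1) ^ i * h x ((blinfun_apply T ^^ i) y)"
proof -
  show "(blinfun_apply T ^^ i) (x + y) = (blinfun_apply T ^^ i) x + (blinfun_apply T ^^ i) y"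
    by (induction i) (auto simp: blinfun.add_right)
  show "(blinfun_apply T ^^ i) (sm a x) = sm a ((blinfun_apply T ^^ i) x)"
    by (induction i) (auto simp: elinD[OF LA_elin[OF T]])
  show "h ((blinfun_apply T ^^ i) x) y = (- 1) ^ i * h x ((blinfun_apply T ^^ i) y)"
  proof (induction i arbitrary: y)
    case (Suc i)
    have "h ((blinfun_apply T ^^ Suc i) x) y = - h ((blinfun_apply T ^^ i) x) (T y)" by (simp add: LA_skew[OF T])
    also have "\<dots> = - ((- 1) ^ i * h x ((blinfun_apply T ^^ i) (T y)))" unfolding Suc ..
    finally show ?case by (simp add: funpow_swap1)
  qed simp
qed

lemma funpow_conj:
  assumes k: "k \<in> GU"
  shows "(blinfun_apply (k o\<^sub>L T o\<^sub>L gi k) ^^ i) x = k ((blinfun_apply T ^^ i) (gi k x))"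
proof (induction i)
  case 0
  show ?case by (simp add: gi_right[OF k])
next
  case (Suc i)
  then show ?case by (simp add: gi_left[OF k])
qed

end

context GGP_anisotropic
begin

lemma projH_diff: "projH (u - v) = projH u - projH v"
  unfolding projH_def coef_def by (simp add: h_simps sm_simps algebra_simps)

text \<open>The central element leaves \<open>\<alpha> e\<close> alone and its inverse multiplies
  \<open>u\<close> by \<open>\<sigma> t\<close>, the inverse of \<open>t\<close>. In the hermitian
  expansion the two pure terms are therefore free of \<open>t\<close>, while the mixed ones carry
  \<open>t\<close> and its inverse, that is \<open>\<theta> z\<close> and
  \<open>1 / \<theta> z\<close> in the first coordinate.\<close>

lemma invariant_expansion:
  assumes g: "g \<in> GU" and z: "z \<in> ZH" and T: "T \<in> LA"
  defines "w \<equiv> gi g e"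
  defines "\<alpha> \<equiv> coef w" and "u \<equiv> projH w"
  shows "p (h ((blinfun_apply ((g o\<^sub>L z) o\<^sub>L T o\<^sub>L gi (g o\<^sub>L z)) ^^ i) e) e) =
    p \<alpha> * p (\<sigma> \<alpha>) * p (h ((blinfun_apply T ^^ i) e) e) + p (h ((blinfun_apply T ^^ i) u) u)
    + p \<alpha> * p (h ((blinfun_apply T ^^ i) e) u) * \<theta> z
    + p (\<sigma> \<alpha>) * (- 1) ^ i * p (h u ((blinfun_apply T ^^ i) e)) / \<theta> z"
proof -
  have zG: "z \<in> GU" by (rule ZH_GU(1)[OF z])
  have kG: "g o\<^sub>L z \<in> GU" by (rule GU_compose[OF g zG])
  define t where "t = tc z"
  have tt: "t * \<sigma> t = 1" unfolding t_def by (rule ZH_tc(1)[OF z])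
  have uV: "u \<in> VH" unfolding u_def by (rule projH_VH)
  have giz_e: "gi z e = e" using gi_left[OF zG, of e] ZH_GU(2)[OF z] by simp
  have giz_u: "gi z u = sm (\<sigma> t) u"
  proof -
    have "z (sm (\<sigma> t) u) = sm (t * \<sigma> t) u"
      using ZH_tc(2)[OF z VH_closed(2)[OF uV], of "\<sigma> t"] unfolding t_def by (simp add: sm_sm)
    then have "z (sm (\<sigma> t) u) = u" unfolding tt sm_one .
    then show ?thesis using gi_left[OF zG, of "sm (\<sigma> t) u"] by simp
  qed
  have w: "w = sm \<alpha> e + u" unfolding \<alpha>_def u_def by (rule projH_decomp)
  have w': "gi (g o\<^sub>L z) e = sm \<alpha> e + sm (\<sigma> t) u"
    unfolding gi_compose[OF g zG] blinfun_apply_blinfun_compose w_def[symmetric]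
    by (subst w) (simp add: blinfun.add_right elinD[OF GU_elin[OF gi_GU[OF zG]]] giz_e giz_u)
  have "h ((blinfun_apply ((g o\<^sub>L z) o\<^sub>L T o\<^sub>L gi (g o\<^sub>L z)) ^^ i) e) e
    = h ((blinfun_apply T ^^ i) (gi (g o\<^sub>L z) e)) (gi (g o\<^sub>L z) e)"
    unfolding funpow_conj[OF kG] by (rule GU_adj[OF kG])
  also have "\<dots> = \<alpha> * \<sigma> \<alpha> * h ((blinfun_apply T ^^ i) e) e + (t * \<sigma> t) * h ((blinfun_apply T ^^ i) u) u
     + \<alpha> * t * h ((blinfun_apply T ^^ i) e) u + \<sigma> t * \<sigma> \<alpha> * h ((blinfun_apply T ^^ i) u) e"
    unfolding w' funpow_LA(1)[OF T] funpow_LA(2)[OF T] h_add_left h_add_right h_sm_left h_sm_right sigma_hom(4)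
    by (simp add: algebra_simps)
  also have "h ((blinfun_apply T ^^ i) u) e = (- 1) ^ i * h u ((blinfun_apply T ^^ i) e)" by (rule funpow_LA(3)[OF T])
  finally have eq: "h ((blinfun_apply ((g o\<^sub>L z) o\<^sub>L T o\<^sub>L gi (g o\<^sub>L z)) ^^ i) e) e =
     \<alpha> * \<sigma> \<alpha> * h ((blinfun_apply T ^^ i) e) e + h ((blinfun_apply T ^^ i) u) u
     + \<alpha> * t * h ((blinfun_apply T ^^ i) e) u + \<sigma> t * \<sigma> \<alpha> * ((- 1) ^ i * h u ((blinfun_apply T ^^ i) e))"
    unfolding tt mult_1_left .
  have pm: "p ((- 1) ^ i) = (- 1) ^ i" by (induction i) (simp_all add: p_1 p_mult p_minus)
  have "p t = \<theta> z" "p (\<sigma> t) = 1 / \<theta> z" unfolding t_def using p_sigma_tc'[OF z] by (simp_all add: \<theta>_def)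
  then show ?thesis unfolding eq p_add p_mult pm by (simp add: algebra_simps)
qed

text \<open>A lift of a class near the identity need not be near the identity itself, so it is
  written as a central \<open>z0\<close> times a \<open>g\<close> close to 1. The factor
  \<open>z0\<close> disappears from the coadjoint action.\<close>

lemma volume_bound:
  assumes haar: "is_haar_measure ZH \<mu>" and ip: "is_inner_product_on_dual sm h ip"
    and N: "is_F_norm F \<iota> sm N" and K: "compact K" "K \<subseteq> lie_dual_stab F \<iota> sm h e"
  shows "\<exists>\<epsilon> r0 C. \<epsilon> > 0 \<and> r0 > 0 \<and> C > 0 \<and> (\<forall>\<tau>\<in>K. \<forall>g\<in>GU. \<forall>z0\<in>ZG. norm (g - id_blinfun) < \<epsilon> \<longrightarrow>
     (\<forall>r. 0 < r \<and> r < r0 \<longrightarrow>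
       emeasure \<mu> {z \<in> {z \<in> ZH. cmod (\<theta> z - 1) \<le> 1/20}.
           dist_F F ip (coad sm h ((z0 o\<^sub>L g) o\<^sub>L z) \<tau>) (H_orbit sm h e \<tau>) \<le> r}
         \<le> ennreal C * (ennreal r / d_H sm h e N (z0 o\<^sub>L g))))"
proof -
  define q where "q = deg_over_real F"
  have q0: "q > 0" unfolding q_def deg_over_real_def by simp
  have Kd: "K \<subseteq> lie_dual sm h" using K(2) unfolding lie_dual_stab_def by blast
  obtain c0 where c0: "c0 > 0" "\<And>T. T \<in> LA \<Longrightarrow> c0 * norm T \<le> dual_norm ip (Phi T)"
    using dual_norm_lower_bound[OF ip] by blast
  obtain m c where c: "c > 0" and cyc: "\<And>T u. T \<in> LA \<Longrightarrow> Phi T \<in> K \<Longrightarrow> \<exists>i\<le>m. c * norm u \<le>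
     max (cmod (p (h ((blinfun_apply T ^^ i) e) u))) (cmod (p (h u ((blinfun_apply T ^^ i) e))))"
    using cyclic_lower_bound[OF K] by blast
  have "compact (Tmap ` K)" by (intro compact_continuous_image K continuous_on_subset[OF continuous_Tmap]) auto
  then have "\<exists>b>0. \<forall>x\<in>Tmap ` K. norm x \<le> b" by (intro bounded_pos[THEN iffD1] compact_imp_bounded)
  then obtain M0 where M0: "M0 > 0" "\<And>T. T \<in> Tmap ` K \<Longrightarrow> norm T \<le> M0" by blast
  obtain Mh where Mh: "Mh > 0" "\<And>v w. cmod (p (h v w)) \<le> norm v * norm w * Mh"
    using bounded_bilinear.pos_bounded[OF bounded_bilinear_p_h] by blast
  obtain Mz where Mz: "Mz \<ge> 1" "\<And>z. z \<in> ZH \<Longrightarrow> 1/4 \<le> cmod (\<theta> z) \<Longrightarrow> cmod (\<theta> z) \<le> 4 \<Longrightarrow> norm z \<le> Mz"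
    using ZH_norm_bound by blast
  obtain KH where KH: "KH \<ge> 0" "\<And>v. norm (projH v) \<le> KH * norm v" using projH_bound by blast
  obtain C2 where C2: "C2 > 0" "\<And>g z. g \<in> GU \<Longrightarrow> z \<in> ZG \<Longrightarrow> norm g \<le> 2 \<Longrightarrow> 1/2 \<le> cmod (p (coef (gi g e))) \<Longrightarrow>
      1/2 \<le> cmod (p (\<sigma> (coef (gi g e)))) \<Longrightarrow>
      d_H sm h e N (z o\<^sub>L g) \<le> ennreal (C2 * norm (projH (gi g e)) ^ q)"
    using d_H_bound[OF N] unfolding q_def by blast
  obtain C4 where C4: "C4 > 0" "\<And>c s. cmod (c - 1) \<le> 1/20 \<Longrightarrow> 0 < s \<Longrightarrow>
     emeasure \<mu> {z \<in> ZH. cmod (\<theta> z - 1) \<le> 1/20 \<and> cmod (\<theta> z - c) \<le> s} \<le> ennreal (C4 * s ^ q)"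
    using haar_disc_bound[OF haar] unfolding q_def by blast
  define E0 where "E0 = norm e"
  define k where "k = cmod (p ei)"
  \<comment> \<open>Common bound for all operators compared: the product bounds the conjugate of
    \<open>T\<close> by \<open>g z\<close>, \<open>M0\<close> bounds \<open>T\<close>, and the 1
    allows for an orbit point at distance at most 1.\<close>
  define R where "R = 2 * Mz * M0 * (Mz * 2) + M0 + 1"
  define C1 where "C1 = Mh * k * (R ^ m * E0 * E0 * Mh) + R ^ m * Mh + 1"
  \<comment> \<open>If \<open>norm u \<le> \<eta>\<close> then
    \<open>C1 * (norm u)^2 \<le> c * norm u / 16\<close>, which is at most \<open>L / 8\<close>, the
    smallness of \<open>A\<close> required by the Laurent estimate.\<close>
  define \<eta> where "\<eta> = c / (16 * C1)"
  \<comment> \<open>The entry \<open>1/2\<close> keeps \<open>g\<close> and its inverse at norm at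
    most 2, the second gives \<open>norm u \<le> \<eta>\<close>, and the third keeps both
    coordinates of \<open>\<alpha>\<close> within \<open>1/2\<close> of 1.\<close>
  define \<epsilon> where "\<epsilon> = min (1/2) (min (\<eta> / (2 * KH * E0 + 1)) (1 / (4 * (Mh * E0 * E0 * k) + 1)))"
  define C3 where "C3 = E0 * E0 * Mh * (real m * R ^ m) * (2 / c0) + 1"
  \<comment> \<open>Makes \<open>(2 / c0) * \<rho>\<close> less than 1 for the \<open>q\<close>-th
    root \<open>\<rho>\<close> of \<open>r\<close>, so that the nearby orbit point is within
    operator distance 1.\<close>
  define r0 where "r0 = (c0 / 2) ^ q"
  define C where "C = C4 * (16 * C3 / c) ^ q * C2"
  have E0: "E0 \<ge> 0" and k: "k \<ge> 0" unfolding E0_def k_def by auto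
  have R: "R \<ge> 1" "M0 \<le> R" "2 * Mz * M0 * (Mz * 2) + 1 \<le> R"
    unfolding R_def using Mz(1) M0(1) by auto
  have C1: "C1 > 0" unfolding C1_def using Mh(1) k E0 R(1) by (intro add_nonneg_pos add_nonneg_nonneg) auto
  have C3: "C3 > 0" unfolding C3_def using Mh(1) E0 R(1) c0(1) by (intro add_nonneg_pos) auto
  have eta: "\<eta> > 0" unfolding \<eta>_def using c C1 by simp
  have eps: "\<epsilon> > 0" unfolding \<epsilon>_def using eta KH(1) E0 Mh(1) k by (auto intro!: divide_pos_pos add_nonneg_pos)
  have eps1: "\<epsilon> \<le> 1/2" unfolding \<epsilon>_def by (rule min.cobounded1)
  have eps2: "KH * (2 * \<epsilon> * E0) \<le> \<eta>"
  proof -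
    have "\<epsilon> \<le> \<eta> / (2 * KH * E0 + 1)" unfolding \<epsilon>_def by (rule min.coboundedI2[OF min.cobounded1])
    moreover have "2 * KH * E0 + 1 > 0" using KH(1) E0 by (intro add_nonneg_pos) auto
    ultimately have "\<epsilon> * (2 * KH * E0 + 1) \<le> \<eta>" by (simp add: pos_le_divide_eq)
    then show ?thesis using eps by (simp add: algebra_simps)
  qed
  have eps3: "2 * \<epsilon> * E0 * E0 * Mh * k \<le> 1/2"
  proof -
    have "\<epsilon> \<le> 1 / (4 * (Mh * E0 * E0 * k) + 1)" unfolding \<epsilon>_def by (rule min.coboundedI2[OF min.cobounded2])
    moreover have "4 * (Mh * E0 * E0 * k) + 1 > 0" using Mh(1) E0 k by (intro add_nonneg_pos) auto
    ultimately have "\<epsilon> * (4 * (Mh * E0 * E0 * k) + 1) \<le> 1" by (simp add: pos_le_divide_eq)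
    then show ?thesis using eps by (simp add: algebra_simps)
  qed
  have r0: "r0 > 0" unfolding r0_def using c0 by simp
  have C: "C > 0" unfolding C_def using C4 C3 c C2 by simp
  have "emeasure \<mu> {z \<in> {z \<in> ZH. cmod (\<theta> z - 1) \<le> 1/20}.
           dist_F F ip (coad sm h ((z0 o\<^sub>L g) o\<^sub>L z) \<tau>) (H_orbit sm h e \<tau>) \<le> r}
         \<le> ennreal C * (ennreal r / d_H sm h e N (z0 o\<^sub>L g))"
    if tau: "\<tau> \<in> K" and g: "g \<in> GU" and z0: "z0 \<in> ZG" and ge: "norm (g - id_blinfun) < \<epsilon>"
      and r: "0 < r" "r < r0" for \<tau> g z0 r
  proof -
    define S where "S = {z \<in> {z \<in> ZH. cmod (\<theta> z - 1) \<le> 1/20}.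
           dist_F F ip (coad sm h ((z0 o\<^sub>L g) o\<^sub>L z) \<tau>) (H_orbit sm h e \<tau>) \<le> r}"
    define T where "T = Tmap \<tau>"
    have T: "T \<in> LA" "Phi T = \<tau>" "norm T \<le> M0"
      unfolding T_def using Tmap_LA Phi_Tmap tau Kd M0(2) by blast+
    define w where "w = gi g e"
    define \<alpha> where "\<alpha> = coef w"
    define u where "u = projH w"
    have ng: "norm g \<le> 2"
    proof -
      have "norm g \<le> norm (g - id_blinfun) + norm (id_blinfun :: 'v \<Rightarrow>\<^sub>L 'v)" by (metis diff_add_cancel norm_triangle_ineq)
      moreover have "norm (id_blinfun :: 'v \<Rightarrow>\<^sub>L 'v) \<le> 1" by (rule norm_blinfun_id_le)
      ultimately show ?thesis using ge eps1 by linarith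
    qed
    have ngi: "norm (gi g) \<le> 2"
    proof (rule norm_blinfun_bound)
      fix v
      define y where "y = gi g v"
      have "v = y + (g - id_blinfun) y" unfolding y_def by (simp add: blinfun.diff_left gi_right[OF g])
      then have "norm y \<le> norm v + norm ((g - id_blinfun) y)" by (metis add_diff_cancel_right' norm_triangle_ineq4)
      also have "norm ((g - id_blinfun) y) \<le> (1/2) * norm y"
        using norm_blinfun[of "g - id_blinfun" y] ge eps1
        by (meson less_eq_real_def mult_right_mono norm_ge_zero order_trans)
      finally show "norm (gi g v) \<le> 2 * norm v" unfolding y_def by simp
    qed simp
    have we: "norm (w - e) \<le> 2 * \<epsilon> * E0"
    proof -
      have "w - e = gi g (- ((g - id_blinfun) e))"
        unfolding w_def by (simp add: blinfun.diff_left blinfun.diff_right blinfun.minus_right gi_left[OF g])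
      then have "norm (w - e) \<le> norm (gi g) * norm ((g - id_blinfun) e)" using norm_blinfun[of "gi g"] by (metis norm_minus_cancel)
      also have "\<dots> \<le> 2 * (\<epsilon> * E0)"
      proof (intro mult_mono)
        have "norm ((g - id_blinfun) e) \<le> norm (g - id_blinfun) * norm e" by (rule norm_blinfun)
        also have "\<dots> \<le> \<epsilon> * E0" unfolding E0_def using ge by (intro mult_right_mono) auto
        finally show "norm ((g - id_blinfun) e) \<le> \<epsilon> * E0" .
      qed (use ngi in auto)
      finally show ?thesis by simp
    qed
    have ue: "norm u \<le> \<eta>"
    proof -
      have "projH w = projH (w - e) + projH e" by (simp add: projH_add[symmetric])
      then have "u = projH (w - e)" unfolding u_def projH_e by simp
      then have "norm u \<le> KH * norm (w - e)" using KH(2) by simp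
      also have "\<dots> \<le> KH * (2 * \<epsilon> * E0)" using we KH(1) by (intro mult_left_mono)
      finally show ?thesis using eps2 by linarith
    qed
    have sei: "\<sigma> ei = ei" by (rule sigma_inverse_h_self[OF h_ee_ei])
    have pee: "p (h e e) * p ei = 1" using h_ee_ei p_1 by (metis p_mult)
    have a1: "p \<alpha> - 1 = p (h (w - e) e) * p ei" "p (\<sigma> \<alpha>) - 1 = p (h e (w - e)) * p ei"
      unfolding \<alpha>_def coef_def sigma_hom p_mult sei h_sigma h_diff_left h_diff_right p_diff
      by (simp_all add: left_diff_distrib pee)
    have small: "cmod (p (h x y) * p ei) \<le> 1/2" if "norm x * norm y \<le> 2 * \<epsilon> * E0 * E0" for x y
    proof -
      have "cmod (p (h x y) * p ei) \<le> (norm x * norm y * Mh) * k"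
        unfolding norm_mult k_def using Mh(2) by (intro mult_right_mono) auto
      also have "\<dots> \<le> (2 * \<epsilon> * E0 * E0 * Mh) * k" using that Mh(1) k by (intro mult_right_mono) auto
      finally show ?thesis using eps3 by linarith
    qed
    have b1: "cmod (p \<alpha> - 1) \<le> 1/2" unfolding a1
      by (rule small) (use we E0 in \<open>auto simp: E0_def[symmetric] intro!: mult_right_mono\<close>)
    have b2: "cmod (p (\<sigma> \<alpha>) - 1) \<le> 1/2" unfolding a1
      by (rule small) (use we E0 in \<open>auto simp: E0_def[symmetric] mult.commute[of E0 "norm _"] intro!: mult_right_mono\<close>)
    have pa: "1/2 \<le> cmod (p \<alpha>)" "1/2 \<le> cmod (p (\<sigma> \<alpha>))"
      using b1 b2 norm_triangle_ineq2[of 1 "p \<alpha>"] norm_triangle_ineq2[of 1 "p (\<sigma> \<alpha>)"]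
      by (simp_all add: norm_minus_commute)
    have dH: "d_H sm h e N (z0 o\<^sub>L g) \<le> ennreal (C2 * norm u ^ q)"
      unfolding u_def w_def by (rule C2(2)[OF g z0 ng]) (use pa in \<open>simp_all add: \<alpha>_def w_def\<close>)
    show ?thesis
    \<comment> \<open>If \<open>d_H\<close> vanishes the right-hand side is infinite; otherwise
      \<open>u\<close> is nonzero and can be divided by.\<close>
    proof (cases "d_H sm h e N (z0 o\<^sub>L g) = 0")
      case True
      then show ?thesis using r C by (simp add: ennreal_mult_eq_top_iff)
    next
      case dnz: False
      have u0: "norm u > 0"
      proof (rule ccontr)
        assume "\<not> ?thesis"
        then have "norm u = 0" by simp
        then have z: "norm u ^ q = 0" using q0 by simp
        show False using dH dnz unfolding z by simp
      qed
      obtain i where i: "i \<le> m" "c * norm u \<le> max (cmod (p (h ((blinfun_apply T ^^ i) e) u))) (cmod (p (h u ((blinfun_apply T ^^ i) e))))"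
        using cyc[OF T(1), of u] T(2) tau by blast
      define A where "A = (p \<alpha> * p (\<sigma> \<alpha>) - 1) * p (h ((blinfun_apply T ^^ i) e) e) + p (h ((blinfun_apply T ^^ i) u) u)"
      define B' where "B' = p \<alpha> * p (h ((blinfun_apply T ^^ i) e) u)"
      define C' where "C' = p (\<sigma> \<alpha>) * (- 1) ^ i * p (h u ((blinfun_apply T ^^ i) e))"
      define L where "L = max (cmod B') (cmod C')"
      have LB: "c * norm u / 2 \<le> L"
      proof -
        have x1: "cmod (p (h ((blinfun_apply T ^^ i) e) u)) / 2 \<le> cmod B'"
          unfolding B'_def norm_mult using mult_right_mono[OF pa(1) norm_ge_zero] by simp
        have x2: "cmod (p (h u ((blinfun_apply T ^^ i) e))) / 2 \<le> cmod C'"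
          unfolding C'_def norm_mult norm_power using mult_right_mono[OF pa(2) norm_ge_zero] by simp
        show ?thesis using i(2) x1 x2 unfolding L_def by linarith
      qed
      have Ri: "R ^ i \<le> R ^ m" using R(1) i(1) by (rule power_increasing[rotated])
      have TR: "norm T \<le> R" using T(3) R(2) by linarith
      have Tie: "norm ((blinfun_apply T ^^ i) v) \<le> R ^ m * norm v" for v
        using funpow_blinfun_bound[OF TR, of i v] mult_right_mono[OF Ri norm_ge_zero[of v]] by linarith
      have Ab: "cmod A \<le> C1 * (norm u * norm u)"
      proof -
        have "h w w = h e e" unfolding w_def by (rule GU_h[OF gi_GU[OF g]])
        moreover have "h w w = \<alpha> * \<sigma> \<alpha> * h e e + h u u"
        proof -
          have w: "w = sm \<alpha> e + u" unfolding \<alpha>_def u_def by (rule projH_decomp)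
          have uV: "u \<in> VH" unfolding u_def by (rule projH_VH)
          show ?thesis unfolding w by (simp add: h_simps VH_h_left[OF uV] VH_h_right[OF uV] mult_ac)
        qed
        ultimately have "p (\<alpha> * \<sigma> \<alpha> * h e e + h u u) = p (h e e)" by simp
        then have "(p \<alpha> * p (\<sigma> \<alpha>) - 1) * p (h e e) = - p (h u u)" by (simp add: p_add p_mult algebra_simps)
        then have "(p \<alpha> * p (\<sigma> \<alpha>) - 1) * (p (h e e) * p ei) = - p (h u u) * p ei" by (simp add: mult.assoc[symmetric])
        then have aa: "p \<alpha> * p (\<sigma> \<alpha>) - 1 = - (p (h u u) * p ei)" unfolding pee by simp
        have "cmod (p \<alpha> * p (\<sigma> \<alpha>) - 1) \<le> norm u * norm u * Mh * k"
          unfolding aa norm_minus_cancel norm_mult k_def using Mh(2) by (intro mult_right_mono) auto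
        moreover have "cmod (p (h ((blinfun_apply T ^^ i) e) e)) \<le> R ^ m * E0 * E0 * Mh"
        proof -
          have "cmod (p (h ((blinfun_apply T ^^ i) e) e)) \<le> norm ((blinfun_apply T ^^ i) e) * norm e * Mh" by (rule Mh(2))
          also have "\<dots> \<le> R ^ m * norm e * norm e * Mh" using Tie[of e] Mh(1) by (intro mult_right_mono) auto
          finally show ?thesis unfolding E0_def .
        qed
        ultimately have y1: "cmod ((p \<alpha> * p (\<sigma> \<alpha>) - 1) * p (h ((blinfun_apply T ^^ i) e) e))
            \<le> (norm u * norm u * Mh * k) * (R ^ m * E0 * E0 * Mh)"
          unfolding norm_mult[of "p \<alpha> * p (\<sigma> \<alpha>) - 1"] using Mh(1) k by (intro mult_mono) auto
        have y2: "cmod (p (h ((blinfun_apply T ^^ i) u) u)) \<le> R ^ m * norm u * norm u * Mh"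
        proof -
          have "cmod (p (h ((blinfun_apply T ^^ i) u) u)) \<le> norm ((blinfun_apply T ^^ i) u) * norm u * Mh" by (rule Mh(2))
          also have "\<dots> \<le> R ^ m * norm u * norm u * Mh" using Tie[of u] Mh(1) by (intro mult_right_mono) auto
          finally show ?thesis .
        qed
        have "cmod A \<le> (norm u * norm u * Mh * k) * (R ^ m * E0 * E0 * Mh) + R ^ m * norm u * norm u * Mh"
          unfolding A_def using norm_triangle_le[OF add_mono[OF y1 y2]] .
        also have "\<dots> \<le> C1 * (norm u * norm u)" unfolding C1_def by (simp add: algebra_simps)
        finally show ?thesis .
      qed
      have AL: "cmod A \<le> L / 8"
      proof -
        have "C1 * (norm u * norm u) \<le> C1 * (\<eta> * norm u)" using ue C1 by (intro mult_left_mono mult_right_mono) auto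
        also have "\<dots> = c * norm u / 16" unfolding \<eta>_def using C1 by simp
        finally show ?thesis using Ab LB by linarith
      qed
      define \<rho> where "\<rho> = root q r"
      have rho: "\<rho> > 0" "\<rho> ^ q = r" unfolding \<rho>_def using r q0 by auto
      have rho0: "\<rho> < c0 / 2"
        by (rule power_less_imp_less_base[of _ q]) (use rho r c0 in \<open>auto simp: r0_def\<close>)
      have bnd: "cmod (A + B' * \<theta> z + C' / \<theta> z) \<le> C3 * \<rho>" if z: "z \<in> S" for z
      proof -
        have zZ: "z \<in> ZH" and th: "cmod (\<theta> z - 1) \<le> 1/20"
          and dist: "dist_F F ip (coad sm h ((z0 o\<^sub>L g) o\<^sub>L z) \<tau>) (H_orbit sm h e \<tau>) \<le> r"
          using z unfolding S_def by auto
        have zG: "z \<in> GU" by (rule ZH_GU(1)[OF zZ])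
        have z0G: "z0 \<in> GU" by (rule center_G_scalar(1)[OF z0])
        have kG: "g o\<^sub>L z \<in> GU" by (rule GU_compose[OF g zG])
        define X where "X = (g o\<^sub>L z) o\<^sub>L T o\<^sub>L gi (g o\<^sub>L z)"
        have X: "X \<in> LA" unfolding X_def by (rule LA_conj[OF kG T(1)])
        have coX: "coad sm h ((z0 o\<^sub>L g) o\<^sub>L z) \<tau> = Phi X"
        proof -
          obtain l where l: "l * \<sigma> l = 1" "\<And>x. z0 x = sm l x" using center_G_scalar(2)[OF z0] by blast
          have as: "(z0 o\<^sub>L g) o\<^sub>L z = z0 o\<^sub>L (g o\<^sub>L z)" by (rule blinfun_eqI) simp
          have "(z0 o\<^sub>L (g o\<^sub>L z)) o\<^sub>L T o\<^sub>L gi (z0 o\<^sub>L (g o\<^sub>L z)) = X"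
          proof (rule blinfun_eqI)
            fix v
            have "((z0 o\<^sub>L (g o\<^sub>L z)) o\<^sub>L T o\<^sub>L gi (z0 o\<^sub>L (g o\<^sub>L z))) v = z0 (X (gi z0 v))"
              unfolding gi_compose[OF z0G kG] X_def by simp
            also have "\<dots> = sm (l * \<sigma> l) (X v)"
              unfolding l(2) center_G_gi[OF z0 l] elinD[OF LA_elin[OF X]] sm_sm ..
            finally show "((z0 o\<^sub>L (g o\<^sub>L z)) o\<^sub>L T o\<^sub>L gi (z0 o\<^sub>L (g o\<^sub>L z))) v = X v" unfolding l(1) sm_one .
          qed
          then show ?thesis unfolding as T(2)[symmetric] using coad_Phi[OF GU_compose[OF z0G kG] T(1)] by simp
        qed
        have "dual_dist ip (Phi X) (H_orbit sm h e \<tau>) ^ q \<le> \<rho> ^ q"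
          using dist unfolding coX dist_F_def q_def[symmetric] rho(2) .
        then have "dual_dist ip (Phi X) (H_orbit sm h e \<tau>) \<le> \<rho>"
          using power_le_imp_le_base[of _ "q - 1" \<rho>] rho(1) q0 by (metis Suc_pred' less_imp_le)
        \<comment> \<open>The infimum over the orbit need not be attained; with
          \<open>2 * \<rho>\<close> the inequality is strict and an orbit point can be
          picked.\<close>
        then have "dual_dist ip (Phi X) (H_orbit sm h e \<tau>) < 2 * \<rho>" using rho(1) by linarith
        moreover have "H_orbit sm h e \<tau> \<noteq> {}" unfolding H_orbit_def carrier_H using GU_id by auto
        ultimately obtain y where y: "y \<in> H_orbit sm h e \<tau>" "dual_norm ip (\<lambda>x. Phi X x - y x) < 2 * \<rho>"
          unfolding dual_dist_def using cInf_lessD[of "(\<lambda>\<eta>. dual_norm ip (\<lambda>x. Phi X x - \<eta> x)) ` H_orbit sm h e \<tau>" "2 * \<rho>"] by blast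
        obtain h0 where h0: "h0 \<in> GU" "h0 e = e" "y = coad sm h h0 \<tau>" using y(1) unfolding H_orbit_def carrier_H by blast
        define Y where "Y = h0 o\<^sub>L T o\<^sub>L gi h0"
        have Y: "Y \<in> LA" unfolding Y_def by (rule LA_conj[OF h0(1) T(1)])
        have yY: "y = Phi Y" unfolding h0(3) Y_def T(2)[symmetric] by (rule coad_Phi[OF h0(1) T(1)])
        have "c0 * norm (X - Y) \<le> dual_norm ip (Phi (X - Y))" by (rule c0(2)[OF LA_diff[OF X Y]])
        also have "\<dots> < 2 * \<rho>" using y(2) unfolding Phi_diff yY .
        finally have nXY: "norm (X - Y) \<le> 2 / c0 * \<rho>" using c0(1) by (simp add: field_simps)
        also have "\<dots> \<le> 1" using rho0 c0(1) by (simp add: field_simps)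
        finally have XY1: "norm (X - Y) \<le> 1" .
        have ann: "19/20 \<le> cmod (\<theta> z)" "cmod (\<theta> z) \<le> 21/20" using near_one_annulus[OF th] by auto
        have nz: "norm z \<le> Mz" by (rule Mz(2)[OF zZ]) (use ann in auto)
        have tz: "tc z * \<sigma> (tc z) = 1" by (rule ZH_tc(1)[OF zZ])
        have ngz: "norm (gi z) \<le> Mz"
        proof -
          have s1: "\<sigma> (tc z) * \<sigma> (\<sigma> (tc z)) = 1" using tz by (simp add: sigma_hom mult.commute)
          have zi: "gi z = zt (\<sigma> (tc z))"
          proof (rule gi_unique[OF zG zt_GU[OF s1]], rule blinfun_eqI)
            fix v
            have "z v = v + sm (tc z - 1) (projH v)" using ZH_tc(3)[OF zZ] zt_apply by metis
            then have "zt (\<sigma> (tc z)) (z v) = v + sm (tc z * \<sigma> (tc z) - 1) (projH v)"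
              by (simp add: zt_apply projH_add projH_diff projH_sm projH_id[OF projH_VH] sm_simps right_diff_distrib mult.commute)
            then show "(zt (\<sigma> (tc z)) o\<^sub>L z) v = id_blinfun v" unfolding tz by (simp add: sm_simps)
          qed
          have zZ': "zt (\<sigma> (tc z)) \<in> ZH" by (rule zt_ZH[OF s1])
          have "\<theta> (zt (\<sigma> (tc z))) = 1 / \<theta> z" unfolding \<theta>_def tc_zt using p_sigma_tc'[OF zZ] by (simp add: \<theta>_def)
          then have inv: "cmod (\<theta> (zt (\<sigma> (tc z)))) = 1 / cmod (\<theta> z)" by (simp add: norm_divide)
          have "1 / (21/20) \<le> 1 / cmod (\<theta> z)" "1 / cmod (\<theta> z) \<le> 1 / (19/20)"
            using ann by (intro divide_left_mono; linarith | simp)+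
          then show ?thesis unfolding zi by (intro Mz(2)[OF zZ']) (simp_all add: inv)
        qed
        have nX: "norm X \<le> 2 * Mz * M0 * (Mz * 2)"
        proof -
          have "norm X \<le> norm g * norm z * norm T * (norm (gi z) * norm (gi g))"
            unfolding X_def gi_compose[OF g zG]
            by (intro order_trans[OF norm_blinfun_compose] mult_mono norm_blinfun_compose) auto
          also have "\<dots> \<le> 2 * Mz * M0 * (Mz * 2)"
            using ng nz ngz ngi T(3) Mz(1) M0(1) by (intro mult_mono) auto
          finally show ?thesis .
        qed
        have XR: "norm X \<le> R" using nX R(3) by linarith
        have "norm Y \<le> norm X + norm (X - Y)" using norm_triangle_ineq4[of X "X - Y"] by simp
        then have YR: "norm Y \<le> R" using nX XY1 R(3) by linarith
        have "norm ((blinfun_apply X ^^ i) e - (blinfun_apply Y ^^ i) e) \<le> real i * R ^ i * norm (X - Y) * norm e"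
          by (rule funpow_blinfun_lipschitz[OF XR YR R(1)])
        also have "\<dots> \<le> real m * R ^ m * (2 / c0 * \<rho>) * E0"
          unfolding E0_def using i(1) Ri nXY R(1) c0(1) rho(1) by (intro mult_mono) auto
        finally have dXY: "norm ((blinfun_apply X ^^ i) e - (blinfun_apply Y ^^ i) e) \<le> real m * R ^ m * (2 / c0 * \<rho>) * E0" .
        have "gi h0 e = e" using gi_left[OF h0(1), of e] h0(2) by simp
        then have hY: "h ((blinfun_apply Y ^^ i) e) e = h ((blinfun_apply T ^^ i) e) e"
          unfolding Y_def funpow_conj[OF h0(1)] GU_adj[OF h0(1)] by simp
        have "A + B' * \<theta> z + C' / \<theta> z = p (h ((blinfun_apply X ^^ i) e) e) - p (h ((blinfun_apply T ^^ i) e) e)"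
          unfolding X_def invariant_expansion[OF g zZ T(1)] A_def B'_def C'_def u_def \<alpha>_def w_def
          by (simp add: algebra_simps)
        also have "\<dots> = p (h ((blinfun_apply X ^^ i) e - (blinfun_apply Y ^^ i) e) e)"
          unfolding h_diff_left p_diff hY ..
        finally have "cmod (A + B' * \<theta> z + C' / \<theta> z) \<le> norm ((blinfun_apply X ^^ i) e - (blinfun_apply Y ^^ i) e) * E0 * Mh"
          unfolding E0_def using Mh(2) by simp
        also have "\<dots> \<le> (real m * R ^ m * (2 / c0 * \<rho>) * E0) * E0 * Mh"
          using dXY E0 Mh(1) by (intro mult_right_mono) auto
        also have "\<dots> = (C3 - 1) * \<rho>" unfolding C3_def by (simp add: field_simps)
        also have "\<dots> \<le> C3 * \<rho>" using rho(1) by (simp add: algebra_simps)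
        finally show ?thesis .
      qed
      \<comment> \<open>The diameter \<open>8 \<kappa> / L\<close> of the Laurent estimate for
        \<open>\<kappa> = C3 * \<rho>\<close>, with \<open>L\<close> replaced by its lower bound
        \<open>c * norm u / 2\<close>.\<close>
      define s where "s = 16 * C3 * \<rho> / (c * norm u)"
      have s0: "s > 0" unfolding s_def using C3 rho(1) c u0 by simp
      have close: "cmod (\<theta> z - \<theta> z') \<le> s" if z: "z \<in> S" "z' \<in> S" for z z'
      proof -
        have "L * cmod (\<theta> z - \<theta> z') \<le> 8 * (C3 * \<rho>)"
          by (rule laurent_small_set_diameter[OF L_def AL _ _ bnd[OF z(1)] bnd[OF z(2)]])
            (use z in \<open>auto simp: S_def\<close>)
        moreover have "(c * norm u / 2) * cmod (\<theta> z - \<theta> z') \<le> L * cmod (\<theta> z - \<theta> z')"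
          using LB by (intro mult_right_mono) auto
        ultimately have "(c * norm u / 2) * cmod (\<theta> z - \<theta> z') \<le> 8 * (C3 * \<rho>)" by linarith
        then have "cmod (\<theta> z - \<theta> z') * (c * norm u) \<le> 16 * C3 * \<rho>" by (simp add: mult_ac)
        moreover have "c * norm u > 0" using c u0 by simp
        ultimately show ?thesis unfolding s_def by (simp only: pos_le_divide_eq)
      qed
      have Smeas: "emeasure \<mu> S \<le> ennreal (C4 * s ^ q)"
      proof (cases "S = {}")
        case True
        then show ?thesis by simp
      next
        case False
        then obtain z' where z': "z' \<in> S" by blast
        \<comment> \<open>\<open>S\<close> lies in the disc of radius \<open>s\<close> about any of
          its own points; that disc is compact, hence measurable.\<close>
        have "emeasure \<mu> S \<le> emeasure \<mu> {z \<in> ZH. cmod (\<theta> z - 1) \<le> 1/20 \<and> cmod (\<theta> z - \<theta> z') \<le> s}"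
        proof (rule emeasure_mono)
          show "S \<subseteq> {z \<in> ZH. cmod (\<theta> z - 1) \<le> 1/20 \<and> cmod (\<theta> z - \<theta> z') \<le> s}"
            using close[OF _ z'] unfolding S_def by auto
          show "{z \<in> ZH. cmod (\<theta> z - 1) \<le> 1/20 \<and> cmod (\<theta> z - \<theta> z') \<le> s} \<in> sets \<mu>"
            by (rule compact_in_sets[OF haar compact_ZH_disc]) blast
        qed
        also have "\<dots> \<le> ennreal (C4 * s ^ q)" by (rule C4(2)[OF _ s0]) (use z' in \<open>auto simp: S_def\<close>)
        finally show ?thesis .
      qed
      have "d_H sm h e N (z0 o\<^sub>L g) < \<infinity>" using dH by (rule order.strict_trans1) simp
      then obtain d where d: "d \<ge> 0" "d_H sm h e N (z0 o\<^sub>L g) = ennreal d" by (cases "d_H sm h e N (z0 o\<^sub>L g)") auto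
      have d0: "d > 0" using dnz d by (cases "d = 0") auto
      have uq: "norm u ^ q > 0" using u0 by simp
      have dle: "d \<le> C2 * norm u ^ q" using dH unfolding d using C2(1) uq by (simp add: ennreal_le_iff)
      have "C4 * s ^ q = C4 * (16 * C3 / c) ^ q * (r / norm u ^ q)"
      proof -
        have "s = (16 * C3 / c) * (\<rho> / norm u)" unfolding s_def by simp
        then have "s ^ q = (16 * C3 / c) ^ q * (\<rho> ^ q / norm u ^ q)" by (simp only: power_mult_distrib power_divide)
        then show ?thesis unfolding rho(2) by simp
      qed
      also have "\<dots> \<le> C4 * (16 * C3 / c) ^ q * (C2 * (r / d))"
      proof (rule mult_left_mono)
        have "r / norm u ^ q = C2 * (r / (C2 * norm u ^ q))" using C2(1) by simp
        also have "\<dots> \<le> C2 * (r / d)" using dle d0 r C2(1) by (intro mult_left_mono divide_left_mono) auto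
        finally show "r / norm u ^ q \<le> C2 * (r / d)" .
        show "0 \<le> C4 * (16 * C3 / c) ^ q" using C4(1) C3 c by simp
      qed
      also have "\<dots> = C * (r / d)" unfolding C_def by simp
      finally have fin: "C4 * s ^ q \<le> C * (r / d)" .
      have "ennreal C * (ennreal r / d_H sm h e N (z0 o\<^sub>L g)) = ennreal (C * (r / d))"
        unfolding d divide_ennreal[OF less_imp_le[OF r(1)] d0] using C r d0
        by (intro ennreal_mult[symmetric]) auto
      then show ?thesis unfolding S_def[symmetric] using order_trans[OF Smeas ennreal_leI[OF fin]] by (simp only:)
    qed
  qed
  then show ?thesis using eps r0 C by blast
qed

end

section \<open>Anisotropic vectors, and the degenerate case\<close>

lemma (in GGP_frame) ex_anisotropic:
  assumes "VH \<noteq> {0}"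
  shows "\<exists>v y. v \<in> VH \<and> h v v * y = 1"
proof (rule ccontr)
  assume neg: "\<not> ?thesis"
  have z: "h v v = 0" if "v \<in> VH" for v using neg that h_self_unit by blast
  have "0 \<in> VH" unfolding VH_def by (simp add: h_simps)
  then obtain v where v: "v \<in> VH" "v \<noteq> 0" using assms by blast
  have "h v w = 0" if w: "w \<in> VH" for w
  proof -
    \<comment> \<open>Polarisation only kills \<open>h x w + h w x\<close>. Using it for
      \<open>\<delta> v\<close> as well turns the sum into a difference, and together they kill both
      coordinates of \<open>h v w\<close>, which puts \<open>v\<close> in the radical.\<close>
    have s: "h x w + h w x = 0" if x: "x \<in> VH" for x
    proof -
      have "h (x + w) (x + w) = h x x + (h x w + h w x) + h w w" by (simp add: h_simps algebra_simps)
      then show ?thesis using z[OF VH_closed(1)[OF x w]] z[OF x] z[OF w] by simp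
    qed
    have 1: "p (h v w) + p (h w v) = 0" using s[OF v(1)] p_add p_0 by metis
    have "\<delta> * h v w + - (\<delta> * h w v) = 0" using s[OF VH_closed(2)[OF v(1)], of \<delta>] by (simp add: h_simps sigma_delta)
    then have "p (\<delta> * h v w + - (\<delta> * h w v)) = 0" using p_0 by simp
    then have "\<omega> * (p (h v w) - p (h w v)) = 0" by (simp add: p_diff p_mult p_delta right_diff_distrib)
    then have 2: "p (h v w) = p (h w v)" using omega_sq(3) by simp
    have "p (h v w) = 0" using 1 unfolding 2 by simp
    then show ?thesis using 2 by (intro p_inj) (simp_all add: h_sigma)
  qed
  moreover have "h v (sm a e) = 0" for a using VH_h_left[OF v(1)] by (simp add: h_simps)
  ultimately have "h v w = 0" for w
    using projH_decomp[of w] projH_VH[of w] by (metis add_0 h_add_right)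
  then show False using nondeg v(2) by blast
qed

theorem theorem15:
  fixes F :: "complex set"
    and \<iota> :: "complex \<Rightarrow> 'e::comm_ring_1"
    and \<sigma> :: "'e \<Rightarrow> 'e"
    and sm :: "'e \<Rightarrow> 'v::euclidean_space \<Rightarrow> 'v"
    and h :: "'v \<Rightarrow> 'v \<Rightarrow> 'e"
    and n :: nat
    and e :: 'v
    and \<mu> :: "('v \<Rightarrow>\<^sub>L 'v) measure"
    and ip :: "'v functional \<Rightarrow> 'v functional \<Rightarrow> real"
    and N :: "'v \<Rightarrow> real"
    and K :: "'v functional set"
  assumes "unitary_GGP_pair F \<iota> \<sigma> sm h n e"
    and "is_haar_measure (group_center (grp_H sm h e)) \<mu>"
    and "is_inner_product_on_dual sm h ip"
    and "is_F_norm F \<iota> sm N"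
    and "compact K"
    and "K \<subseteq> lie_dual_stab F \<iota> sm h e"
  shows "\<exists>\<Z> U r0 C.
      is_neighborhood (top_of_set (group_center (grp_H sm h e))) \<one>\<^bsub>grp_H sm h e\<^esub> \<Z> \<and>
      \<Z> \<in> sets \<mu> \<and>
      is_neighborhood (adjoint_topology (grp_G sm h)) \<one>\<^bsub>adjoint_group (grp_G sm h)\<^esub> U \<and>
      (r0::real) > 0 \<and> (C::real) > 0 \<and>
      (\<forall>\<tau>\<in>K. \<forall>gZ\<in>U. \<forall>g\<in>gZ. \<forall>r. 0 < r \<and> r < r0 \<longrightarrow>
         emeasure \<mu> {z \<in> \<Z>. dist_F F ip (coad sm h (g o\<^sub>L z) \<tau>) (H_orbit sm h e \<tau>) \<le> r}
           \<le> ennreal C * (ennreal r / d_H sm h e N g))"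
proof -
  interpret unitary_GGP_pair F \<iota> \<sigma> sm h n e by (rule assms(1))
  obtain p \<delta> \<omega> where "GGP_coordinates F \<iota> \<sigma> sm h n e p \<delta> \<omega>" using ex_coordinates by blast
  then interpret GGP_coordinates F \<iota> \<sigma> sm h n e p \<delta> \<omega> .
  obtain B f where Bf: "finite B" "\<And>v. v = (\<Sum>b\<in>B. sm (h v (f b)) b)" using ex_dual_frame by blast
  interpret GGP_frame F \<iota> \<sigma> sm h n e p \<delta> \<omega> B f
    by unfold_locales (use Bf in auto)
  let ?q = "\<lambda>g. ZG #>\<^bsub>grp_G sm h\<^esub> g"
  show ?thesis
  proof (cases "VH = {0}")
    \<comment> \<open>Every unitary operator then maps \<open>e\<close> to a norm-one multiple of
      itself, so \<open>d_H\<close> is identically 0 and the bound is infinite.\<close>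
    case True
    have dH: "d_H sm h e N g = 0" if g: "g \<in> GU" for g
    proof -
      have N0: "N 0 = 0"
      proof -
        obtain C where "0 \<le> N 0 \<and> N 0 \<le> (C * norm (0::'v)) ^ deg_over_real F"
          using F_norm_bound[OF assms(4)] by blast
        then show ?thesis by (simp add: deg_over_real_def split: if_splits)
      qed
      have dt: "dtilde_H sm h e N k = 0" if k: "k \<in> GU" for k
      proof -
        define l where "l = coef (k e)"
        have "projH (k e) = 0" using projH_VH[of "k e"] True by simp
        then have ke: "k e = sm l e" using projH_decomp[of "k e"] unfolding l_def by simp
        have "l * \<sigma> l * h e e = h e e" using GU_h[OF k, of e e] unfolding ke by (simp add: h_simps mult_ac)
        then have "l * \<sigma> l * (h e e * ei) = h e e * ei" by (simp add: mult.assoc[symmetric])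
        then have "l * \<sigma> l = 1" unfolding h_ee_ei by simp
        then show ?thesis using dtilde_H_scaled[OF ke _ h_ee_ei, of N] by (simp add: projH_e sm_zero_right N0)
      qed
      show ?thesis unfolding d_H_def using dt[OF g] dt[OF gi_GU[OF g]] by (simp add: gi_def)
    qed
    have "is_neighborhood (top_of_set ZH) \<one>\<^bsub>grp_H sm h e\<^esub> ZH"
      unfolding is_neighborhood_def mult_G using GU_id
      by (auto simp: group_center_def carrier_H mult_G interior_of_openin openin_subtopology_self intro!: blinfun_eqI)
    moreover have "ZH \<in> sets \<mu>" using assms(2) unfolding is_haar_measure_def by (metis sets.top)
    moreover note adjoint_neighborhood[OF open_UNIV UNIV_I]
    moreover have "emeasure \<mu> {z \<in> ZH. dist_F F ip (coad sm h (g o\<^sub>L z) \<tau>) (H_orbit sm h e \<tau>) \<le> r}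
           \<le> ennreal 1 * (ennreal r / d_H sm h e N g)"
      if gZ: "gZ \<in> ?q ` (GU \<inter> UNIV)" and g: "g \<in> gZ" and r: "0 < r \<and> r < (1::real)" for \<tau> gZ g r
    proof -
      obtain z0 g0 where "z0 \<in> ZG" "g0 \<in> GU" "g = z0 o\<^sub>L g0" using gZ g coset_elem by auto
      then have "d_H sm h e N g = 0" using dH GU_compose center_G_scalar(1) by blast
      then show ?thesis using r by simp
    qed
    ultimately show ?thesis using zero_less_one by (intro exI conjI ballI allI impI) assumption+
  next
    case False
    then obtain v1 y1 where v1: "v1 \<in> VH" "h v1 v1 * y1 = 1" using ex_anisotropic by blast
    interpret GGP_anisotropic F \<iota> \<sigma> sm h n e p \<delta> \<omega> B f v1 y1
      by unfold_locales (use v1 in auto)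
    obtain \<epsilon> r0 C where eps: "\<epsilon> > 0" and r0: "r0 > 0" and C: "C > 0"
      and bound: "\<forall>\<tau>\<in>K. \<forall>g\<in>GU. \<forall>z0\<in>ZG. norm (g - id_blinfun) < \<epsilon> \<longrightarrow>
     (\<forall>r. 0 < r \<and> r < r0 \<longrightarrow>
       emeasure \<mu> {z \<in> {z \<in> ZH. cmod (\<theta> z - 1) \<le> 1/20}.
           dist_F F ip (coad sm h ((z0 o\<^sub>L g) o\<^sub>L z) \<tau>) (H_orbit sm h e \<tau>) \<le> r}
         \<le> ennreal C * (ennreal r / d_H sm h e N (z0 o\<^sub>L g)))"
      using volume_bound[OF assms(2-6)] by (elim exE conjE) (rule that)
    let ?Z = "{z \<in> ZH. cmod (\<theta> z - 1) \<le> 1/20}"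
    let ?W = "{g. norm (g - id_blinfun) < \<epsilon>}"
    have "is_neighborhood (top_of_set ZH) \<one>\<^bsub>grp_H sm h e\<^esub> ?Z"
    proof -
      have "open {z. cmod (\<theta> z - 1) < 1/20}"
        by (intro open_Collect_less continuous_intros continuous_theta)
      then have "openin (top_of_set ZH) (ZH \<inter> {z. cmod (\<theta> z - 1) < 1/20})" by (rule openin_open_Int)
      moreover have "id_blinfun \<in> ZH \<inter> {z. cmod (\<theta> z - 1) < 1/20}" using ZH_id theta_id by simp
      moreover have "ZH \<inter> {z. cmod (\<theta> z - 1) < 1/20} \<subseteq> ?Z" by auto
      ultimately show ?thesis unfolding is_neighborhood_def mult_G interior_of_def by auto
    qed
    moreover have "?Z \<in> sets \<mu>"
    proof (rule compact_in_sets[OF assms(2)])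
      have "?Z = {z \<in> ZH. cmod (\<theta> z - 1) \<le> 1/20 \<and> cmod (\<theta> z - 1) \<le> 1/20}" by simp
      then show "compact ?Z" using compact_ZH_disc[of 1 "1/20"] by simp
    qed blast
    moreover have "is_neighborhood (adjoint_topology (grp_G sm h)) \<one>\<^bsub>adjoint_group (grp_G sm h)\<^esub> (?q ` (GU \<inter> ?W))"
    proof (rule adjoint_neighborhood)
      show "open ?W" by (intro open_Collect_less continuous_intros)
    qed (use eps in simp)
    moreover have "emeasure \<mu> {z \<in> ?Z. dist_F F ip (coad sm h (g o\<^sub>L z) \<tau>) (H_orbit sm h e \<tau>) \<le> r}
           \<le> ennreal C * (ennreal r / d_H sm h e N g)"
      if tau: "\<tau> \<in> K" and gZ: "gZ \<in> ?q ` (GU \<inter> ?W)" and g: "g \<in> gZ" and r: "0 < r \<and> r < r0" for \<tau> gZ g r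
    proof -
      \<comment> \<open>An arbitrary lift of a class in the image of the ball: the central factor
        \<open>z0\<close> is unrestricted, only \<open>g0\<close> is close to the identity.\<close>
      obtain z0 g0 where g0: "z0 \<in> ZG" "g0 \<in> GU" "norm (g0 - id_blinfun) < \<epsilon>" "g = z0 o\<^sub>L g0"
        using gZ g coset_elem by auto
      show ?thesis unfolding g0(4) by (rule bound[rule_format, OF tau g0(2,1,3) r])
    qed
    ultimately show ?thesis using r0 C by (intro exI conjI ballI allI impI) assumption+
  qed
qed

end
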